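(* Let $k$ be a field of characteristic zero, let $\{s(n)\}_{n\ge 2}$ be a sequence of positive integers, let $X,\zeta_0,\zeta_1$ be algebraically independent over $k$, and define $\zeta_n\in k(X,\zeta_0,\zeta_1)$ for $n\ge 2$ recursively by $$X\zeta_n=\zeta_{n-1}^{s(n)}+\zeta_{n-2}.$$ Let $J_n=k[X,\zeta_{n-1},\zeta_n]$ for $n\ge 1$ and let $J=\bigcup_{n\ge 1}J_n\subseteq k(X,\zeta_0,\zeta_1)$ (David's $3$-dimensional non-Noetherian factorial domain). Then $J$ is locally Jaffard.
   Context: An integral domain $D$ of finite Krull dimension is a Jaffard domain if $\dim D[X_1,\dots,X_n]=n+\dim D$ for every $n\ge 1$; equivalently, if $\dim D=\dim_v D$, where the valuative dimension $\dim_v D$ is the supremum of $\dim V$ over all valuation rings $V$ with $D\subseteq V\subseteq\operatorname{Frac}(D)$ and $\operatorname{Frac}(V)=\operatorname{Frac}(D)$. $D$ is locally Jaffard if $D_P$ is a Jaffard domain for every prime ideal $P$ of $D$. The recurrence gives $\zeta_{n-2}=X\zeta_n-\zeta_{n-1}^{s(n)}$, so $J_{n-1}\subseteq J_n$ and $J_n\subseteq J\subseteq J_n[X^{-1}]$ for every $n$. *)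

theory Defs
  imports
    "HOL-Algebra.Generated_Rings"
    "HOL-Algebra.Algebraic_Closure_Type"
    "HOL-Library.Poly_Mapping"
    "HOL-Library.Extended_Nat"
begin

definition sub_ring :: "'a::ring_1 set \<Rightarrow> 'a ring" where
  "sub_ring S = ring_of_type_algebra\<lparr>carrier := S\<rparr>"

(* The chain P 0 < ... < P n has length n: strict inclusions are counted, not primes.
   The supremum is \<infinity> for unbounded chain lengths, and 0 for the zero ring. *)
definition krull_dim :: "('a, 'b) ring_scheme \<Rightarrow> enat" where
  "krull_dim R = Sup {enat n | n. \<exists>P :: nat \<Rightarrow> 'a set.
     (\<forall>i\<le>n. primeideal (P i) R) \<and> (\<forall>i<n. P i \<subset> P (Suc i))}"

(* A monomial is an exponent vector nat \<Rightarrow>\<^sub>0 nat and a polynomial maps monomials to coefficients;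
   multiplication on this type is convolution. mpolys D n is D[X_0, ..., X_(n-1)], and
   using one type for all n keeps the number of variables an ordinary parameter. *)
type_synonym 'a mpoly_type = "(nat \<Rightarrow>\<^sub>0 nat) \<Rightarrow>\<^sub>0 'a"

definition mpolys :: "'a::comm_ring_1 set \<Rightarrow> nat \<Rightarrow> 'a mpoly_type set" where
  "mpolys D n = {p. (\<forall>m. Poly_Mapping.lookup p m \<in> D) \<and>
     (\<forall>m \<in> Poly_Mapping.keys p. Poly_Mapping.keys m \<subseteq> {..<n})}"

definition mpoly_eval :: "(nat \<Rightarrow> 'a) \<Rightarrow> 'a::comm_ring_1 mpoly_type \<Rightarrow> 'a" where
  "mpoly_eval x p = (\<Sum>m \<in> Poly_Mapping.keys p.
     Poly_Mapping.lookup p m * (\<Prod>i \<in> Poly_Mapping.keys m. x i ^ Poly_Mapping.lookup m i))"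

(* The family xs ! 0, ..., xs ! (length xs - 1) is algebraically independent over k. *)
definition alg_independent :: "'a::field set \<Rightarrow> 'a list \<Rightarrow> bool" where
  "alg_independent k xs \<longleftrightarrow>
     (\<forall>p \<in> mpolys k (length xs). mpoly_eval (\<lambda>i. xs ! i) p = 0 \<longrightarrow> p = 0)"

(* Integral domains are represented as subrings D of a field. *)
definition jaffard_domain :: "'a::field set \<Rightarrow> bool" where
  "jaffard_domain D \<longleftrightarrow>
     domain (sub_ring D) \<and> krull_dim (sub_ring D) < \<infinity> \<and>
     (\<forall>n\<ge>1. krull_dim (sub_ring (mpolys D n)) = enat n + krull_dim (sub_ring D))"

(* The localization of D at a prime ideal P, inside the ambient field. The denominators are
   nonzero because 0 \<in> P. *)
definition localization_at :: "'a::field set \<Rightarrow> 'a set \<Rightarrow> 'a set" where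
  "localization_at D P = {a / b | a b. a \<in> D \<and> b \<in> D - P}"

definition locally_jaffard :: "'a::field set \<Rightarrow> bool" where
  "locally_jaffard D \<longleftrightarrow> domain (sub_ring D) \<and>
     (\<forall>P. primeideal P (sub_ring D) \<longrightarrow> jaffard_domain (localization_at D P))"

(* k[A], for a subring k of the ambient field. *)
definition adjoin :: "'a::field set \<Rightarrow> 'a set \<Rightarrow> 'a set" where
  "adjoin k A = generate_ring ring_of_type_algebra (k \<union> A)"

definition david_J_n :: "'a::field set \<Rightarrow> 'a \<Rightarrow> (nat \<Rightarrow> 'a) \<Rightarrow> nat \<Rightarrow> 'a set" where
  "david_J_n k x \<zeta> n = adjoin k {x, \<zeta> (n - 1), \<zeta> n}"

definition david_J :: "'a::field set \<Rightarrow> 'a \<Rightarrow> (nat \<Rightarrow> 'a) \<Rightarrow> 'a set" where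
  "david_J k x \<zeta> = (\<Union>n\<in>{1..}. david_J_n k x \<zeta> n)"

end

theory Submission
  imports Defs "HOL-Computational_Algebra.Polynomial"
begin

text \<open>Adjoining \<open>n\<close> variables always raises the dimension by at least \<open>n\<close>, so only upper bounds matter. Let \<open>P\<close> be 
  a prime of \<open>J\<close> and \<open>R = J\<^sub>P\<close>. There are two sources of upper bounds.

  First, \<open>J\<close> is the directed union of the polynomial rings \<open>J\<^sub>i\<close> in three variables, and a chain of primes of 
  \<open>R[Y\<^sub>1, \<dots>, Y\<^sub>n]\<close> remains strict when contracted to \<open>J\<^sub>i[Y\<^sub>1, \<dots>, Y\<^sub>n]\<close> for large \<open>i\<close>; so its length is at 
  most \<open>n + 3\<close>, and \<open>R\<close> is Jaffard if \<open>P\<close> has height 3. Second, \<open>R\<close> is Jaffard if it is Noetherian: if 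
  \<open>p \<subset> q\<close> are adjacent primes of a Noetherian ring, no prime lies strictly between \<open>p[Z]\<close> and \<open>q[Z]\<close>, by a 
  growth estimate for lengths in the manner of Krull and Akizuki.

  If \<open>X \<notin> P\<close>, then \<open>R\<close> is a localization of \<open>J\<^sub>1\<close>. The ideal \<open>XJ\<close> is prime, because modulo \<open>X\<close> the ring \<open>J\<close> 
  becomes the union of the polynomial rings \<open>k[\<zeta>\<^sub>n]\<close>, and \<open>Q = (\<Inter>e. X\<^sup>e J)\<close> is prime. For \<open>P = XJ\<close>, the ring 
  \<open>R\<close> is a discrete valuation ring if \<open>Q = 0\<close>; otherwise \<open>P\<close> has height 2, and \<open>J\<^sub>i\<close> may be replaced by 
  \<open>k(\<zeta>\<^sub>i)[X, \<zeta>\<^sub>i\<^sub>-\<^sub>1]\<close>, which improves the bound to \<open>n + 2\<close>. (The case \<open>Q \<noteq> 0\<close> does occur, for instance if all 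
  \<open>s(n) = 1\<close>.) For \<open>XJ \<subset> P\<close>, suppose that the height is not 3. Then \<open>Q = 0\<close> and no \<open>\<zeta>\<^sub>n\<close> lies in \<open>P\<close>, so that in
  characteristic 0 the ring \<open>R/XR\<close> is a discrete valuation ring. The primes of \<open>R\<close> that do not contain \<open>X\<close> are
  principal by unique factorization in \<open>J\<^sub>1\<close>, and \<open>R\<close> is Noetherian by Cohen's theorem.\<close>

section \<open>Subrings, ideals and chains of primes as sets\<close>

text \<open>A new variable can raise the dimension of a non-Noetherian ring by more than one, so the
  upper bounds for the localizations of J have to come from elsewhere. The union bound
  \<open>n + 3\<close> takes no account of the height of P and is sharp in height 3 only; in smaller
  height one has to find either better approximating rings or a Noetherian localization. For
  \<open>xJ \<subset> P\<close> the assumption that the height is not 3 works as a tool. It keeps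
  every \<open>z n\<close> out of P, because x together with one zeta forces all of them into P and
  yields the chain 0, (z_0), (z_0, z_1), P of primes extended from \<open>B 0\<close>. It excludes a
  nonzero Q, which would give the chain 0, Q, xJ, P. And it gives the nonzero primes without x below
  P height one. Few primes are then left below P, and primes are all that Cohen's theorem inspects.

  When one variable is adjoined to a Noetherian ring A, the danger is a prime of A[Z] inside q[Z]
  that lies over p but is larger than p[Z]. The growth estimate is aimed at exactly this. Residue
  rings modulo p and localizations at q are represented there by saturated ideals of A
  itself.\<close>

definition subring_on :: "'r::comm_ring_1 set \<Rightarrow> bool" where
  "subring_on A \<longleftrightarrow> 0 \<in> A \<and> 1 \<in> A \<and>
     (\<forall>a\<in>A. \<forall>b\<in>A. a + b \<in> A \<and> a * b \<in> A \<and> a - b \<in> A)"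

definition ideal_in :: "'r::comm_ring_1 set \<Rightarrow> 'r set \<Rightarrow> bool" where
  "ideal_in I A \<longleftrightarrow> I \<subseteq> A \<and> 0 \<in> I \<and> (\<forall>a\<in>I. \<forall>b\<in>I. a + b \<in> I) \<and> (\<forall>r\<in>A. \<forall>a\<in>I. r * a \<in> I)"

definition prime_in :: "'r::comm_ring_1 set \<Rightarrow> 'r set \<Rightarrow> bool" where
  "prime_in P A \<longleftrightarrow> ideal_in P A \<and> 1 \<notin> P \<and> (\<forall>a\<in>A. \<forall>b\<in>A. a * b \<in> P \<longrightarrow> a \<in> P \<or> b \<in> P)"

definition prime_chain :: "'r::comm_ring_1 set \<Rightarrow> nat \<Rightarrow> (nat \<Rightarrow> 'r set) \<Rightarrow> bool" where
  "prime_chain A n P \<longleftrightarrow> (\<forall>i\<le>n. prime_in (P i) A) \<and> (\<forall>i<n. P i \<subset> P (Suc i))"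

definition has_chain :: "'r::comm_ring_1 set \<Rightarrow> nat \<Rightarrow> bool" where
  "has_chain A n \<longleftrightarrow> (\<exists>P. prime_chain A n P)"

definition dim_le :: "'r::comm_ring_1 set \<Rightarrow> nat \<Rightarrow> bool" where
  "dim_le A d \<longleftrightarrow> (\<forall>n. has_chain A n \<longrightarrow> n \<le> d)"

text \<open>Well-foundedness of reverse inclusion gives both the maximal condition and Noetherian
  induction directly. Finite generation enters only through \<open>Cohen\<close>.\<close>

definition noeth :: "'r::comm_ring_1 set \<Rightarrow> bool" where
  "noeth A \<longleftrightarrow> wf {(I, J). ideal_in I A \<and> ideal_in J A \<and> J \<subset> I}"

text \<open>The laws are required on \<open>A\<close> only, so that \<open>inv_into A f\<close>,
  which is arbitrary outside the image of \<open>A\<close>, is again a homomorphism on that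
  image.\<close>

definition hom_on :: "('r::comm_ring_1 \<Rightarrow> 's::comm_ring_1) \<Rightarrow> 'r set \<Rightarrow> bool" where
  "hom_on f A \<longleftrightarrow> f 0 = 0 \<and> f 1 = 1 \<and> (\<forall>a\<in>A. \<forall>b\<in>A. f (a + b) = f a + f b \<and> f (a * b) = f a * f b)"

lemma subring_on_0 [intro]: "subring_on A \<Longrightarrow> 0 \<in> A"
  and subring_on_1 [intro]: "subring_on A \<Longrightarrow> 1 \<in> A"
  and subring_on_add [intro]: "subring_on A \<Longrightarrow> a \<in> A \<Longrightarrow> b \<in> A \<Longrightarrow> a + b \<in> A"
  and subring_on_mult [intro]: "subring_on A \<Longrightarrow> a \<in> A \<Longrightarrow> b \<in> A \<Longrightarrow> a * b \<in> A"
  and subring_on_diff [intro]: "subring_on A \<Longrightarrow> a \<in> A \<Longrightarrow> b \<in> A \<Longrightarrow> a - b \<in> A"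
  by (auto simp: subring_on_def)

lemma subring_on_uminus [intro]: "subring_on A \<Longrightarrow> a \<in> A \<Longrightarrow> - a \<in> A"
  using subring_on_diff[of A 0 a] by auto

lemma subring_on_power [intro]: "subring_on A \<Longrightarrow> a \<in> A \<Longrightarrow> a ^ n \<in> A"
  by (induction n) auto

lemma subring_on_sum [intro]: "subring_on A \<Longrightarrow> (\<And>i. i \<in> S \<Longrightarrow> f i \<in> A) \<Longrightarrow> sum f S \<in> A"
  by (induction S rule: infinite_finite_induct) auto

lemma subring_on_of_nat [intro]: "subring_on A \<Longrightarrow> of_nat n \<in> A"
  by (induction n) auto

lemma subring_onI:
  assumes "1 \<in> A" "\<And>a b. a \<in> A \<Longrightarrow> b \<in> A \<Longrightarrow> a + b \<in> A" "\<And>a b. a \<in> A \<Longrightarrow> b \<in> A \<Longrightarrow> a * b \<in> A"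
    "\<And>a. a \<in> A \<Longrightarrow> - a \<in> A"
  shows "subring_on A"
proof -
  have "1 + - 1 \<in> A" using assms by blast
  moreover have "a - b \<in> A" if "a \<in> A" "b \<in> A" for a b
    using assms(2)[of a "- b"] assms(4) that by simp
  ultimately show ?thesis using assms unfolding subring_on_def by simp
qed

lemma ideal_in_sub: "ideal_in I A \<Longrightarrow> a \<in> I \<Longrightarrow> a \<in> A"
  and ideal_in_0: "ideal_in I A \<Longrightarrow> 0 \<in> I"
  and ideal_in_add: "ideal_in I A \<Longrightarrow> a \<in> I \<Longrightarrow> b \<in> I \<Longrightarrow> a + b \<in> I"
  and ideal_in_mult: "ideal_in I A \<Longrightarrow> r \<in> A \<Longrightarrow> a \<in> I \<Longrightarrow> r * a \<in> I"
  by (auto simp: ideal_in_def)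

lemma ideal_in_mult': "ideal_in I A \<Longrightarrow> r \<in> A \<Longrightarrow> a \<in> I \<Longrightarrow> a * r \<in> I"
  by (metis ideal_in_mult mult.commute)

lemma ideal_in_uminus: "subring_on A \<Longrightarrow> ideal_in I A \<Longrightarrow> a \<in> I \<Longrightarrow> - a \<in> I"
  using ideal_in_mult[of I A "-1" a] by auto

lemma ideal_in_diff: "subring_on A \<Longrightarrow> ideal_in I A \<Longrightarrow> a \<in> I \<Longrightarrow> b \<in> I \<Longrightarrow> a - b \<in> I"
  using ideal_in_add[of I A a "- b"] ideal_in_uminus[of A I b] by auto

lemma ideal_in_sum: "ideal_in I A \<Longrightarrow> (\<And>i. i \<in> S \<Longrightarrow> f i \<in> I) \<Longrightarrow> sum f S \<in> I"
  by (induction S rule: infinite_finite_induct) (auto intro: ideal_in_add ideal_in_0)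

lemma ideal_in_add_cancel: 
  "subring_on A \<Longrightarrow> ideal_in I A \<Longrightarrow> a + b \<in> I \<Longrightarrow> b \<in> I \<Longrightarrow> a \<in> I"
  using ideal_in_diff[of A I "a + b" b] by simp

lemma ideal_in_diff_cancel: 
  "subring_on A \<Longrightarrow> ideal_in I A \<Longrightarrow> a - b \<in> I \<Longrightarrow> b \<in> I \<Longrightarrow> a \<in> I"
  using ideal_in_add[of I A "a - b" b] by simp

lemma ideal_in_diff_cancel': 
  "subring_on A \<Longrightarrow> ideal_in I A \<Longrightarrow> a - b \<in> I \<Longrightarrow> a \<in> I \<Longrightarrow> b \<in> I"
  using ideal_in_diff[of A I a "a - b"] by simp

lemma prime_in_ideal: "prime_in P A \<Longrightarrow> ideal_in P A"
  and prime_in_1: "prime_in P A \<Longrightarrow> 1 \<notin> P"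
  and prime_in_mult: "prime_in P A \<Longrightarrow> a \<in> A \<Longrightarrow> b \<in> A \<Longrightarrow> a * b \<in> P \<Longrightarrow> a \<in> P \<or> b \<in> P"
  by (auto simp: prime_in_def)

lemma prime_in_power: 
  assumes "prime_in P A" "subring_on A" "a \<in> A" "a ^ n \<in> P" shows "a \<in> P"
  using assms(4)
proof (induction n)
  case 0 then show ?case using prime_in_1[OF assms(1)] by simp
next
  case (Suc n) then show ?case using prime_in_mult[OF assms(1), of a "a^n"] assms by auto
qed

lemma ideal_in_zero: "subring_on A \<Longrightarrow> ideal_in {0} A"
  by (auto simp: ideal_in_def)

lemma prime_in_zero: "subring_on (A :: 'r::idom set) \<Longrightarrow> prime_in {0} A"
  by (auto simp: prime_in_def ideal_in_zero)

definition princ :: "'r::comm_ring_1 set \<Rightarrow> 'r \<Rightarrow> 'r set" where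
  "princ A a = (\<lambda>r. r * a) ` A"

lemma princ_ideal: assumes "subring_on A" "a \<in> A" shows "ideal_in (princ A a) A"
proof -
  have "x * a + y * a \<in> (\<lambda>r. r * a) ` A" if "x \<in> A" "y \<in> A" for x y
    using that assms by (intro image_eqI[of _ _ "x + y"]) (auto simp: algebra_simps)
  moreover have "r * (x * a) \<in> (\<lambda>r. r * a) ` A" if "x \<in> A" "r \<in> A" for x r
    using that assms by (intro image_eqI[of _ _ "r * x"]) (auto simp: algebra_simps)
  moreover have "0 \<in> (\<lambda>r. r * a) ` A"
    using assms by (intro image_eqI[of _ _ 0]) auto
  ultimately show ?thesis using assms unfolding ideal_in_def princ_def by auto
qed

lemma princ_self: "subring_on A \<Longrightarrow> a \<in> princ A a"
  unfolding princ_def by (rule image_eqI[of _ _ 1]) auto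

lemma princ_least: "ideal_in I A \<Longrightarrow> a \<in> I \<Longrightarrow> princ A a \<subseteq> I"
  by (auto simp: princ_def ideal_in_mult)

lemma hom_on_0: "hom_on f A \<Longrightarrow> f 0 = 0"
  and hom_on_1: "hom_on f A \<Longrightarrow> f 1 = 1"
  and hom_on_add: "hom_on f A \<Longrightarrow> a \<in> A \<Longrightarrow> b \<in> A \<Longrightarrow> f (a + b) = f a + f b"
  and hom_on_mult: "hom_on f A \<Longrightarrow> a \<in> A \<Longrightarrow> b \<in> A \<Longrightarrow> f (a * b) = f a * f b"
  by (auto simp: hom_on_def)

lemma hom_on_uminus:
  assumes "hom_on f A" "subring_on A" "a \<in> A" shows "f (- a) = - f a"
proof -
  have "f (a + - a) = f a + f (- a)" using assms by (intro hom_on_add) auto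
  then show ?thesis using hom_on_0[OF assms(1)] by (simp add: eq_neg_iff_add_eq_0 add.commute)
qed

lemma subring_on_image: 
  assumes "hom_on f A" "subring_on A" shows "subring_on (f ` A)"
proof (rule subring_onI)
  show "1 \<in> f ` A" using hom_on_1[OF assms(1)] assms(2) by (metis image_eqI subring_on_1)
  fix a b assume "a \<in> f ` A" "b \<in> f ` A"
  then obtain c d where cd: "a = f c" "c \<in> A" "b = f d" "d \<in> A" by blast
  show "a + b \<in> f ` A" using cd hom_on_add[OF assms(1)] assms(2) by (metis image_eqI subring_on_add)
  show "a * b \<in> f ` A" using cd hom_on_mult[OF assms(1)] assms(2) by (metis image_eqI subring_on_mult)
next
  fix a assume "a \<in> f ` A"
  then show "- a \<in> f ` A" using hom_on_uminus[OF assms] assms(2) by (metis (full_types) imageE image_eqI subring_on_uminus)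
qed

lemma hom_on_id: "hom_on (\<lambda>x. x) A"
  by (auto simp: hom_on_def)

lemma contract_ideal:
  assumes "hom_on f A" "subring_on A" "f ` A \<subseteq> B" "ideal_in I B"
  shows "ideal_in {a\<in>A. f a \<in> I} A"
  using assms by (auto simp: ideal_in_def hom_on_def image_subset_iff)

lemma contract_prime:
  assumes "hom_on f A" "subring_on A" "f ` A \<subseteq> B" "prime_in P B"
  shows "prime_in {a\<in>A. f a \<in> P} A"
  using contract_ideal[OF assms(1-3) prime_in_ideal[OF assms(4)]] assms
  by (auto simp: prime_in_def hom_on_def image_subset_iff)

lemma hom_on_inv:
  assumes "hom_on f A" "inj_on f A" "subring_on A"
  shows "hom_on (inv_into A f) (f ` A)"
proof -
  let ?g = "inv_into A f"
  have g: "?g (f a) = a" if "a \<in> A" for a using assms that by simp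
  have "?g 0 = 0" "?g 1 = 1"
    using g[of 0] g[of 1] assms hom_on_0[OF assms(1)] hom_on_1[OF assms(1)] by auto
  moreover have "?g (f a + f b) = ?g (f a) + ?g (f b) \<and> ?g (f a * f b) = ?g (f a) * ?g (f b)" 
    if ab: "a \<in> A" "b \<in> A" for a b
  proof -
    have "f a + f b = f (a + b)" "f a * f b = f (a * b)" using assms(1) ab by (auto simp: hom_on_def)
    moreover have "a + b \<in> A" "a * b \<in> A" using ab assms(3) by auto
    ultimately show ?thesis using g ab by simp
  qed
  ultimately show ?thesis unfolding hom_on_def by auto
qed

lemma inv_into_image: "inj_on f A \<Longrightarrow> inv_into A f ` f ` A = A"
  by (force simp: image_iff)

text \<open>Contraction can only fail by collapsing an inclusion, and one witness from the smaller
  ring for each step prevents this. Surjections and directed unions supply the witnesses in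
  different ways.\<close>

lemma contract_chain:
  assumes "hom_on f A" "subring_on A" "f ` A \<subseteq> B" "prime_chain B n P"
    and "\<And>i. i < n \<Longrightarrow> \<exists>a\<in>A. f a \<in> P (Suc i) \<and> f a \<notin> P i"
  shows "prime_chain A n (\<lambda>i. {a\<in>A. f a \<in> P i})"
  unfolding prime_chain_def
proof (intro conjI allI impI)
  fix i assume "i \<le> n" then show "prime_in {a \<in> A. f a \<in> P i} A"
    using assms(4) contract_prime[OF assms(1-3)] by (auto simp: prime_chain_def)
next
  fix i assume i: "i < n"
  have "P i \<subseteq> P (Suc i)" using assms(4) i by (auto simp: prime_chain_def)
  then show "{a \<in> A. f a \<in> P i} \<subset> {a \<in> A. f a \<in> P (Suc i)}" using assms(5)[OF i] by auto
qed

lemma has_chain_surj: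
  assumes "hom_on f A" "subring_on A" "f ` A = B" "has_chain B n" shows "has_chain A n"
proof -
  obtain P where P: "prime_chain B n P" using assms by (auto simp: has_chain_def)
  have "\<exists>a\<in>A. f a \<in> P (Suc i) \<and> f a \<notin> P i" if "i < n" for i
  proof -
    have "prime_in (P (Suc i)) B" "P i \<subset> P (Suc i)" using P that by (auto simp: prime_chain_def)
    then show ?thesis using assms(3) prime_in_ideal ideal_in_sub by blast
  qed
  then show ?thesis using contract_chain[OF assms(1,2) _ P] assms(3) unfolding has_chain_def by blast
qed

lemma has_chain_iso:
  assumes "hom_on f A" "subring_on A" "inj_on f A" shows "has_chain (f ` A) n \<longleftrightarrow> has_chain A n"
  using has_chain_surj[OF assms(1,2) refl] 
    has_chain_surj[OF hom_on_inv[OF assms(1,3,2)] subring_on_image[OF assms(1,2)] inv_into_image[OF assms(3)]] by blast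

lemma dim_le_iso:
  assumes "hom_on f A" "subring_on A" "inj_on f A" shows "dim_le (f ` A) n \<longleftrightarrow> dim_le A n"
  unfolding dim_le_def has_chain_iso[OF assms] ..

text \<open>Strict chains of ideals stay strict under an injective contraction. Quotients and
  localizations both contract injectively.\<close>

lemma noeth_contract:
  assumes "noeth A" "hom_on f A" "subring_on A" "f ` A \<subseteq> B"
    and inj: "\<And>I J. ideal_in I B \<Longrightarrow> ideal_in J B \<Longrightarrow> {a\<in>A. f a \<in> I} = {a\<in>A. f a \<in> J} \<Longrightarrow> I = J"
  shows "noeth B"
proof -
  let ?c = "\<lambda>I. {a\<in>A. f a \<in> I}"
  have "{(I, J). ideal_in I B \<and> ideal_in J B \<and> J \<subset> I} \<subseteq>
     inv_image {(I, J). ideal_in I A \<and> ideal_in J A \<and> J \<subset> I} ?c"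
  proof (rule subsetI)
    fix z assume "z \<in> {(I, J). ideal_in I B \<and> ideal_in J B \<and> J \<subset> I}"
    then obtain I J where IJ: "z = (I, J)" "ideal_in I B" "ideal_in J B" "J \<subset> I" by blast
    then have "?c J \<subseteq> ?c I" "?c J \<noteq> ?c I" using inj[of J I] by blast+
    then show "z \<in> inv_image {(I, J). ideal_in I A \<and> ideal_in J A \<and> J \<subset> I} ?c"
      using contract_ideal[OF assms(2-4)] IJ by (simp add: inv_image_def psubset_eq)
  qed
  then show ?thesis using assms(1) wf_subset[OF wf_inv_image] unfolding noeth_def by blast
qed

lemma noeth_surj:
  assumes "noeth A" "hom_on f A" "subring_on A" shows "noeth (f ` A)"
proof (rule noeth_contract[OF assms subset_refl])
  fix I J assume "ideal_in I (f ` A)" "ideal_in J (f ` A)" "{a \<in> A. f a \<in> I} = {a \<in> A. f a \<in> J}"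
  then show "I = J" using ideal_in_sub by (smt (verit) imageE mem_Collect_eq subsetI subset_antisym)
qed

lemma noeth_max:
  assumes "noeth A" "C \<noteq> {}" "\<And>I. I \<in> C \<Longrightarrow> ideal_in I A"
  obtains M where "M \<in> C" "\<And>I. I \<in> C \<Longrightarrow> M \<subseteq> I \<Longrightarrow> I = M"
proof -
  obtain z where z: "z \<in> C" using assms(2) by blast
  obtain M where M: "M \<in> C" "\<And>y. (y, M) \<in> {(I, J). ideal_in I A \<and> ideal_in J A \<and> J \<subset> I} \<Longrightarrow> y \<notin> C" 
    using wfE_min[OF assms(1)[unfolded noeth_def] z] by blast
  show ?thesis by (rule that[OF M(1)]) (use M assms(3) in blast)
qed

lemma noeth_seq:
  assumes "noeth A" "\<And>i::nat. ideal_in (I i) A" "\<And>i. I i \<subseteq> I (Suc i)"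
  obtains n where "\<And>i. i \<ge> n \<Longrightarrow> I i = I n"
proof -
  obtain M where M: "M \<in> range I" "\<And>J. J \<in> range I \<Longrightarrow> M \<subseteq> J \<Longrightarrow> J = M"
    using noeth_max[OF assms(1), of "range I"] assms(2) by blast
  then obtain n where n: "M = I n" by blast
  have "I n \<subseteq> I i" if "i \<ge> n" for i using lift_Suc_mono_le[of I n i] assms(3) that by auto
  then have "I i = I n" if "i \<ge> n" for i using M(2) n that by blast
  then show ?thesis using that by blast
qed

lemma noethI:
  assumes "\<And>I. (\<And>i::nat. ideal_in (I i) A) \<Longrightarrow> (\<And>i. I i \<subset> I (Suc i)) \<Longrightarrow> False"
  shows "noeth A"
  unfolding noeth_def wf_iff_no_infinite_down_chain using assms by blast

section \<open>Translation to \<open>primeideal\<close> and \<open>krull_dim\<close>\<close>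

lemma sub_ring_simps [simp]:
  "carrier (sub_ring S) = S" "monoid.mult (sub_ring S) = (\<lambda>x y. x * y)" "one (sub_ring S) = 1"
  "ring.zero (sub_ring S) = 0" "ring.add (sub_ring S) = (\<lambda>x y. x + y)"
  by (auto simp: sub_ring_def ring_of_type_algebra_def)

lemma cring_sub_ring:
  assumes "subring_on A" shows "cring (sub_ring A)"
proof (rule cringI)
  have neg: "\<exists>y\<in>A. y + x = 0" if "x \<in> A" for x using that assms by (intro bexI[of _ "- x"]) auto
  show "abelian_group (sub_ring A)"
    by (rule abelian_groupI) (use assms neg in \<open>auto simp: algebra_simps\<close>)
  show "comm_monoid (sub_ring A)"
    by (rule comm_monoidI) (use assms in \<open>auto simp: algebra_simps\<close>)
qed (auto simp: algebra_simps)

lemma domain_sub_ring: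
  assumes "subring_on (A :: 'r::idom set)" shows "domain (sub_ring A)"
  unfolding domain_def domain_axioms_def using cring_sub_ring[OF assms] by auto

lemma primeideal_sub_ring:
  assumes "subring_on A" shows "primeideal P (sub_ring A) \<longleftrightarrow> prime_in P A"
proof
  assume "primeideal P (sub_ring A)"
  then interpret primeideal P "sub_ring A" .
  have id: "ideal_in P A"
    using Icarr I_l_closed additive_subgroup.a_closed[OF is_additive_subgroup] additive_subgroup.zero_closed[OF is_additive_subgroup]
    by (auto simp: ideal_in_def)
  have "1 \<notin> P"
  proof
    assume "1 \<in> P"
    then have "r \<in> P" if "r \<in> A" for r using ideal_in_mult[OF id that, of 1] by simp
    then show False using I_notcarr ideal_in_sub[OF id] by auto
  qed
  then show "prime_in P A" using id I_prime by (auto simp: prime_in_def)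
next
  assume P: "prime_in P A"
  interpret cring "sub_ring A" by (rule cring_sub_ring[OF assms])
  have id: "ideal_in P A" using P by (rule prime_in_ideal)
  have "ideal P (sub_ring A)"
  proof (rule idealI)
    show "ring (sub_ring A)" by (rule ring_axioms)
    show "subgroup P (add_monoid (sub_ring A))"
    proof (rule subgroup.intro)
      fix x assume x: "x \<in> P"
      have "inv\<^bsub>add_monoid (sub_ring A)\<^esub> x = - x"
      proof (rule group.inv_equality[OF a_group])
        show "- x \<otimes>\<^bsub>add_monoid (sub_ring A)\<^esub> x = \<one>\<^bsub>add_monoid (sub_ring A)\<^esub>" by simp
      qed (use ideal_in_sub[OF id x] assms in auto)
      then show "inv\<^bsub>add_monoid (sub_ring A)\<^esub> x \<in> P" using ideal_in_uminus[OF assms id x] by simp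
    qed (use id in \<open>auto simp: ideal_in_def\<close>)
  qed (use ideal_in_mult[OF id] ideal_in_mult'[OF id] in auto)
  moreover have "A \<noteq> P" using prime_in_1[OF P] assms by auto
  ultimately show "primeideal P (sub_ring A)"
    using P by (intro primeidealI) (auto simp: prime_in_def is_cring)
qed

lemma krull_dim_sub_ring:
  assumes "subring_on A" shows "krull_dim (sub_ring A) = Sup {enat n | n. has_chain A n}"
  unfolding krull_dim_def primeideal_sub_ring[OF assms] has_chain_def prime_chain_def ..

lemma krull_dim_eqI:
  assumes "subring_on A" "has_chain A d" "dim_le A d" shows "krull_dim (sub_ring A) = enat d"
  unfolding krull_dim_sub_ring[OF assms(1)]
  by (rule antisym) (use assms in \<open>auto simp: dim_le_def intro!: Sup_least Sup_upper\<close>)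

section \<open>Polynomials with coefficients in a subring\<close>

abbreviation pcoeff :: "'r::zero poly \<Rightarrow> nat \<Rightarrow> 'r" where "pcoeff \<equiv> Polynomial.coeff"
abbreviation pdeg :: "'r::zero poly \<Rightarrow> nat" where "pdeg \<equiv> Polynomial.degree"

text \<open>The coefficient set may be any set: for an ideal \<open>P\<close> of \<open>A\<close>
  the same notation denotes the extended ideal P[Z].\<close>

definition polys_over :: "'r::comm_ring_1 set \<Rightarrow> 'r poly set" where
  "polys_over A = {p. \<forall>i. pcoeff p i \<in> A}"

text \<open>As an image of the polynomial ring, A[y] inherits dimension bounds and the Noetherian
  property for arbitrary \<open>y\<close>; under \<open>transc\<close> the map is bijective and
  lower bounds are inherited too.\<close>

definition adjoin1 :: "'r::comm_ring_1 set \<Rightarrow> 'r \<Rightarrow> 'r set" where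
  "adjoin1 A y = (\<lambda>p. poly p y) ` polys_over A"

definition transc :: "'r::comm_ring_1 set \<Rightarrow> 'r \<Rightarrow> bool" where
  "transc A y \<longleftrightarrow> (\<forall>p\<in>polys_over A. poly p y = 0 \<longrightarrow> p = 0)"

lemma polys_over_coeff: "p \<in> polys_over A \<Longrightarrow> pcoeff p i \<in> A"
  by (simp add: polys_over_def)

lemma polys_over_mono: "A \<subseteq> B \<Longrightarrow> polys_over A \<subseteq> polys_over B"
  by (auto simp: polys_over_def)

lemma subring_on_polys_over [intro]: "subring_on A \<Longrightarrow> subring_on (polys_over A)"
  by (rule subring_onI) (auto simp: polys_over_def coeff_mult intro!: subring_on_sum)

lemma polys_over_const: "subring_on A \<Longrightarrow> a \<in> A \<Longrightarrow> [:a:] \<in> polys_over A"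
  by (auto simp: polys_over_def coeff_pCons split: nat.split)

lemma polys_over_monom: "subring_on A \<Longrightarrow> a \<in> A \<Longrightarrow> Polynomial.monom a n \<in> polys_over A"
  by (auto simp: polys_over_def)

lemma polys_over_pCons: "p \<in> polys_over A \<Longrightarrow> a \<in> A \<Longrightarrow> pCons a p \<in> polys_over A"
  by (auto simp: polys_over_def coeff_pCons split: nat.split)

lemma ideal_polys_over:
  assumes "subring_on A" "ideal_in I A" shows "ideal_in (polys_over I) (polys_over A)"
  unfolding ideal_in_def using assms 
  by (auto simp: polys_over_def coeff_mult dest: ideal_in_sub 
      intro!: ideal_in_sum[OF assms(2)] ideal_in_mult[OF assms(2)] ideal_in_0 ideal_in_add)

text \<open>Take the lowest coefficients \<open>i\<close> of \<open>f\<close> and \<open>j\<close>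
  of \<open>g\<close> outside \<open>P\<close>: modulo \<open>P\<close> the coefficient of the
  product in degree \<open>i + j\<close> is the product of these two.\<close>

lemma prime_polys_over:
  assumes "subring_on A" "prime_in P A" shows "prime_in (polys_over P) (polys_over A)"
  unfolding prime_in_def
proof (intro conjI ballI impI)
  note id = prime_in_ideal[OF assms(2)]
  show "ideal_in (polys_over P) (polys_over A)" by (rule ideal_polys_over[OF assms(1) id])
  show "1 \<notin> polys_over P" using prime_in_1[OF assms(2)] by (auto simp: polys_over_def intro: exI[of _ 0])
  fix f g assume f: "f \<in> polys_over A" and g: "g \<in> polys_over A" and fg: "f * g \<in> polys_over P"
  show "f \<in> polys_over P \<or> g \<in> polys_over P"
  proof (rule ccontr)
    assume "\<not> ?thesis"
    then have ex: "\<exists>i. pcoeff f i \<notin> P" "\<exists>i. pcoeff g i \<notin> P" by (auto simp: polys_over_def)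
    define i where "i = (LEAST i. pcoeff f i \<notin> P)"
    define j where "j = (LEAST j. pcoeff g j \<notin> P)"
    have i: "pcoeff f i \<notin> P" "\<And>l. l < i \<Longrightarrow> pcoeff f l \<in> P" 
      unfolding i_def using LeastI_ex[OF ex(1)] by (auto dest: not_less_Least)
    have j: "pcoeff g j \<notin> P" "\<And>l. l < j \<Longrightarrow> pcoeff g l \<in> P" 
      unfolding j_def using LeastI_ex[OF ex(2)] by (auto dest: not_less_Least)
    have "(\<Sum>l\<le>i+j. pcoeff f l * pcoeff g (i + j - l)) = 
       pcoeff f i * pcoeff g j + (\<Sum>l\<in>{..i+j} - {i}. pcoeff f l * pcoeff g (i + j - l))"
      by (subst sum.remove[of _ i]) auto
    moreover have "(\<Sum>l\<in>{..i+j} - {i}. pcoeff f l * pcoeff g (i + j - l)) \<in> P"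
    proof (rule ideal_in_sum[OF id])
      fix l assume l: "l \<in> {..i+j} - {i}"
      show "pcoeff f l * pcoeff g (i + j - l) \<in> P"
      proof (cases "l < i")
        case True then show ?thesis using i g by (auto intro!: ideal_in_mult'[OF id] simp: polys_over_def)
      next
        case False 
        then have "i + j - l < j" using l by auto
        then show ?thesis using j f by (auto intro!: ideal_in_mult[OF id] simp: polys_over_def)
      qed
    qed
    moreover have "pcoeff (f * g) (i + j) \<in> P" using fg by (auto simp: polys_over_def)
    ultimately have "pcoeff f i * pcoeff g j \<in> P" 
      using ideal_in_add_cancel[OF assms(1) id] by (metis coeff_mult)
    then show False using prime_in_mult[OF assms(2)] f g i j by (auto simp: polys_over_def)
  qed
qed

lemma hom_on_const: "hom_on (\<lambda>a. [:a:]) A"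
  by (auto simp: hom_on_def)

lemma hom_on_eval: "hom_on (\<lambda>p. poly p y) A"
  by (auto simp: hom_on_def)

lemma adjoin1_subring: "subring_on A \<Longrightarrow> subring_on (adjoin1 A y)"
  unfolding adjoin1_def by (intro subring_on_image hom_on_eval subring_on_polys_over)

lemma adjoin1_base: "subring_on A \<Longrightarrow> a \<in> A \<Longrightarrow> a \<in> adjoin1 A y"
  unfolding adjoin1_def by (rule image_eqI[of _ _ "[:a:]"]) (auto intro: polys_over_const)

lemma adjoin1_gen: "subring_on A \<Longrightarrow> y \<in> adjoin1 A y"
  unfolding adjoin1_def by (rule image_eqI[of _ _ "[:0,1:]"]) (auto intro!: polys_over_pCons polys_over_const)

lemma poly_in_subring: "subring_on B \<Longrightarrow> p \<in> polys_over B \<Longrightarrow> y \<in> B \<Longrightarrow> poly p y \<in> B"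
  unfolding poly_altdef by (auto simp: polys_over_def)

lemma adjoin1_least: "subring_on B \<Longrightarrow> A \<subseteq> B \<Longrightarrow> y \<in> B \<Longrightarrow> adjoin1 A y \<subseteq> B"
  unfolding adjoin1_def using poly_in_subring polys_over_mono by blast

lemma adjoin1_mono: "A \<subseteq> B \<Longrightarrow> adjoin1 A y \<subseteq> adjoin1 B y"
  unfolding adjoin1_def using polys_over_mono by blast

lemma transc_mono: "transc B y \<Longrightarrow> A \<subseteq> B \<Longrightarrow> transc A y"
  unfolding transc_def using polys_over_mono by blast

lemma transc_inj: 
  assumes "subring_on A" "transc A y" shows "inj_on (\<lambda>p. poly p y) (polys_over A)"
proof (rule inj_onI)
  fix p q assume pq: "p \<in> polys_over A" "q \<in> polys_over A" "poly p y = poly q y"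
  then have "p - q \<in> polys_over A" using subring_on_polys_over[OF assms(1)] by blast
  then show "p = q" using assms(2) pq by (auto simp: transc_def)
qed

lemma transcD: "transc A y \<Longrightarrow> p \<in> polys_over A \<Longrightarrow> poly p y = 0 \<Longrightarrow> p = 0"
  by (auto simp: transc_def)

text \<open>Every prime P is extended to P[Z], and one more prime is put on top: the polynomials
  with constant term in \<open>P n\<close>, which include Z.\<close>

lemma has_chain_polys_over:
  assumes "subring_on A" "has_chain A n" shows "has_chain (polys_over A) (Suc n)"
proof -
  obtain P where P: "prime_chain A n P" using assms by (auto simp: has_chain_def)
  define Q where "Q i = (if i \<le> n then polys_over (P i) else {f\<in>polys_over A. poly f 0 \<in> P n})" for i
  have pr: "prime_in (P i) A" if "i \<le> n" for i using P that by (auto simp: prime_chain_def)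
  have ss: "P i \<subset> P (Suc i)" if "i < n" for i using P that by (auto simp: prime_chain_def)
  have "prime_chain (polys_over A) (Suc n) Q"
    unfolding prime_chain_def
  proof (intro conjI allI impI)
    have "(\<lambda>p. poly p 0) ` polys_over A \<subseteq> A"
      using assms(1) by (auto simp: poly_0_coeff_0 polys_over_def)
    then show "prime_in (Q i) (polys_over A)" if "i \<le> Suc n" for i
      using pr prime_polys_over[OF assms(1)] that contract_prime[OF hom_on_eval subring_on_polys_over[OF assms(1)] _ pr[of n]] 
      by (auto simp: Q_def)
  next
    fix i assume i: "i < Suc n"
    show "Q i \<subset> Q (Suc i)"
    proof (cases "i < n")
      case True
      then obtain a where a: "a \<in> P (Suc i)" "a \<notin> P i" using ss by blast
      have "[:a:] \<in> polys_over (P (Suc i))" "[:a:] \<notin> polys_over (P i)"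
        using a ideal_in_0[OF prime_in_ideal[OF pr[of "Suc i"]]] True
        by (auto simp: polys_over_def coeff_pCons split: nat.split intro: exI[of _ 0])
      then show ?thesis using True ss[OF True] polys_over_mono by (auto simp: Q_def)
    next
      case False
      have id: "ideal_in (P n) A" using pr prime_in_ideal by blast
      have "[:0,1:] \<notin> polys_over (P n)" using prime_in_1[OF pr[of n]]
        by (auto simp: polys_over_def coeff_pCons intro: exI[of _ 1])
      moreover have "[:0,1:] \<in> polys_over A" using assms by (auto intro!: polys_over_pCons polys_over_const)
      moreover have "polys_over (P n) \<subseteq> {f\<in>polys_over A. poly f 0 \<in> P n}"
        using ideal_in_sub[OF id] by (auto simp: polys_over_def poly_0_coeff_0)
      ultimately show ?thesis using False i ideal_in_0[OF id] by (auto simp: Q_def less_Suc_eq)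
    qed
  qed
  then show ?thesis by (auto simp: has_chain_def)
qed

section \<open>Hilbert's basis theorem\<close>

definition lead_ideal :: "'r::comm_ring_1 poly set \<Rightarrow> nat \<Rightarrow> 'r set" where
  "lead_ideal I n = (\<lambda>p. pcoeff p n) ` {p\<in>I. pdeg p \<le> n}"

lemma lead_ideal_mono: "I \<subseteq> J \<Longrightarrow> lead_ideal I n \<subseteq> lead_ideal J n"
  by (auto simp: lead_ideal_def)

lemma lead_ideal_ideal:
  assumes "subring_on A" "ideal_in I (polys_over A)" shows "ideal_in (lead_ideal I n) A"
  unfolding ideal_in_def
proof (intro conjI ballI)
  show "lead_ideal I n \<subseteq> A" using ideal_in_sub[OF assms(2)] by (auto simp: lead_ideal_def polys_over_def)
  show "0 \<in> lead_ideal I n" using ideal_in_0[OF assms(2)] unfolding lead_ideal_def 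
    by (intro image_eqI[of _ _ 0]) auto
next
  fix a b assume "a \<in> lead_ideal I n" "b \<in> lead_ideal I n"
  then obtain p q where "a = pcoeff p n" "p \<in> I" "pdeg p \<le> n" "b = pcoeff q n" "q \<in> I" "pdeg q \<le> n"
    by (auto simp: lead_ideal_def)
  then show "a + b \<in> lead_ideal I n" using ideal_in_add[OF assms(2)] degree_add_le unfolding lead_ideal_def
    by (intro image_eqI[of _ _ "p + q"]) auto
next
  fix r b assume r: "r \<in> A" "b \<in> lead_ideal I n"
  then obtain q where "b = pcoeff q n" "q \<in> I" "pdeg q \<le> n"
    by (auto simp: lead_ideal_def)
  moreover have "[:r:] * q \<in> I" using r calculation by (intro ideal_in_mult[OF assms(2)] polys_over_const assms)
  ultimately show "r * b \<in> lead_ideal I n" using degree_smult_le[of r q] unfolding lead_ideal_def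
    by (intro image_eqI[of _ _ "[:r:] * q"]) auto
qed

lemma lead_ideal_Suc:
  assumes "subring_on A" "ideal_in I (polys_over A)" shows "lead_ideal I n \<subseteq> lead_ideal I (Suc n)"
proof
  fix a assume "a \<in> lead_ideal I n"
  then obtain p where p: "a = pcoeff p n" "p \<in> I" "pdeg p \<le> n" by (auto simp: lead_ideal_def)
  have "[:0,1:] * p \<in> I" using p assms
    by (intro ideal_in_mult[OF assms(2)] polys_over_pCons polys_over_const) auto
  then show "a \<in> lead_ideal I (Suc n)" using p unfolding lead_ideal_def
    by (intro image_eqI[of _ _ "[:0,1:] * p"]) auto
qed

text \<open>From a member of \<open>J\<close> one subtracts a member of \<open>I\<close> with the
  same coefficient in the top degree. The difference has smaller degree and is again in
  \<open>J\<close>, because \<open>I\<close> is contained in \<open>J\<close>.\<close>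

lemma lead_ideal_eq:
  assumes A: "subring_on A" and I: "ideal_in I (polys_over A)" and J: "ideal_in J (polys_over A)" 
    and "I \<subseteq> J" and eq: "\<And>n. lead_ideal I n = lead_ideal J n"
  shows "I = J"
proof -
  have main: "p \<in> I" if "p \<in> J" "pdeg p \<le> n" for p n
    using that
  proof (induction n arbitrary: p)
    case 0
    then have "pcoeff p 0 \<in> lead_ideal I 0" using eq[of 0] by (auto simp: lead_ideal_def)
    then obtain q where q: "q \<in> I" "pdeg q \<le> 0" "pcoeff q 0 = pcoeff p 0" by (auto simp: lead_ideal_def)
    then have "p = q" using 0 by (metis degree_0_id le_zero_eq)
    then show ?case using q by simp
  next
    case (Suc n)
    then have "pcoeff p (Suc n) \<in> lead_ideal I (Suc n)" using eq[of "Suc n"] by (auto simp: lead_ideal_def)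
    then obtain q where q: "q \<in> I" "pdeg q \<le> Suc n" "pcoeff q (Suc n) = pcoeff p (Suc n)" by (auto simp: lead_ideal_def)
    have "p - q \<in> J" using Suc q assms(4) ideal_in_diff[OF subring_on_polys_over[OF A] J] by blast
    moreover have "pdeg (p - q) \<le> n"
    proof (rule degree_le, intro allI impI)
      fix i assume "n < i"
      show "pcoeff (p - q) i = 0"
      proof (cases "i = Suc n")
        case False
        then have "pdeg p < i" "pdeg q < i" using \<open>n < i\<close> Suc q by auto
        then show ?thesis by (simp add: coeff_eq_0)
      qed (use q in auto)
    qed
    ultimately have "p - q \<in> I" using Suc.IH by blast
    then show ?case using ideal_in_diff_cancel[OF subring_on_polys_over[OF A] I] q by blast
  qed
  then show ?thesis using assms(4) by blast
qed

theorem Hilbert_basis: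
  assumes A: "subring_on A" and N: "noeth A" shows "noeth (polys_over A)"
proof (rule noethI)
  fix I :: "nat \<Rightarrow> 'a poly set" 
  assume id: "\<And>i. ideal_in (I i) (polys_over A)" and ss: "\<And>i. I i \<subset> I (Suc i)"
  have mono: "I i \<subseteq> I j" if "i \<le> j" for i j using lift_Suc_mono_le[of I i j] ss that by blast
  have Lmono: "lead_ideal (I i) m \<subseteq> lead_ideal (I j) n" if "i \<le> j" "m \<le> n" for i j m n
  proof -
    have "lead_ideal (I i) m \<subseteq> lead_ideal (I i) n" 
      using lift_Suc_mono_le[of "lead_ideal (I i)" m n] lead_ideal_Suc[OF A id] that by blast
    then show ?thesis using lead_ideal_mono[OF mono[OF that(1)]] by blast
  qed
  \<comment> \<open>\<open>M\<close> is maximal among the leading ideals for all indices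
    \<open>j\<close> and all degrees \<open>n\<close> at once. Beyond \<open>(j0, n0)\<close> they
    all equal \<open>M\<close>, and only the finitely many degrees up to \<open>n0\<close> have to
    be stabilized separately.\<close>
  obtain M where M: "M \<in> range (\<lambda>(j, n). lead_ideal (I j) n)" 
    "\<And>J. J \<in> range (\<lambda>(j, n). lead_ideal (I j) n) \<Longrightarrow> M \<subseteq> J \<Longrightarrow> J = M"
  proof (rule noeth_max[OF N, of "range (\<lambda>(j, n). lead_ideal (I j) n)"])
    fix L assume "L \<in> range (\<lambda>(j, n). lead_ideal (I j) n)"
    then show "ideal_in L A" using lead_ideal_ideal[OF A id] by auto
  qed auto
  then obtain j0 n0 where M0: "M = lead_ideal (I j0) n0" by auto
  have big: "lead_ideal (I j) n = M" if "j \<ge> j0" "n \<ge> n0" for j n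
  proof (rule M(2))
    show "lead_ideal (I j) n \<in> range (\<lambda>(j, n). lead_ideal (I j) n)" by (rule image_eqI[of _ _ "(j, n)"]) auto
    show "M \<subseteq> lead_ideal (I j) n" unfolding M0 by (rule Lmono[OF that])
  qed
  have "\<exists>k. \<forall>j\<ge>k. lead_ideal (I j) n = lead_ideal (I k) n" for n
  proof -
    have "lead_ideal (I i) n \<subseteq> lead_ideal (I (Suc i)) n" for i by (rule Lmono) auto
    then obtain k where "\<And>j. j \<ge> k \<Longrightarrow> lead_ideal (I j) n = lead_ideal (I k) n"
      using noeth_seq[where I = "\<lambda>j. lead_ideal (I j) n", OF N lead_ideal_ideal[OF A id]] by blast
    then show ?thesis by blast
  qed
  then obtain k where k: "\<And>n j. j \<ge> k n \<Longrightarrow> lead_ideal (I j) n = lead_ideal (I (k n)) n" by metis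
  define K where "K = Max (insert j0 (k ` {..n0}))"
  have K: "K \<ge> j0" "\<And>n. n \<le> n0 \<Longrightarrow> K \<ge> k n" unfolding K_def by (auto intro!: Max_ge simp del: Max_insert)
  have "lead_ideal (I K) n = lead_ideal (I (Suc K)) n" for n
  proof (cases "n \<le> n0")
    case True
    then show ?thesis using k[of n K] k[of n "Suc K"] K(2)[of n] by simp
  next
    case False
    then show ?thesis using big[of K n] big[of "Suc K" n] K(1) by simp
  qed
  then have "I K = I (Suc K)" using lead_ideal_eq[OF A id id] ss by blast
  then show False using ss[of K] by blast
qed

lemma noeth_adjoin1: "subring_on A \<Longrightarrow> noeth A \<Longrightarrow> noeth (adjoin1 A y)"
  unfolding adjoin1_def by (intro noeth_surj Hilbert_basis hom_on_eval subring_on_polys_over)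

section \<open>Lengths at adjacent primes\<close>

definition ideal_sum :: "'r::comm_ring_1 set \<Rightarrow> 'r set \<Rightarrow> 'r set" where
  "ideal_sum I J = {x + y | x y. x \<in> I \<and> y \<in> J}"

lemma ideal_sum_ideal:
  assumes "ideal_in I A" "ideal_in J A" "subring_on A" shows "ideal_in (ideal_sum I J) A"
  unfolding ideal_in_def
proof (intro conjI ballI)
  show "ideal_sum I J \<subseteq> A" using assms ideal_in_sub by (auto simp: ideal_sum_def intro!: subring_on_add) 
  show "0 \<in> ideal_sum I J" using ideal_in_0[OF assms(1)] ideal_in_0[OF assms(2)] by (force simp: ideal_sum_def)
next
  fix a b assume "a \<in> ideal_sum I J" "b \<in> ideal_sum I J"
  then obtain x y x' y' where *: "a = x + y" "b = x' + y'" "x \<in> I" "x' \<in> I" "y \<in> J" "y' \<in> J"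
    by (auto simp: ideal_sum_def)
  then have "a + b = (x + x') + (y + y')" by (simp add: algebra_simps)
  then show "a + b \<in> ideal_sum I J" using * ideal_in_add assms unfolding ideal_sum_def by blast
next
  fix r b assume r: "r \<in> A" "b \<in> ideal_sum I J"
  then obtain x y where "b = x + y" "x \<in> I" "y \<in> J" by (auto simp: ideal_sum_def)
  moreover from this have "r * b = r * x + r * y" by (simp add: algebra_simps)
  ultimately show "r * b \<in> ideal_sum I J" using r(1) ideal_in_mult assms unfolding ideal_sum_def by blast
qed

lemma ideal_sum_left: "ideal_in J A \<Longrightarrow> I \<subseteq> ideal_sum I J"
  using ideal_in_0 by (force simp: ideal_sum_def)

lemma ideal_sum_right: "ideal_in I A \<Longrightarrow> J \<subseteq> ideal_sum I J"
  using ideal_in_0 by (force simp: ideal_sum_def)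

lemma ideal_sum_mono: "I \<subseteq> I' \<Longrightarrow> J \<subseteq> J' \<Longrightarrow> ideal_sum I J \<subseteq> ideal_sum I' J'"
  by (force simp: ideal_sum_def)

lemma ideal_scale:
  assumes "ideal_in I A" "subring_on A" "a \<in> A" shows "ideal_in ((*) a ` I) A"
  unfolding ideal_in_def
proof (intro conjI ballI)
  show "(*) a ` I \<subseteq> A" using assms ideal_in_sub by auto
  show "0 \<in> (*) a ` I" using ideal_in_0[OF assms(1)] by (intro image_eqI[of _ _ 0]) auto
next
  fix x y assume "x \<in> (*) a ` I" "y \<in> (*) a ` I"
  then obtain u v where "x = a * u" "y = a * v" "u \<in> I" "v \<in> I" by blast
  then show "x + y \<in> (*) a ` I" using ideal_in_add[OF assms(1)] 
    by (intro image_eqI[of _ _ "u + v"]) (auto simp: algebra_simps)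
next
  fix r y assume r: "r \<in> A" "y \<in> (*) a ` I"
  then obtain v where "y = a * v" "v \<in> I" by blast
  then show "r * y \<in> (*) a ` I" using ideal_in_mult[OF assms(1)] r
    by (intro image_eqI[of _ _ "r * v"]) (auto simp: algebra_simps)
qed

text \<open>This models the one-dimensional local domain obtained by factoring out \<open>p\<close>
  and localizing at \<open>q\<close>, with all computations kept inside \<open>A\<close>.\<close>

locale adjacent_primes =
  fixes A p q :: "'r::comm_ring_1 set"
  assumes A: "subring_on A" and N: "noeth A" and p: "prime_in p A" and q: "prime_in q A" and pq: "p \<subset> q"
    and adj: "\<And>r. prime_in r A \<Longrightarrow> p \<subseteq> r \<Longrightarrow> r \<subseteq> q \<Longrightarrow> r = p \<or> r = q"
begin

lemma W_mult: "w \<in> A - q \<Longrightarrow> v \<in> A - q \<Longrightarrow> w * v \<in> A - q"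
  using prime_in_mult[OF q] A by auto

lemma W_1: "1 \<in> A - q"
  using prime_in_1[OF q] A by auto

text \<open>Ideals saturated with respect to \<open>A - q\<close> stand for ideals of the localization at \<open>q\<close>.\<close>

definition saturated :: "'r set \<Rightarrow> bool" where
  "saturated I \<longleftrightarrow> (\<forall>w\<in>A-q. \<forall>x\<in>A. w * x \<in> I \<longrightarrow> x \<in> I)"

definition sat :: "'r set \<Rightarrow> 'r set" where
  "sat I = {x\<in>A. \<exists>w\<in>A-q. w * x \<in> I}"

lemma saturatedD: "saturated I \<Longrightarrow> w \<in> A - q \<Longrightarrow> x \<in> A \<Longrightarrow> w * x \<in> I \<Longrightarrow> x \<in> I"
  by (auto simp: saturated_def)

lemma sat_ideal: assumes "ideal_in I A" shows "ideal_in (sat I) A"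
  unfolding ideal_in_def
proof (intro conjI ballI)
  show "sat I \<subseteq> A" by (auto simp: sat_def)
  show "0 \<in> sat I" using W_1 ideal_in_0[OF assms] A by (auto simp: sat_def)
next
  fix a b assume "a \<in> sat I" "b \<in> sat I"
  then obtain w v where *: "a \<in> A" "b \<in> A" "w \<in> A - q" "v \<in> A - q" "w * a \<in> I" "v * b \<in> I"
    by (auto simp: sat_def)
  have "(w * v) * (a + b) = v * (w * a) + w * (v * b)" by (simp add: algebra_simps)
  also have "\<dots> \<in> I" using * ideal_in_add[OF assms] ideal_in_mult[OF assms] by simp
  finally show "a + b \<in> sat I" using * W_mult A unfolding sat_def by blast
next
  fix r a assume "r \<in> A" "a \<in> sat I"
  then obtain w where *: "a \<in> A" "r \<in> A" "w \<in> A - q" "w * a \<in> I" by (auto simp: sat_def)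
  then have "w * (r * a) \<in> I" using ideal_in_mult[OF assms, of r "w * a"] by (simp add: algebra_simps)
  then show "r * a \<in> sat I" using * A unfolding sat_def by blast
qed

lemma sat_saturated: "saturated (sat I)"
  unfolding saturated_def
proof (intro ballI impI)
  fix w x assume *: "w \<in> A - q" "x \<in> A" "w * x \<in> sat I"
  then obtain v where v: "v \<in> A - q" "v * (w * x) \<in> I" by (auto simp: sat_def)
  then have "(v * w) * x \<in> I" by (simp add: algebra_simps)
  then show "x \<in> sat I" using * W_mult[OF v(1) *(1)] unfolding sat_def by blast
qed

lemma sat_incl: "I \<subseteq> A \<Longrightarrow> I \<subseteq> sat I"
  unfolding sat_def using W_1 by (auto intro!: bexI[of _ 1])

lemma sat_mono: "I \<subseteq> J \<Longrightarrow> sat I \<subseteq> sat J"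
  unfolding sat_def by blast

lemma sat_idem: "saturated I \<Longrightarrow> I \<subseteq> A \<Longrightarrow> sat I = I"
  using sat_incl[of I] unfolding sat_def saturated_def by blast

lemma sat_sum_memE:
  assumes "x \<in> sat (ideal_sum I (princ A c))"
  obtains w y r where "x \<in> A" "w \<in> A - q" "y \<in> I" "r \<in> A" "w * x = y + r * c"
proof -
  obtain w where w: "x \<in> A" "w \<in> A - q" "w * x \<in> ideal_sum I (princ A c)"
    using assms unfolding sat_def by blast
  obtain y z where yz: "w * x = y + z" "y \<in> I" "z \<in> princ A c" 
    using w(3) unfolding ideal_sum_def by blast
  obtain r where "r \<in> A" "z = r * c" using yz(3) unfolding princ_def by blast
  then show ?thesis using that w yz by blast
qed

lemma sat_sum_memI:
  assumes "x \<in> A" "w \<in> A - q" "y \<in> I" "r \<in> A" "w * x = y + r * c"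
  shows "x \<in> sat (ideal_sum I (princ A c))"
  using assms unfolding sat_def ideal_sum_def princ_def by blast

text \<open>\<open>colength_le I n\<close> bounds the length of \<open>A/I\<close>, localized at \<open>q\<close>, by \<open>n\<close>.\<close>

inductive colength_le :: "'r set \<Rightarrow> nat \<Rightarrow> bool" where
  colength_le_top: "colength_le A 0"
| colength_le_step: "ideal_in I A \<Longrightarrow> saturated I \<Longrightarrow> c \<in> A \<Longrightarrow> (\<And>x. x \<in> q \<Longrightarrow> x * c \<in> I) \<Longrightarrow>
    colength_le (sat (ideal_sum I (princ A c))) n \<Longrightarrow> colength_le I (Suc n)"

text \<open>A substitute for additivity of length: the saturated ideals above \<open>I\<close>
  receive a rank that is bounded by \<open>n\<close> and strictly monotone, so a strict chain of
  them has at most \<open>n\<close> steps.\<close>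

lemma colength_le_rank:
  assumes "colength_le I n"
  shows "\<exists>\<rho>. \<forall>J. ideal_in J A \<and> saturated J \<and> I \<subseteq> J \<longrightarrow> \<rho> J \<le> n \<and>
    (\<forall>J'. ideal_in J' A \<and> saturated J' \<and> J \<subseteq> J' \<longrightarrow> \<rho> J \<le> \<rho> J' \<and> (\<rho> J = \<rho> J' \<longrightarrow> J = J'))"
  using assms
proof (induction rule: colength_le.induct)
  case colength_le_top
  show ?case by (rule exI[of _ "\<lambda>_. 0"]) (auto dest: ideal_in_sub)
next
  case (colength_le_step I c n)
  note I = colength_le_step.hyps(1) and c = colength_le_step.hyps(3)
  let ?s = "\<lambda>J. sat (ideal_sum J (princ A c))"
  obtain \<rho> where \<rho>0: "\<forall>J. ideal_in J A \<and> saturated J \<and> ?s I \<subseteq> J \<longrightarrow> \<rho> J \<le> n \<and>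
    (\<forall>J'. ideal_in J' A \<and> saturated J' \<and> J \<subseteq> J' \<longrightarrow> \<rho> J \<le> \<rho> J' \<and> (\<rho> J = \<rho> J' \<longrightarrow> J = J'))"
    using colength_le_step.IH by (rule exE)
  have \<rho>: "\<And>J. ideal_in J A \<Longrightarrow> saturated J \<Longrightarrow> ?s I \<subseteq> J \<Longrightarrow> \<rho> J \<le> n"
    "\<And>J J'. ideal_in J A \<Longrightarrow> saturated J \<Longrightarrow> ?s I \<subseteq> J \<Longrightarrow> ideal_in J' A \<Longrightarrow> saturated J' \<Longrightarrow> J \<subseteq> J' \<Longrightarrow> \<rho> J \<le> \<rho> J'"
    "\<And>J J'. ideal_in J A \<Longrightarrow> saturated J \<Longrightarrow> ?s I \<subseteq> J \<Longrightarrow> ideal_in J' A \<Longrightarrow> saturated J' \<Longrightarrow> J \<subseteq> J' \<Longrightarrow> \<rho> J = \<rho> J' \<Longrightarrow> J = J'"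
    using \<rho>0 by simp_all
  \<comment> \<open>One simple layer is added: an ideal is recorded by whether it contains
    \<open>c\<close> and by the rank of its saturated sum with \<open>c\<close>.\<close>
  define \<rho>' where "\<rho>' J = (if c \<in> J then 1 else 0) + \<rho> (?s J)" for J
  have pr: "ideal_in (princ A c) A" by (rule princ_ideal[OF A c])
  have sid: "ideal_in (?s J) A" if "ideal_in J A" for J
    by (rule sat_ideal[OF ideal_sum_ideal[OF that pr A]])
  have smono: "?s J \<subseteq> ?s J'" if "J \<subseteq> J'" for J J'
    by (rule sat_mono[OF ideal_sum_mono[OF that subset_refl]])
  have sincl: "J \<subseteq> ?s J" if "ideal_in J A" for J
    using sat_incl[of "ideal_sum J (princ A c)"] ideal_sum_left[OF pr, of J] ideal_in_sub[OF ideal_sum_ideal[OF that pr A]] by blast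
  have sc: "?s J = J" if "ideal_in J A" "saturated J" "c \<in> J" for J
  proof -
    have "ideal_sum J (princ A c) \<subseteq> J"
      using princ_least[OF that(1,3)] ideal_in_add[OF that(1)] by (auto simp: ideal_sum_def)
    then have "?s J \<subseteq> sat J" by (rule sat_mono)
    then show ?thesis using sat_idem[OF that(2)] ideal_in_sub[OF that(1)] sincl[OF that(1)] by blast
  qed
  have "\<rho>' J \<le> Suc n" if "ideal_in J A" "saturated J" "I \<subseteq> J" for J
    using \<rho>(1)[OF sid[OF that(1)] sat_saturated smono[OF that(3)]] by (simp add: \<rho>'_def)
  moreover have "\<rho>' J \<le> \<rho>' J' \<and> (\<rho>' J = \<rho>' J' \<longrightarrow> J = J')" 
    if J: "ideal_in J A" "saturated J" "I \<subseteq> J" and J': "ideal_in J' A" "saturated J'" "J \<subseteq> J'" for J J'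
  proof -
    have le: "\<rho> (?s J) \<le> \<rho> (?s J')"
      by (rule \<rho>(2)[OF sid[OF J(1)] sat_saturated smono[OF J(3)] sid[OF J'(1)] sat_saturated smono[OF J'(3)]])
    then have "\<rho>' J \<le> \<rho>' J'" using J'(3) by (auto simp: \<rho>'_def)
    moreover have "J = J'" if "\<rho>' J = \<rho>' J'"
    proof -
      have eqc: "c \<in> J \<longleftrightarrow> c \<in> J'" "\<rho> (?s J) = \<rho> (?s J')" using that le J'(3) by (auto simp: \<rho>'_def split: if_splits)
      have eq: "?s J = ?s J'"
        by (rule \<rho>(3)[OF sid[OF J(1)] sat_saturated smono[OF J(3)] sid[OF J'(1)] sat_saturated smono[OF J'(3)] eqc(2)])
      show ?thesis
      proof (cases "c \<in> J")
        case True
        then have "J = ?s J" by (intro sc[OF J(1,2), symmetric])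
        also note eq
        also have "?s J' = J'" by (rule sc[OF J'(1,2)]) (use True eqc in blast)
        finally show ?thesis .
      next
        case False
        \<comment> \<open>An element \<open>x\<close> of \<open>J'\<close> satisfies w x = y + r c
          with \<open>y\<close> in \<open>J\<close>. If \<open>r\<close> were outside
          \<open>q\<close>, saturation would put \<open>c\<close> into \<open>J'\<close>; so
          \<open>r\<close> is in \<open>q\<close>, \<open>r * c\<close> is in \<open>I\<close>, and
          \<open>x\<close> is in \<open>J\<close>.\<close>
        have "x \<in> J" if "x \<in> J'" for x
        proof -
          have "x \<in> ?s J" using sincl[OF J'(1)] eq that by blast
          then obtain w y r where w: "w \<in> A - q" "w * x = y + r * c" "y \<in> J" "r \<in> A" "x \<in> A"
            by (rule sat_sum_memE)
          have "r * c = w * x - y" using w by simp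
          also have "\<dots> \<in> J'" using w that J'(3) by (intro ideal_in_diff[OF A J'(1)] ideal_in_mult[OF J'(1)]) auto
          finally have "r * c \<in> J'" .
          then have "r \<in> q" using saturatedD[OF J'(2), of r c] eqc False w c by blast
          then have "r * c \<in> J" using colength_le_step.hyps(4) J(3) by blast
          then have "w * x \<in> J" using w ideal_in_add[OF J(1)] by simp
          then show ?thesis using saturatedD[OF J(2)] w by blast
        qed
        then show ?thesis using J'(3) by blast
      qed
    qed
    ultimately show ?thesis by blast
  qed
  ultimately show ?case by (intro exI[of _ \<rho>']) blast
qed

text \<open>A maximal ideal among the (I : c) with \<open>c\<close> outside \<open>I\<close> is
  prime, as for associated primes. It contains \<open>p\<close> and \<open>a\<close>, and it lies in
  \<open>q\<close> by saturation; adjacency makes it equal to \<open>q\<close>. So \<open>c\<close>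
  spans a simple layer above \<open>I\<close>, and Noetherian induction applies to the larger
  ideal.\<close>

lemma colength_le_exists:
  assumes a: "a \<in> A" "a \<notin> p" and I: "ideal_in I A" "saturated I" "p \<subseteq> I" "a \<in> I"
  shows "\<exists>n. colength_le I n"
proof -
  have "ideal_in I A \<longrightarrow> saturated I \<longrightarrow> p \<subseteq> I \<longrightarrow> a \<in> I \<longrightarrow> (\<exists>n. colength_le I n)"
  proof (induction I rule: wf_induct_rule[OF N[unfolded noeth_def]])
    case (1 I)
    show ?case
    proof (intro impI)
      assume I: "ideal_in I A" "saturated I" "p \<subseteq> I" "a \<in> I"
      show "\<exists>n. colength_le I n"
      proof (cases "I = A")
        case True then show ?thesis using colength_le_top by blast
      next
        case False
        let ?q = "\<lambda>c. {x\<in>A. x * c \<in> I}"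
        have idq: "ideal_in (?q c) A" if "c \<in> A" for c
          using that I(1) A unfolding ideal_in_def by (auto simp: algebra_simps intro: subring_on_mult)
        have "?q ` (A - I) \<noteq> {}" using False ideal_in_sub[OF I(1)] by blast
        then obtain M where M: "M \<in> ?q ` (A - I)" "\<And>J. J \<in> ?q ` (A - I) \<Longrightarrow> M \<subseteq> J \<Longrightarrow> J = M"
          using noeth_max[OF N, of "?q ` (A - I)"] idq by blast
        then obtain c where c: "M = ?q c" "c \<in> A" "c \<notin> I" by blast
        have "prime_in M A"
          unfolding prime_in_def
        proof (intro conjI ballI impI)
          show "ideal_in M A" using c idq by blast
          show "1 \<notin> M" using c by simp
          fix x y assume xy: "x \<in> A" "y \<in> A" "x * y \<in> M"
          show "x \<in> M \<or> y \<in> M"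
          proof (rule disjCI)
            assume "y \<notin> M"
            then have "y * c \<in> A - I" using c xy A by auto
            moreover have "M \<subseteq> ?q (y * c)"
            proof
              fix z assume "z \<in> M"
              then have "z \<in> A" "y * (z * c) \<in> I" using c xy ideal_in_mult[OF I(1), of y] by auto
              then show "z \<in> ?q (y * c)" by (simp add: mult.left_commute)
            qed
            ultimately have "?q (y * c) = M" using M(2) by blast
            moreover have "x \<in> ?q (y * c)" using xy c by (auto simp: algebra_simps)
            ultimately show "x \<in> M" by blast
          qed
        qed
        moreover have "p \<subseteq> M" using c I(3) ideal_in_sub[OF prime_in_ideal[OF p]] ideal_in_mult'[OF I(1)] by auto
        moreover have "M \<subseteq> q" using saturatedD[OF I(2) _ c(2)] c by blast
        moreover have "a \<in> M" using c I(4) a ideal_in_mult'[OF I(1)] by auto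
        ultimately have "M = q" using adj a by blast
        then have qc: "x * c \<in> I" if "x \<in> q" for x using that c by blast
        let ?J = "sat (ideal_sum I (princ A c))"
        have pr: "ideal_in (princ A c) A" by (rule princ_ideal[OF A c(2)])
        have Jid: "ideal_in ?J A" by (rule sat_ideal[OF ideal_sum_ideal[OF I(1) pr A]])
        have sub: "ideal_sum I (princ A c) \<subseteq> ?J"
          by (rule sat_incl) (use ideal_sum_ideal[OF I(1) pr A] ideal_in_sub in blast)
        then have "I \<subseteq> ?J" "c \<in> ?J" using ideal_sum_left[OF pr] ideal_sum_right[OF I(1)] princ_self[OF A] by blast+
        then have "\<exists>n. colength_le ?J n" using 1[of ?J] I Jid c sat_saturated by blast
        then show ?thesis using colength_le_step[OF I(1,2) c(2) qc] by blast
      qed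
    qed
  qed
  then show ?thesis using I by blast
qed

text \<open>Multiplication by \<open>a\<close> on ideals of the modelled local domain. The t-th
  iterate at \<open>A\<close> stands for the ideal generated by the t-th power of
  \<open>a\<close>.\<close>

definition shift :: "'r \<Rightarrow> 'r set \<Rightarrow> 'r set" where
  "shift a I = sat (ideal_sum p ((*) a ` I))"

lemma shift_ideal: "a \<in> A \<Longrightarrow> ideal_in I A \<Longrightarrow> ideal_in (shift a I) A"
  unfolding shift_def by (intro sat_ideal ideal_sum_ideal ideal_scale A prime_in_ideal[OF p])

lemma shift_memI: 
  assumes "x \<in> A" "w \<in> A - q" "u \<in> p" "y \<in> I" "w * x = u + a * y" shows "x \<in> shift a I"
  using assms unfolding shift_def sat_def ideal_sum_def by blast

lemma shift_memE:
  assumes "x \<in> shift a I"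
  obtains w u y where "x \<in> A" "w \<in> A - q" "u \<in> p" "y \<in> I" "w * x = u + a * y"
  using assms unfolding shift_def sat_def ideal_sum_def by blast

text \<open>The length of A/(p + aI) is at most that of A/I plus that of A/(p + aA): multiplying the
  layers above \<open>I\<close> by \<open>a\<close> leads from \<open>shift a I\<close> up to
  \<open>shift a A\<close>, and \<open>e\<close> more steps lead to \<open>A\<close>.\<close>

lemma colength_le_shift:
  assumes a: "a \<in> A" and e: "colength_le (shift a A) e" and "colength_le I n"
  shows "colength_le (shift a I) (n + e)"
  using assms(3)
proof (induction rule: colength_le.induct)
  case colength_le_top then show ?case using e by simp
next
  case (colength_le_step I c n)
  note I = colength_le_step.hyps(1) and c = colength_le_step.hyps(3)
  note pid = prime_in_ideal[OF p]
  let ?J = "sat (ideal_sum I (princ A c))"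
  \<comment> \<open>Saturated sums commute with the shift, so the layer spanned by \<open>c\<close>
    is carried to the one spanned by \<open>a * c\<close>.\<close>
  have "sat (ideal_sum (shift a I) (princ A (a * c))) = shift a ?J"
  proof (intro equalityI subsetI)
    fix x assume "x \<in> sat (ideal_sum (shift a I) (princ A (a * c)))"
    then obtain w y r where 1: "x \<in> A" "w \<in> A - q" "y \<in> shift a I" "r \<in> A" "w * x = y + r * (a * c)"
      by (rule sat_sum_memE)
    obtain v u z where 2: "v \<in> A - q" "u \<in> p" "z \<in> I" "v * y = u + a * z" using 1(3) by (rule shift_memE)
    have "(v * w) * x = v * y + v * r * a * c" using 1(5) by (simp add: algebra_simps)
    also have "\<dots> = u + a * (z + (v * r) * c)" using 2(4) by (simp add: algebra_simps)
    finally have 3: "(v * w) * x = u + a * (z + (v * r) * c)" .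
    have "z + (v * r) * c \<in> ideal_sum I (princ A c)"
      using 1 2 A unfolding ideal_sum_def princ_def by blast
    also have "\<dots> \<subseteq> ?J" 
      by (rule sat_incl) (use ideal_sum_ideal[OF I princ_ideal[OF A c] A] ideal_in_sub in blast)
    finally show "x \<in> shift a ?J" using shift_memI[OF 1(1) W_mult[OF 2(1) 1(2)] 2(2) _ 3] by blast
  next
    fix x assume "x \<in> shift a ?J"
    then obtain w u y where 1: "x \<in> A" "w \<in> A - q" "u \<in> p" "y \<in> ?J" "w * x = u + a * y" by (rule shift_memE)
    from 1(4) obtain v z r where 2: "y \<in> A" "v \<in> A - q" "z \<in> I" "r \<in> A" "v * y = z + r * c" 
      by (rule sat_sum_memE)
    have "(v * w) * x = v * u + a * (v * y)" using 1(5) by (simp add: algebra_simps)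
    also have "\<dots> = (v * u + a * z) + r * (a * c)" using 2(5) by (simp add: algebra_simps)
    finally have 3: "(v * w) * x = (v * u + a * z) + r * (a * c)" .
    have vu: "v * u \<in> p" using ideal_in_mult[OF pid] 1 2 by auto
    have "v * u + a * z \<in> shift a I"
      by (rule shift_memI[of _ 1 "v * u" z]) (use W_1 vu 2 a ideal_in_sub[OF pid vu] ideal_in_sub[OF I 2(3)] A in auto)
    then show "x \<in> sat (ideal_sum (shift a I) (princ A (a * c)))"
      using sat_sum_memI[OF 1(1) W_mult[OF 2(2) 1(2)] _ 2(4) 3] by blast
  qed
  then have "colength_le (sat (ideal_sum (shift a I) (princ A (a * c)))) (n + e)" using colength_le_step.IH by simp
  moreover have "x * (a * c) \<in> shift a I" if "x \<in> q" for x
  proof (rule shift_memI[of _ 1 0 "x * c"])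
    show "x * (a * c) \<in> A" using that a c ideal_in_sub[OF prime_in_ideal[OF q]] A by auto
  qed (use W_1 ideal_in_0[OF pid] colength_le_step.hyps(4)[OF that] in \<open>auto simp: mult.left_commute\<close>)
  ultimately show ?case using colength_le.colength_le_step[OF shift_ideal[OF a I], of "a * c" "n + e"] a c A sat_saturated 
    unfolding shift_def by auto
qed

lemma colength_le_shift_power:
  assumes a: "a \<in> A" and e: "colength_le (shift a A) e"
  shows "colength_le ((shift a ^^ t) A) (t * e)"
proof (induction t)
  case 0 then show ?case using colength_le_top by simp
next
  case (Suc t) then show ?case using colength_le_shift[OF a e Suc] by (simp add: add.commute)
qed

lemma shift_power_mem:
  assumes a: "a \<in> A" and x: "x \<in> (shift a ^^ t) A"
  shows "x \<in> A \<and> (\<exists>w\<in>A-q. \<exists>u\<in>p. \<exists>y\<in>A. w * x = u + a ^ t * y)"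
  using x
proof (induction t arbitrary: x)
  case 0 
  then have "1 * x = 0 + a ^ 0 * x" "x \<in> A" by auto
  then show ?case using W_1 ideal_in_0[OF prime_in_ideal[OF p]] by blast
next
  case (Suc t)
  then have "x \<in> shift a ((shift a ^^ t) A)" by simp
  then obtain w u y where 1: "x \<in> A" "w \<in> A - q" "u \<in> p" "y \<in> (shift a ^^ t) A" "w * x = u + a * y" by (rule shift_memE)
  obtain v u' z where 2: "v \<in> A - q" "u' \<in> p" "z \<in> A" "v * y = u' + a ^ t * z" using Suc.IH[OF 1(4)] by blast
  have "(v * w) * x = v * u + a * (v * y)" using 1(5) by (simp add: algebra_simps)
  also have "\<dots> = (v * u + a * u') + a ^ Suc t * z" unfolding 2(4) by (simp add: algebra_simps)
  finally have "(v * w) * x = (v * u + a * u') + a ^ Suc t * z" .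
  moreover have "v * u + a * u' \<in> p" using 1 2 a prime_in_ideal[OF p] by (auto intro!: ideal_in_add ideal_in_mult)
  ultimately show ?case using W_mult[OF 2(1) 1(2)] 1(1) 2(3) by blast
qed

end

section \<open>Primes of a polynomial ring\<close>

text \<open>The exponent is any bound \<open>n\<close> on the degree of \<open>f\<close>, so that
  one power of the leading coefficient serves all polynomials up to that degree.\<close>

lemma pseudo_division:
  assumes A: "subring_on A" and F: "F \<in> polys_over A" and d: "pdeg F > 0"
    and f: "f \<in> polys_over A" "pdeg f \<le> n"
  shows "\<exists>H\<in>polys_over A. \<exists>R\<in>polys_over A. [:pcoeff F (pdeg F) ^ n:] * f = F * H + R \<and> pdeg R < pdeg F"
  using f
proof (induction n arbitrary: f)
  case 0
  then show ?case using d subring_on_0[OF subring_on_polys_over[OF A]] by (intro bexI[of _ 0] bexI[of _ f]) auto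
next
  case (Suc n)
  note SA = subring_on_polys_over[OF A]
  let ?a = "pcoeff F (pdeg F)"
  have a: "?a \<in> A" using F by (rule polys_over_coeff)
  show ?case
  proof (cases "pdeg f < pdeg F")
    case True
    have "[:?a ^ Suc n:] * f \<in> polys_over A" 
      using subring_on_mult[OF SA polys_over_const[OF A subring_on_power[OF A a]] Suc.prems(1)] .
    moreover have "pdeg ([:?a ^ Suc n:] * f) < pdeg F"
      using True degree_smult_le[of "?a ^ Suc n" f] by simp
    ultimately show ?thesis using subring_on_0[OF SA] 
      by (intro bexI[of _ 0] bexI[of _ "[:?a ^ Suc n:] * f"]) auto
  next
    case False
    let ?b = "pcoeff f (Suc n)"
    let ?M = "Polynomial.monom ?b (Suc n - pdeg F)"
    let ?g = "[:?a:] * f - ?M * F"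
    have M: "?M \<in> polys_over A" using polys_over_monom[OF A polys_over_coeff[OF Suc.prems(1)]] .
    have g: "?g \<in> polys_over A"
      using subring_on_diff[OF SA subring_on_mult[OF SA polys_over_const[OF A a] Suc.prems(1)] subring_on_mult[OF SA M F]] .
    have "pdeg ?g \<le> n"
    proof (rule degree_le, intro allI impI)
      fix i assume i: "n < i"
      have dn: "pdeg F \<le> Suc n" using False Suc.prems(2) by linarith
      have "pcoeff (?M * F) i = ?b * pcoeff F (i - (Suc n - pdeg F))"
        using i by (simp add: coeff_monom_mult)
      moreover have "pcoeff f i = 0" if "i \<noteq> Suc n" using i Suc.prems(2) that by (intro coeff_eq_0) linarith
      moreover have "pcoeff F (i - (Suc n - pdeg F)) = 0" if "i \<noteq> Suc n" using i dn that by (intro coeff_eq_0) linarith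
      ultimately show "pcoeff ?g i = 0" using dn by (cases "i = Suc n") (auto simp: mult.commute)
    qed
    then obtain H R where HR: "H \<in> polys_over A" "R \<in> polys_over A" "[:?a ^ n:] * ?g = F * H + R" "pdeg R < pdeg F"
      using Suc.IH[OF g] by blast
    have "[:?a ^ Suc n:] = [:?a ^ n:] * [:?a:]" by (simp add: mult.commute)
    then have "[:?a ^ Suc n:] * f = [:?a ^ n:] * ?g + F * ([:?a ^ n:] * ?M)"
      by (simp only: algebra_simps)
    also have "\<dots> = F * (H + [:?a ^ n:] * ?M) + R" unfolding HR(3) by (simp only: algebra_simps)
    finally have "[:?a ^ Suc n:] * f = F * (H + [:?a ^ n:] * ?M) + R" .
    moreover have "H + [:?a ^ n:] * ?M \<in> polys_over A" 
      using subring_on_add[OF SA HR(1) subring_on_mult[OF SA polys_over_const[OF A subring_on_power[OF A a]] M]] .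
    ultimately show ?thesis using HR by blast
  qed
qed

lemma extend_ideal_subset:
  assumes A: "subring_on A" and I: "ideal_in I (polys_over A)" and f: "f \<in> polys_over {a\<in>A. [:a:] \<in> I}"
  shows "f \<in> I"
proof -
  have "Polynomial.monom (pcoeff f i) i \<in> I" for i
  proof -
    have "[:pcoeff f i:] \<in> I" using f by (auto simp: polys_over_def)
    then have "Polynomial.monom 1 i * [:pcoeff f i:] \<in> I"
      using ideal_in_mult[OF I polys_over_monom[OF A subring_on_1[OF A]]] by blast
    then show ?thesis by (simp add: smult_monom)
  qed
  then have "(\<Sum>i\<le>pdeg f. Polynomial.monom (pcoeff f i) i) \<in> I" by (intro ideal_in_sum[OF I]) auto
  then show ?thesis by (simp add: poly_as_sum_of_monoms)
qed

text \<open>\<open>F\<close> stands for a generator of the image of \<open>I\<close> over the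
  residue field of \<open>p\<close>. If its leading coefficient were in \<open>p\<close>, deleting
  the leading term would leave an element of \<open>I\<close> outside p[Z] of smaller
  degree.\<close>

lemma min_degree_elem:
  assumes A: "subring_on A" and I: "prime_in I (polys_over A)" and p: "{a\<in>A. [:a:] \<in> I} = p"
    and ne: "I \<noteq> polys_over p"
  obtains F where "F \<in> I" "F \<notin> polys_over p" "pdeg F > 0" "pcoeff F (pdeg F) \<notin> p"
    "\<And>G. G \<in> I \<Longrightarrow> G \<notin> polys_over p \<Longrightarrow> pdeg F \<le> pdeg G"
proof -
  note id = prime_in_ideal[OF I]
  have sub: "polys_over p \<subseteq> I" using extend_ideal_subset[OF A id] p by blast
  then obtain G where "G \<in> I - polys_over p" using ne by blast
  then obtain F where F: "F \<in> I - polys_over p" "\<And>G. G \<in> I - polys_over p \<Longrightarrow> pdeg F \<le> pdeg G"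
    using ex_has_least_nat[of "\<lambda>F. F \<in> I - polys_over p" G pdeg] by blast
  have FA: "F \<in> polys_over A" using F ideal_in_sub[OF id] by blast
  have 0: "0 \<in> p" using p ideal_in_0[OF id] A by auto
  have d: "pdeg F > 0"
  proof (rule ccontr)
    assume "\<not> ?thesis"
    then obtain c where c: "F = [:c:]" by (metis degree_eq_zeroE gr0I)
    then have "c \<in> p" using F FA p polys_over_coeff[OF FA, of 0] by auto
    then have "F \<in> polys_over p" using c 0 by (auto simp: polys_over_def coeff_pCons split: nat.split)
    then show False using F by blast
  qed
  have "pcoeff F (pdeg F) \<notin> p"
  proof
    let ?M = "Polynomial.monom (pcoeff F (pdeg F)) (pdeg F)"
    assume "pcoeff F (pdeg F) \<in> p"
    then have M: "?M \<in> polys_over p" using 0 by (auto simp: polys_over_def)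
    then have "F - ?M \<in> I" using F sub ideal_in_diff[OF subring_on_polys_over[OF A] id] by blast
    moreover have "F - ?M \<notin> polys_over p"
    proof
      assume "F - ?M \<in> polys_over p"
      then have "pcoeff F i \<in> p" for i
        using \<open>pcoeff F (pdeg F) \<in> p\<close> by (cases "i = pdeg F") (auto simp: polys_over_def dest: spec[of _ i])
      then show False using F by (auto simp: polys_over_def)
    qed
    moreover have "pdeg (F - ?M) < pdeg F"
    proof -
      have "pdeg (F - ?M) \<le> pdeg F - 1"
      proof (rule degree_le, intro allI impI)
        fix i assume "pdeg F - 1 < i"
        then show "pcoeff (F - ?M) i = 0" by (cases "i = pdeg F") (auto intro!: coeff_eq_0)
      qed
      then show ?thesis using d by linarith
    qed
    ultimately show False using F(2) by fastforce
  qed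
  then show ?thesis using that F d by blast
qed

text \<open>The fibre of A[Z] over \<open>p\<close> is a principal ideal domain. Concretely,
  \<open>G\<close> divides \<open>F\<close> up to a power of its leading coefficient and up to p[Z];
  the cofactor \<open>H\<close> has too small a degree modulo \<open>p\<close> to lie in
  \<open>I\<close>, so \<open>G\<close> lies there. All of \<open>J\<close> is divisible by
  \<open>G\<close> in the same sense and follows.\<close>

lemma primes_over_same:
  assumes A: "subring_on A" and I: "prime_in I (polys_over A)" and J: "prime_in J (polys_over A)" 
    and "I \<subset> J" and Ip: "{a\<in>A. [:a:] \<in> I} = p" and Jp: "{a\<in>A. [:a:] \<in> J} = p" and P: "prime_in p A"
  shows "I = polys_over p"
proof (rule ccontr)
  assume ne: "I \<noteq> polys_over p"
  note idI = prime_in_ideal[OF I] and idJ = prime_in_ideal[OF J] and SA = subring_on_polys_over[OF A]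
  note idP = prime_in_ideal[OF P]
  have subI: "polys_over p \<subseteq> I" using extend_ideal_subset[OF A idI] Ip by blast
  have neJ: "J \<noteq> polys_over p" using subI assms(4) by blast
  obtain F where F: "F \<in> I" "F \<notin> polys_over p" "pdeg F > 0" "pcoeff F (pdeg F) \<notin> p"
    "\<And>G. G \<in> I \<Longrightarrow> G \<notin> polys_over p \<Longrightarrow> pdeg F \<le> pdeg G" 
    using min_degree_elem[OF A I Ip ne] by metis
  obtain G where G: "G \<in> J" "G \<notin> polys_over p" "pdeg G > 0" "pcoeff G (pdeg G) \<notin> p"
    "\<And>F. F \<in> J \<Longrightarrow> F \<notin> polys_over p \<Longrightarrow> pdeg G \<le> pdeg F" 
    using min_degree_elem[OF A J Jp neJ] by metis
  have FA: "F \<in> polys_over A" and GA: "G \<in> polys_over A" using F G ideal_in_sub[OF idI] ideal_in_sub[OF idJ] by blast+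
  let ?c = "pcoeff G (pdeg G)"
  have c: "?c \<in> A" using GA by (rule polys_over_coeff)
  have cn: "?c ^ n \<in> A - p" for n using prime_in_power[OF P A c] G(4) c A by auto
  have div: "\<exists>n H R. H \<in> polys_over A \<and> R \<in> polys_over p \<and> [:?c ^ n:] * f = G * H + R" if f: "f \<in> J" for f
  proof -
    have fA: "f \<in> polys_over A" using f ideal_in_sub[OF idJ] by blast
    obtain n H R where HR: "H \<in> polys_over A" "R \<in> polys_over A" "[:?c ^ n:] * f = G * H + R" "pdeg R < pdeg G"
      using pseudo_division[OF A GA G(3) fA order_refl] by blast
    have "R = [:?c ^ n:] * f - H * G" using HR by (simp add: algebra_simps)
    also have "\<dots> \<in> J"
      using f G(1) HR(1) polys_over_const[OF A] cn by (intro ideal_in_diff[OF SA idJ] ideal_in_mult[OF idJ]) auto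
    finally have "R \<in> polys_over p" using G(5) HR(4) by force
    then show ?thesis using HR by blast
  qed
  have cancel: "f \<in> I" if f: "f \<in> polys_over A" "[:?c ^ n:] * f \<in> I" for f n
  proof -
    have "[:?c ^ n:] \<notin> I" using cn Ip by blast
    then show ?thesis using prime_in_mult[OF I polys_over_const[OF A] f(1) f(2)] cn by blast
  qed
  have "F \<in> J" using F(1) assms(4) by blast
  from div[OF this] obtain n H R where HR: "H \<in> polys_over A" "R \<in> polys_over p" "[:?c ^ n:] * F = G * H + R" by blast
  have GH: "G * H = [:?c ^ n:] * F - R" using HR by simp
  have "[:?c ^ n:] * F \<in> I" using F(1) cn polys_over_const[OF A] by (intro ideal_in_mult[OF idI]) auto
  then have "G * H \<in> I" unfolding GH using HR(2) subI by (intro ideal_in_diff[OF SA idI]) auto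
  moreover have "H \<notin> I"
  proof
    assume H: "H \<in> I"
    have Hp: "H \<notin> polys_over p"
    proof
      assume "H \<in> polys_over p"
      then have "[:?c ^ n:] * F \<in> polys_over p" unfolding HR(3) using HR(2) GA 
        by (intro ideal_in_add[OF ideal_polys_over[OF A idP]] ideal_in_mult[OF ideal_polys_over[OF A idP]]) auto
      then have "[:?c ^ n:] \<in> polys_over p \<or> F \<in> polys_over p"
        using prime_in_mult[OF prime_polys_over[OF A P] polys_over_const[OF A] FA] cn by blast
      then have "?c ^ n \<in> p" using F(2) polys_over_coeff[of "[:?c ^ n:]" p 0] by simp
      then show False using cn by blast
    qed
    txt \<open>Compare coefficients modulo \<open>p\<close>: the top coefficient of \<open>H\<close> outside \<open>p\<close> sits in degree at least \<open>pdeg F\<close>.\<close>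
    define j where "j = (GREATEST j. pcoeff H j \<notin> p)"
    have ex: "\<exists>j. pcoeff H j \<notin> p" using Hp by (auto simp: polys_over_def)
    have bd: "\<And>j. pcoeff H j \<notin> p \<Longrightarrow> j \<le> pdeg H" using ideal_in_0[OF idP] by (metis coeff_eq_0 not_le)
    have j: "pcoeff H j \<notin> p" using ex bd unfolding j_def by (metis (mono_tags, lifting) GreatestI_ex_nat)
    have j2: "pcoeff H l \<in> p" if "l > j" for l
      using bd that Greatest_le_nat[of "\<lambda>j. pcoeff H j \<notin> p" l "pdeg H"] unfolding j_def by force
    define H' where "H' = (\<Sum>l\<le>j. Polynomial.monom (pcoeff H l) l)"
    have cH': "pcoeff H' l = (if l \<le> j then pcoeff H l else 0)" for l
      by (auto simp: H'_def coeff_sum when_def sum.delta)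
    have HH': "H - H' \<in> polys_over p" using j2 ideal_in_0[OF idP] by (auto simp: polys_over_def cH' not_le)
    then have "H' \<in> I" using ideal_in_diff[OF SA idI H, of "H - H'"] subI by auto
    moreover have "H' \<notin> polys_over p" using j cH' by (auto simp: polys_over_def intro!: exI[of _ j])
    moreover have "pdeg H' \<le> j" by (rule degree_le) (simp add: cH')
    ultimately have jF: "pdeg F \<le> j" using F(5) by fastforce
    \<comment> \<open>Since pdeg F \<le> j < pdeg G + j, this coefficient of \<open>G * H\<close>
      comes from \<open>R\<close> alone; modulo \<open>p\<close> it is also the product of two
      coefficients outside \<open>p\<close>.\<close>
    have "pcoeff (G * H) (pdeg G + j) \<in> p"
    proof -
      have "pcoeff ([:?c ^ n:] * F) (pdeg G + j) = 0" using jF G(3) coeff_eq_0[of F "pdeg G + j"] by simp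
      then have "pcoeff (G * H) (pdeg G + j) = - pcoeff R (pdeg G + j)" unfolding GH by simp
      then show ?thesis using HR(2) ideal_in_uminus[OF A idP] by (auto simp: polys_over_def)
    qed
    moreover have "pcoeff (G * H) (pdeg G + j) = pcoeff G (pdeg G) * pcoeff H j + 
        (\<Sum>l\<in>{..pdeg G+j} - {pdeg G}. pcoeff G l * pcoeff H (pdeg G + j - l))"
      unfolding coeff_mult by (subst sum.remove[of _ "pdeg G"]) auto
    moreover have "(\<Sum>l\<in>{..pdeg G+j} - {pdeg G}. pcoeff G l * pcoeff H (pdeg G + j - l)) \<in> p"
    proof (rule ideal_in_sum[OF idP])
      fix l assume l: "l \<in> {..pdeg G+j} - {pdeg G}"
      show "pcoeff G l * pcoeff H (pdeg G + j - l) \<in> p"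
      proof (cases "l < pdeg G")
        case True then show ?thesis using j2[of "pdeg G + j - l"] polys_over_coeff[OF GA] by (intro ideal_in_mult[OF idP]) auto
      next
        case False 
        then have "pcoeff G l = 0" using l by (intro coeff_eq_0) auto
        then show ?thesis using ideal_in_0[OF idP] by simp
      qed
    qed
    ultimately have "pcoeff G (pdeg G) * pcoeff H j \<in> p" using ideal_in_add_cancel[OF A idP] by metis
    then show False using prime_in_mult[OF P c polys_over_coeff[OF HR(1)]] G(4) j by blast
  qed
  ultimately have GI: "G \<in> I" using prime_in_mult[OF I GA HR(1)] by blast
  have "J \<subseteq> I"
  proof
    fix f assume f: "f \<in> J"
    from div[OF this] obtain n H R where HR: "H \<in> polys_over A" "R \<in> polys_over p" "[:?c ^ n:] * f = G * H + R" by blast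
    have "G * H + R \<in> I" using GI HR(1,2) subI by (intro ideal_in_add[OF idI] ideal_in_mult'[OF idI]) auto
    then show "f \<in> I" using cancel[of f n] HR(3) f ideal_in_sub[OF idJ] by auto
  qed
  then show False using assms(4) by blast
qed

section \<open>The dimension of a polynomial ring over a Noetherian ring\<close>

text \<open>A free module of rank \<open>d\<close>. Stating the bound through coefficients makes
  \<open>d = 0\<close> the zero module, since the zero polynomial has degree 0.\<close>

definition polys_below :: "'r::comm_ring_1 set \<Rightarrow> nat \<Rightarrow> 'r poly set" where
  "polys_below A d = {h\<in>polys_over A. \<forall>i\<ge>d. pcoeff h i = 0}"

lemma polys_below_add: "subring_on A \<Longrightarrow> g \<in> polys_below A d \<Longrightarrow> h \<in> polys_below A d \<Longrightarrow> g + h \<in> polys_below A d"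
  by (auto simp: polys_below_def polys_over_def)

lemma polys_below_const: "subring_on A \<Longrightarrow> a \<in> A \<Longrightarrow> h \<in> polys_below A d \<Longrightarrow> [:a:] * h \<in> polys_below A d"
  by (auto simp: polys_below_def polys_over_def)

lemma polys_below_0: "subring_on A \<Longrightarrow> 0 \<in> polys_below A d"
  by (auto simp: polys_below_def polys_over_def)

lemma polys_below_mono: "d \<le> e \<Longrightarrow> polys_below A d \<subseteq> polys_below A e"
  by (auto simp: polys_below_def)

context adjacent_primes
begin

text \<open>Stands for the submodules of the free module of rank \<open>d\<close> over the
  localization at \<open>q\<close>.\<close>

definition sat_submodule :: "nat \<Rightarrow> 'r poly set \<Rightarrow> bool" where
  "sat_submodule d U \<longleftrightarrow> U \<subseteq> polys_below A d \<and> 0 \<in> U \<and> (\<forall>g\<in>U. \<forall>h\<in>U. g + h \<in> U) \<and>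
     (\<forall>r\<in>A. \<forall>h\<in>U. [:r:] * h \<in> U) \<and> (\<forall>w\<in>A-q. \<forall>h\<in>polys_below A d. [:w:] * h \<in> U \<longrightarrow> h \<in> U)"

lemma sat_submodule_diff: "sat_submodule d U \<Longrightarrow> g \<in> U \<Longrightarrow> h \<in> U \<Longrightarrow> g - h \<in> U"
proof -
  assume U: "sat_submodule d U" "g \<in> U" "h \<in> U"
  have "-1 \<in> A" using A by auto
  then have "[:-1:] * h \<in> U" using U by (auto simp: sat_submodule_def)
  then have "g + [:-1:] * h \<in> U" using U unfolding sat_submodule_def by blast
  then show ?thesis by simp
qed

definition lead_sat :: "'r poly set \<Rightarrow> nat \<Rightarrow> 'r set" where
  "lead_sat U j = sat ((\<lambda>h. pcoeff h j) ` {h\<in>U. \<forall>i>j. pcoeff h i = 0})"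

lemma lead_sat_ideal:
  assumes "sat_submodule d U" shows "ideal_in (lead_sat U j) A"
  unfolding lead_sat_def
proof (rule sat_ideal, unfold ideal_in_def, intro conjI ballI)
  let ?L = "(\<lambda>h. pcoeff h j) ` {h\<in>U. \<forall>i>j. pcoeff h i = 0}"
  show "?L \<subseteq> A" using assms by (auto simp: sat_submodule_def polys_below_def polys_over_def)
  show "0 \<in> ?L" using assms by (intro image_eqI[of _ _ 0]) (auto simp: sat_submodule_def)
  fix a b assume "a \<in> ?L" "b \<in> ?L"
  then obtain g h where "a = pcoeff g j" "g \<in> U" "\<forall>i>j. pcoeff g i = 0" 
    "b = pcoeff h j" "h \<in> U" "\<forall>i>j. pcoeff h i = 0" by auto
  then show "a + b \<in> ?L" using assms by (intro image_eqI[of _ _ "g + h"]) (auto simp: sat_submodule_def)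
next
  let ?L = "(\<lambda>h. pcoeff h j) ` {h\<in>U. \<forall>i>j. pcoeff h i = 0}"
  fix r b assume "r \<in> A" "b \<in> ?L"
  then obtain h where "r \<in> A" "b = pcoeff h j" "h \<in> U" "\<forall>i>j. pcoeff h i = 0" by auto
  moreover from this assms have "[:r:] * h \<in> U" unfolding sat_submodule_def by blast
  ultimately show "r * b \<in> ?L" by (intro image_eqI[of _ _ "[:r:] * h"]) auto
qed

text \<open>The leading coefficients in degrees below \<open>d\<close> turn a submodule into
  \<open>d\<close> ideals above \<open>B\<close>, whose ranks are added. Equal sums force equality
  in every degree because no summand decreases.\<close>

lemma poly_rank:
  assumes "colength_le B n" "ideal_in B A"
  shows "\<exists>\<rho>. \<forall>U. sat_submodule d U \<and> {h\<in>polys_below A d. \<forall>i. pcoeff h i \<in> B} \<subseteq> U \<longrightarrow> \<rho> U \<le> d * n \<and>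
    (\<forall>U'. sat_submodule d U' \<and> U \<subseteq> U' \<longrightarrow> \<rho> U \<le> \<rho> U' \<and> (\<rho> U = \<rho> U' \<longrightarrow> U = U'))"
proof -
  obtain \<rho>0 where \<rho>0: "\<forall>J. ideal_in J A \<and> saturated J \<and> B \<subseteq> J \<longrightarrow> \<rho>0 J \<le> n \<and>
    (\<forall>J'. ideal_in J' A \<and> saturated J' \<and> J \<subseteq> J' \<longrightarrow> \<rho>0 J \<le> \<rho>0 J' \<and> (\<rho>0 J = \<rho>0 J' \<longrightarrow> J = J'))"
    using colength_le_rank[OF assms(1)] by (rule exE)
  define \<rho> where "\<rho> U = (\<Sum>j<d. \<rho>0 (lead_sat U j))" for U
  have plB: "B \<subseteq> lead_sat U j" if U: "{h\<in>polys_below A d. \<forall>i. pcoeff h i \<in> B} \<subseteq> U" and j: "j < d" for U j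
  proof
    fix b assume b: "b \<in> B"
    then have bA: "b \<in> A" using ideal_in_sub[OF assms(2)] by blast
    have "Polynomial.monom b j \<in> {h\<in>polys_below A d. \<forall>i. pcoeff h i \<in> B}" 
      using b bA j A ideal_in_0[OF assms(2)] by (auto simp: polys_below_def polys_over_def)
    then have "Polynomial.monom b j \<in> U" using U by blast
    then have "b \<in> (\<lambda>h. pcoeff h j) ` {h\<in>U. \<forall>i>j. pcoeff h i = 0}"
      by (intro image_eqI[of _ _ "Polynomial.monom b j"]) auto
    then show "b \<in> lead_sat U j" unfolding lead_sat_def sat_def using bA W_1 by (auto intro!: bexI[of _ 1])
  qed
  have plsat: "saturated (lead_sat U j)" for U j unfolding lead_sat_def by (rule sat_saturated)
  have plmono: "lead_sat U j \<subseteq> lead_sat U' j" if "U \<subseteq> U'" for U U' j 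
    unfolding lead_sat_def by (rule sat_mono) (use that in auto)
  have b1: "\<rho> U \<le> d * n" if U: "sat_submodule d U" "{h\<in>polys_below A d. \<forall>i. pcoeff h i \<in> B} \<subseteq> U" for U
  proof -
    have "\<rho>0 (lead_sat U j) \<le> n" if "j < d" for j
      using \<rho>0 lead_sat_ideal[OF U(1)] plsat plB[OF U(2) that] by blast
    then have "\<rho> U \<le> (\<Sum>j<d. n)" unfolding \<rho>_def by (intro sum_mono) auto
    then show ?thesis by simp
  qed
  have b2: "\<rho> U \<le> \<rho> U' \<and> (\<rho> U = \<rho> U' \<longrightarrow> U = U')" 
    if U: "sat_submodule d U" "{h\<in>polys_below A d. \<forall>i. pcoeff h i \<in> B} \<subseteq> U" and U': "sat_submodule d U'" "U \<subseteq> U'" for U U'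
  proof -
    have le: "\<rho>0 (lead_sat U j) \<le> \<rho>0 (lead_sat U' j)" "\<rho>0 (lead_sat U j) = \<rho>0 (lead_sat U' j) \<Longrightarrow> lead_sat U j = lead_sat U' j" if "j < d" for j
      using \<rho>0[rule_format, of "lead_sat U j"] lead_sat_ideal[OF U(1), of j] lead_sat_ideal[OF U'(1), of j] plsat[of _ j] plB[OF U(2) that] 
        plmono[OF U'(2), of j] by simp_all
    have "\<rho> U \<le> \<rho> U'" unfolding \<rho>_def by (intro sum_mono le) auto
    moreover have "U = U'" if eq: "\<rho> U = \<rho> U'"
    proof -
      have "\<rho>0 (lead_sat U j) = \<rho>0 (lead_sat U' j)" if "j < d" for j
        using sum_mono_inv[of "\<lambda>j. \<rho>0 (lead_sat U j)" "{..<d}" "\<lambda>j. \<rho>0 (lead_sat U' j)" j] eq le(1) that unfolding \<rho>_def by auto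
      then have pl: "lead_sat U j = lead_sat U' j" if "j < d" for j using le(2) that by blast
      \<comment> \<open>Leading coefficients are removed one degree at a time as in
        \<open>lead_ideal_eq\<close>, here up to a denominator \<open>w\<close> that saturation
        cancels.\<close>
      have "h \<in> U" if "h \<in> U'" "m \<le> d" "\<forall>i\<ge>m. pcoeff h i = 0" for h m
        using that
      proof (induction m arbitrary: h)
        case 0
        then have "h = 0" by (intro poly_eqI) auto
        then show ?case using U(1) by (auto simp: sat_submodule_def)
      next
        case (Suc m)
        have hA: "h \<in> polys_below A d" using Suc.prems(1) U'(1) by (auto simp: sat_submodule_def)
        have cA: "pcoeff h m \<in> A" using hA polys_over_coeff by (auto simp: polys_below_def)
        have "pcoeff h m \<in> (\<lambda>h. pcoeff h m) ` {h\<in>U'. \<forall>i>m. pcoeff h i = 0}" using Suc.prems by auto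
        then have "pcoeff h m \<in> lead_sat U' m" unfolding lead_sat_def sat_def using cA W_1 by (auto intro!: bexI[of _ 1])
        then have "pcoeff h m \<in> lead_sat U m" using pl[of m] Suc.prems by auto
        then obtain w g where w: "w \<in> A - q" "g \<in> U" "\<forall>i>m. pcoeff g i = 0" "w * pcoeff h m = pcoeff g m" 
          unfolding lead_sat_def sat_def by blast
        have "[:w:] * h \<in> U'" using Suc.prems(1) U'(1) w(1) unfolding sat_submodule_def by blast
        then have d: "[:w:] * h - g \<in> U'" using sat_submodule_diff[OF U'(1)] w(2) U'(2) by blast
        have "pcoeff ([:w:] * h - g) i = 0" if "i \<ge> m" for i
          using Suc.prems(3) w(3,4) that by (cases "i = m") auto
        then have "[:w:] * h - g \<in> U" using Suc.IH[OF d] Suc.prems(2) by auto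
        then have "([:w:] * h - g) + g \<in> U" using w(2) U(1) unfolding sat_submodule_def by blast
        then have "[:w:] * h \<in> U" by simp
        then show ?case using U(1) w(1) hA unfolding sat_submodule_def by blast
      qed
      from this[of _ d] have "U' \<subseteq> U" using U'(1) by (auto simp: sat_submodule_def polys_below_def)
      then show ?thesis using U'(2) by blast
    qed
    ultimately show ?thesis by blast
  qed
  show ?thesis by (rule exI[of _ \<rho>]) (use b1 b2 in blast)
qed

text \<open>Elements of the t-th shift are multiples of the t-th power of \<open>a\<close> modulo
  \<open>p\<close> and up to denominators; the coefficients are treated one by one. This places a
  submodule of known colength inside all the modules counted in
  \<open>no_prime_between\<close>.\<close>

lemma base_approx:
  assumes a: "a \<in> A" and I: "ideal_in I (polys_over A)" "polys_over p \<subseteq> I"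
    and h: "h \<in> polys_below A k" "\<And>i. pcoeff h i \<in> (shift a ^^ t) A"
  shows "\<exists>w\<in>A-q. \<exists>g\<in>polys_below A k. [:w:] * h - [:a ^ t:] * g \<in> I"
  using h
proof (induction k arbitrary: h)
  case 0
  then have "h = 0" by (intro poly_eqI) (auto simp: polys_below_def)
  then show ?case using W_1 polys_below_0[OF A] ideal_in_0[OF I(1)] by (intro bexI[of _ 1] bexI[of _ 0]) auto
next
  case (Suc k)
  note SA = subring_on_polys_over[OF A]
  let ?c = "pcoeff h k"
  let ?h = "h - Polynomial.monom ?c k"
  have "ideal_in A A" using A by (auto simp: ideal_in_def)
  then have idt: "ideal_in ((shift a ^^ t) A) A"
    by (induction t) (simp_all add: shift_ideal[OF a])
  have hb: "?h \<in> polys_below A k"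
  proof -
    have hA: "h \<in> polys_over A" using Suc.prems(1) by (simp add: polys_below_def)
    have "?h \<in> polys_over A" using subring_on_diff[OF SA hA polys_over_monom[OF A polys_over_coeff[OF hA]]] .
    moreover have "pcoeff ?h i = 0" if "i \<ge> k" for i using Suc.prems(1) that by (cases "i = k") (simp_all add: polys_below_def)
    ultimately show ?thesis unfolding polys_below_def by blast
  qed
  have "pcoeff ?h i \<in> (shift a ^^ t) A" for i using Suc.prems(2)[of i] ideal_in_0[OF idt] by (cases "i = k") simp_all
  from Suc.IH[OF hb this] obtain w g where w: "w \<in> A - q" "g \<in> polys_below A k" "[:w:] * ?h - [:a ^ t:] * g \<in> I" by blast
  obtain v u y where v: "v \<in> A - q" "u \<in> p" "y \<in> A" "v * ?c = u + a ^ t * y"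
    using shift_power_mem[OF a Suc.prems(2)[of k]] by blast
  let ?g = "[:v:] * g + Polynomial.monom (w * y) k"
  have g: "?g \<in> polys_below A (Suc k)"
  proof (rule polys_below_add[OF A])
    show "[:v:] * g \<in> polys_below A (Suc k)"
      using subsetD[OF polys_below_mono[of k "Suc k" A] polys_below_const[OF A _ w(2), of v]] v by simp
    show "Polynomial.monom (w * y) k \<in> polys_below A (Suc k)"
      using w v A by (auto simp: polys_below_def polys_over_def)
  qed
  have e: "[:v:] * Polynomial.monom ?c k = Polynomial.monom u k + [:a^t:] * Polynomial.monom y k"
    using v(4) by (simp add: smult_monom add_monom)
  have "[:w * v:] = [:w:] * [:v:]" "Polynomial.monom (w * y) k = [:w:] * Polynomial.monom y k"
    by (simp_all add: smult_monom)
  then have "[:w * v:] * h - [:a ^ t:] * ?g = 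
     [:v:] * ([:w:] * ?h - [:a ^ t:] * g) + [:w:] * ([:v:] * Polynomial.monom ?c k - [:a^t:] * Polynomial.monom y k)"
    by (simp only: algebra_simps)
  also have "\<dots> = [:v:] * ([:w:] * ?h - [:a ^ t:] * g) + [:w:] * Polynomial.monom u k" unfolding e by simp
  also have "\<dots> \<in> I"
  proof (intro ideal_in_add[OF I(1)] ideal_in_mult[OF I(1)])
    have "Polynomial.monom u k \<in> polys_over p" using v(2) ideal_in_0[OF prime_in_ideal[OF p]] by (auto simp: polys_over_def)
    then show "Polynomial.monom u k \<in> I" using I(2) by blast
  qed (use w v polys_over_const[OF A] in auto)
  finally show ?case using W_mult[OF w(1) v(1)] g by blast
qed

text \<open>The residue ring \<open>A[Z]/I\<close>, localized at \<open>q\<close>, has finite rank \<open>d\<close> over \<open>A/p\<close>, so its quotients by powers of 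
  \<open>a\<close> have length growing at rate at most \<open>d \<sqdot> e\<close>; if \<open>I \<subseteq> q[Z]\<close> the powers of \<open>Z\<close> would force 
  a larger rate.\<close>

lemma no_prime_between:
  assumes I: "prime_in I (polys_over A)" and Iq: "I \<subseteq> polys_over q" and Ip: "{a\<in>A. [:a:] \<in> I} = p"
  shows "I = polys_over p"
proof (rule ccontr)
  assume ne: "I \<noteq> polys_over p"
  note id = prime_in_ideal[OF I] and SA = subring_on_polys_over[OF A]
  have pI: "polys_over p \<subseteq> I" using extend_ideal_subset[OF A id] Ip by blast
  obtain F where F: "F \<in> I" "F \<notin> polys_over p" "pdeg F > 0" "pcoeff F (pdeg F) \<notin> p"
    using min_degree_elem[OF A I Ip ne] by metis
  define d where "d = pdeg F"
  define a where "a = pcoeff F d"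
  have FA: "F \<in> polys_over A" using F(1) ideal_in_sub[OF id] by blast
  have a: "a \<in> A" "a \<notin> p" using FA F(4) by (auto simp: a_def d_def polys_over_def)
  have aq: "a \<in> q" using F(1) Iq by (auto simp: a_def polys_over_def)
  have apow: "[:a ^ m:] \<in> polys_over A" for m using a A polys_over_const by blast
  have apn: "[:a ^ m:] \<notin> I" for m using Ip a prime_in_power[OF p A a(1)] A by blast
  have idA: "ideal_in A A" using A by (auto simp: ideal_in_def)
  have idst: "ideal_in ((shift a ^^ t) A) A" for t by (induction t) (simp_all add: shift_ideal[OF a(1)] idA)
  obtain e where e: "colength_le (shift a A) e"
  proof -
    have "p \<subseteq> shift a A" 
    proof
      fix x assume x: "x \<in> p"
      then have "x \<in> A" using ideal_in_sub[OF prime_in_ideal[OF p]] by blast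
      then show "x \<in> shift a A" using x A W_1 by (intro shift_memI[of _ 1 x 0]) auto
    qed
    moreover have "a \<in> shift a A" 
      using a A W_1 ideal_in_0[OF prime_in_ideal[OF p]] by (intro shift_memI[of _ 1 0 1]) auto
    ultimately show ?thesis using that colength_le_exists[OF a, of "shift a A"] shift_ideal[OF a(1) idA] sat_saturated unfolding shift_def by blast
  qed
  \<comment> \<open>There will be \<open>s\<close> levels with \<open>Suc r\<close> strict steps
    each, against a rank of at most \<open>d * ((r + s) * e)\<close>. Taking \<open>r\<close> at
    least \<open>d * e\<close> makes the number of steps grow faster in \<open>s\<close>, and
    \<open>s\<close> exceeds the constant \<open>d * e * r\<close> that remains. The summand
    \<open>d\<close> in \<open>r\<close> also gives \<open>d \<le> Suc r\<close>, as used in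
    \<open>Vbase\<close>.\<close>
  define r where "r = d * e + d"
  define s where "s = d * e * r + 1"
  obtain \<rho> where \<rho>0: "\<forall>U. sat_submodule d U \<and> {h\<in>polys_below A d. \<forall>i. pcoeff h i \<in> (shift a ^^ (r+s)) A} \<subseteq> U \<longrightarrow> \<rho> U \<le> d * ((r+s)*e) \<and>
    (\<forall>U'. sat_submodule d U' \<and> U \<subseteq> U' \<longrightarrow> \<rho> U \<le> \<rho> U' \<and> (\<rho> U = \<rho> U' \<longrightarrow> U = U'))"
    using poly_rank[OF colength_le_shift_power[OF a(1) e] idst, of d "r+s"] by (rule exE)
  define V where "V m i = {h\<in>polys_below A d. \<exists>w\<in>A-q. \<exists>g\<in>polys_below A i. \<exists>g'\<in>polys_below A (Suc r).
     [:w:] * h - ([:a^m:] * g + [:a^Suc m:] * g') \<in> I}" for m i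
  have VI: "h \<in> V m i" if "h \<in> polys_below A d" "w \<in> A - q" "g \<in> polys_below A i" "g' \<in> polys_below A (Suc r)"
     "[:w:] * h - ([:a^m:] * g + [:a^Suc m:] * g') \<in> I" for h w g g' m i
    unfolding V_def using that by blast
  have Vsub: "sat_submodule d (V m i)" for m i
    unfolding sat_submodule_def
  proof (intro conjI ballI impI)
    show "V m i \<subseteq> polys_below A d" by (auto simp: V_def)
    show "0 \<in> V m i" 
      by (rule VI[where w = 1 and g = 0 and g' = 0]) (use W_1 polys_below_0[OF A] ideal_in_0[OF id] in auto)
  next
    fix h1 h2 assume "h1 \<in> V m i" "h2 \<in> V m i"
    then obtain w1 g1 g1' w2 g2 g2' where 
      1: "h1 \<in> polys_below A d" "w1 \<in> A - q" "g1 \<in> polys_below A i" "g1' \<in> polys_below A (Suc r)"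
        "[:w1:] * h1 - ([:a^m:] * g1 + [:a^Suc m:] * g1') \<in> I" and
      2: "h2 \<in> polys_below A d" "w2 \<in> A - q" "g2 \<in> polys_below A i" "g2' \<in> polys_below A (Suc r)"
        "[:w2:] * h2 - ([:a^m:] * g2 + [:a^Suc m:] * g2') \<in> I"
      unfolding V_def by blast
    show "h1 + h2 \<in> V m i"
    proof (rule VI)
      show "h1 + h2 \<in> polys_below A d" using 1 2 polys_below_add[OF A] by blast
      show "w1 * w2 \<in> A - q" using 1 2 W_mult by blast
      show "[:w2:] * g1 + [:w1:] * g2 \<in> polys_below A i" 
        using 1 2 by (intro polys_below_add[OF A] polys_below_const[OF A]) auto
      show "[:w2:] * g1' + [:w1:] * g2' \<in> polys_below A (Suc r)" 
        using 1 2 by (intro polys_below_add[OF A] polys_below_const[OF A]) auto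
      have "[:w1 * w2:] = [:w1:] * [:w2:]" by simp
      then have "[:w1 * w2:] * (h1 + h2) - ([:a^m:] * ([:w2:] * g1 + [:w1:] * g2) + [:a^Suc m:] * ([:w2:] * g1' + [:w1:] * g2'))
        = [:w2:] * ([:w1:] * h1 - ([:a^m:] * g1 + [:a^Suc m:] * g1')) + [:w1:] * ([:w2:] * h2 - ([:a^m:] * g2 + [:a^Suc m:] * g2'))"
        by (simp only: algebra_simps)
      also have "\<dots> \<in> I" using 1 2 by (intro ideal_in_add[OF id] ideal_in_mult[OF id] polys_over_const[OF A]) auto
      finally show "[:w1 * w2:] * (h1 + h2) - ([:a^m:] * ([:w2:] * g1 + [:w1:] * g2) + [:a^Suc m:] * ([:w2:] * g1' + [:w1:] * g2')) \<in> I" .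
    qed
  next
    fix c h assume c: "c \<in> A" and "h \<in> V m i"
    then obtain w g g' where 
      1: "h \<in> polys_below A d" "w \<in> A - q" "g \<in> polys_below A i" "g' \<in> polys_below A (Suc r)"
        "[:w:] * h - ([:a^m:] * g + [:a^Suc m:] * g') \<in> I"
      unfolding V_def by blast
    show "[:c:] * h \<in> V m i"
    proof (rule VI)
      show "[:c:] * h \<in> polys_below A d" "[:c:] * g \<in> polys_below A i" "[:c:] * g' \<in> polys_below A (Suc r)" 
        using 1 c polys_below_const[OF A] by blast+
      have "[:w:] * ([:c:] * h) - ([:a^m:] * ([:c:] * g) + [:a^Suc m:] * ([:c:] * g'))
         = [:c:] * ([:w:] * h - ([:a^m:] * g + [:a^Suc m:] * g'))" by (simp only: algebra_simps)
      also have "\<dots> \<in> I" using 1 c by (intro ideal_in_mult[OF id] polys_over_const[OF A]) auto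
      finally show "[:w:] * ([:c:] * h) - ([:a^m:] * ([:c:] * g) + [:a^Suc m:] * ([:c:] * g')) \<in> I" .
    qed (use 1 in auto)
  next
    fix v h assume v: "v \<in> A - q" and h: "h \<in> polys_below A d" and "[:v:] * h \<in> V m i"
    then obtain w g g' where 
      1: "w \<in> A - q" "g \<in> polys_below A i" "g' \<in> polys_below A (Suc r)"
        "[:w:] * ([:v:] * h) - ([:a^m:] * g + [:a^Suc m:] * g') \<in> I"
      unfolding V_def by blast
    have "[:w * v:] * h = [:w:] * ([:v:] * h)" by (simp add: mult.commute)
    then show "h \<in> V m i" using VI[OF h W_mult[OF 1(1) v] 1(2,3)] 1(4) by simp
  qed
  have Vbase: "{h\<in>polys_below A d. \<forall>i. pcoeff h i \<in> (shift a ^^ (r+s)) A} \<subseteq> V m i" if m: "Suc m \<le> r + s" for m i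
  proof
    fix h assume "h \<in> {h\<in>polys_below A d. \<forall>i. pcoeff h i \<in> (shift a ^^ (r+s)) A}"
    then have h: "h \<in> polys_below A d" "\<And>i. pcoeff h i \<in> (shift a ^^ (r+s)) A" by auto
    obtain w g where w: "w \<in> A - q" "g \<in> polys_below A d" "[:w:] * h - [:a ^ (r+s):] * g \<in> I"
      using base_approx[OF a(1) id pI h] by blast
    have "a ^ (r+s) = a ^ Suc m * a ^ (r + s - Suc m)" using m by (metis le_add_diff_inverse power_add)
    then have eq: "[:a ^ (r+s):] * g = [:a ^ Suc m:] * ([:a ^ (r + s - Suc m):] * g)" by (simp add: mult.commute)
    have "[:a ^ (r + s - Suc m):] * g \<in> polys_below A (Suc r)"
      using polys_below_const[OF A subring_on_power[OF A a(1)] w(2)] polys_below_mono[of d "Suc r" A] by (auto simp: r_def)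
    moreover have "[:w:] * h - ([:a^m:] * 0 + [:a^Suc m:] * ([:a ^ (r + s - Suc m):] * g)) \<in> I"
      using w(3) unfolding eq by (simp only: mult_zero_right add_0_left)
    ultimately show "h \<in> V m i" by (rule VI[OF h(1) w(1) polys_below_0[OF A]])
  qed
  have Vmono: "V m i \<subseteq> V m j" if "i \<le> j" for m i j
    unfolding V_def using polys_below_mono[OF that, of A] by blast
  have Vdown: "V (Suc m) (Suc r) \<subseteq> V m 0" for m
  proof
    fix h assume "h \<in> V (Suc m) (Suc r)"
    then obtain w g g' where 
      1: "h \<in> polys_below A d" "w \<in> A - q" "g \<in> polys_below A (Suc r)" "g' \<in> polys_below A (Suc r)"
        "[:w:] * h - ([:a^Suc m:] * g + [:a^Suc (Suc m):] * g') \<in> I"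
      unfolding V_def by blast
    have "[:a^Suc (Suc m):] = [:a^Suc m:] * [:a:]" by simp
    then have "[:a^Suc m:] * g + [:a^Suc (Suc m):] * g' = [:a^m:] * 0 + [:a^Suc m:] * (g + [:a:] * g')"
      by (simp only: algebra_simps mult_zero_left mult_zero_right add_0_left)
    moreover have "g + [:a:] * g' \<in> polys_below A (Suc r)" using 1 a by (intro polys_below_add[OF A] polys_below_const[OF A])
    ultimately show "h \<in> V m 0" using VI[OF 1(1,2) polys_below_0[OF A]] 1(5) by metis
  qed
  \<comment> \<open>The new element is the pseudo-remainder of a^m Z^i by \<open>F\<close>, and
    \<open>r \<le> m\<close> lets a^m clear the division. If it lay in \<open>V m i\<close>,
    cancelling a^m modulo the prime \<open>I\<close> would give an element of \<open>I\<close> whose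
    coefficient at \<open>i\<close> is \<open>w\<close> minus a multiple of \<open>a\<close>. But
    \<open>I\<close> is inside q[Z] and \<open>a\<close> is in \<open>q\<close>, whereas
    \<open>w\<close> is not.\<close>
  have Vstrict: "V m i \<noteq> V m (Suc i)" if i: "i \<le> r" and m: "r \<le> m" for m i
  proof -
    let ?f = "Polynomial.monom (1::'r) i"
    have f: "?f \<in> polys_over A" using polys_over_monom[OF A] A by blast
    have "pdeg ?f \<le> m" using i m degree_monom_le[of "1::'r" i] by linarith
    then obtain H R where HR: "H \<in> polys_over A" "R \<in> polys_over A" "[:a ^ m:] * ?f = F * H + R" "pdeg R < d"
      using pseudo_division[OF A FA F(3) f] unfolding a_def d_def by blast
    have R: "R \<in> polys_below A d" using HR(2,4) by (auto simp: polys_below_def intro: coeff_eq_0)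
    have FH: "F * H \<in> I" using F(1) HR(1) by (intro ideal_in_mult'[OF id])
    have "R \<in> V m (Suc i)"
    proof (rule VI)
      show "?f \<in> polys_below A (Suc i)" using f by (auto simp: polys_below_def)
      have "[:1:] * R - ([:a ^ m:] * ?f + [:a ^ Suc m:] * 0) = - (F * H)" unfolding HR(3) by (simp only: algebra_simps) simp
      then show "[:1:] * R - ([:a ^ m:] * ?f + [:a ^ Suc m:] * 0) \<in> I" using ideal_in_uminus[OF SA id FH] by metis
    qed (use R W_1 polys_below_0[OF A] in auto)
    moreover have "R \<notin> V m i"
    proof
      assume "R \<in> V m i"
      then obtain w g g' where 
        1: "w \<in> A - q" "g \<in> polys_below A i" "g' \<in> polys_below A (Suc r)"
          "[:w:] * R - ([:a^m:] * g + [:a^Suc m:] * g') \<in> I"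
        unfolding V_def by blast
      let ?T = "[:w:] * ?f - g - [:a:] * g'"
      have "[:a^Suc m:] = [:a^m:] * [:a:]" by simp
      then have "[:a^m:] * ?T = [:w:] * ([:a^m:] * ?f) - ([:a^m:] * g + [:a^Suc m:] * g')"
        by (simp only: algebra_simps)
      also have "\<dots> = [:w:] * (F * H) + ([:w:] * R - ([:a^m:] * g + [:a^Suc m:] * g'))" 
        unfolding HR(3) by (simp only: algebra_simps)
      also have "\<dots> \<in> I" using 1(1)
        by (intro ideal_in_add[OF id _ 1(4)] ideal_in_mult[OF id _ FH] polys_over_const[OF A]) auto
      finally have T: "[:a^m:] * ?T \<in> I" .
      have "?T \<in> polys_over A" using 1 f a by (intro subring_on_diff[OF SA] subring_on_mult[OF SA] polys_over_const[OF A]) (auto simp: polys_below_def)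
      then have "?T \<in> I" using prime_in_mult[OF I apow _ T] apn by blast
      then have "?T \<in> polys_over q" using Iq by blast
      then have "pcoeff ?T i \<in> q" by (rule polys_over_coeff)
      moreover have "pcoeff ?T i = w - a * pcoeff g' i" using 1(2) by (auto simp: polys_below_def)
      moreover have "a * pcoeff g' i \<in> q" using aq 1(3) polys_over_coeff 
        by (intro ideal_in_mult'[OF prime_in_ideal[OF q]]) (auto simp: polys_below_def)
      ultimately show False using ideal_in_diff_cancel[OF A prime_in_ideal[OF q]] 1(1) by auto
    qed
    ultimately show ?thesis by blast
  qed
  have step: "\<rho> (V m 0) + i \<le> \<rho> (V m i)" if "r \<le> m" "Suc m \<le> r + s" "i \<le> Suc r" for m i
    using that(3)
  proof (induction i)
    case (Suc i)
    have "\<rho> (V m i) \<le> \<rho> (V m (Suc i)) \<and> (\<rho> (V m i) = \<rho> (V m (Suc i)) \<longrightarrow> V m i = V m (Suc i))"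
      using \<rho>0 Vsub Vbase[OF that(2)] Vmono[of i "Suc i"] by simp
    then show ?case using Suc Vstrict[of i m] that by fastforce
  qed simp
  \<comment> \<open>Telescoping from level \<open>r + s - 1\<close> down to level \<open>r\<close>:
    by \<open>Vdown\<close> the top of one level lies in the bottom of the level below it.\<close>
  have "(Suc j) * Suc r \<le> \<rho> (V (r + s - Suc j) (Suc r))" if "j < s" for j
    using that
  proof (induction j)
    case 0
    then have "r \<le> r + s - 1" "Suc (r + s - 1) \<le> r + s" by linarith+
    then show ?case using step[of "r + s - 1" "Suc r"] by simp
  next
    case (Suc j)
    have "r + s - Suc j = Suc (r + s - Suc (Suc j))" using Suc.prems by linarith
    then have sub: "V (r + s - Suc j) (Suc r) \<subseteq> V (r + s - Suc (Suc j)) 0" using Vdown by metis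
    have "\<rho> (V (r + s - Suc j) (Suc r)) \<le> \<rho> (V (r + s - Suc (Suc j)) 0)"
      using \<rho>0 Vsub Vbase[of "r + s - Suc j" "Suc r"] sub Suc.prems by simp
    moreover have "\<rho> (V (r + s - Suc (Suc j)) 0) + Suc r \<le> \<rho> (V (r + s - Suc (Suc j)) (Suc r))"
      using Suc.prems by (intro step) linarith+
    ultimately show ?case using Suc by auto
  qed
  from this[of "s - 1"] have "s * Suc r \<le> \<rho> (V r (Suc r))" by (auto simp: s_def)
  also have "\<dots> \<le> d * ((r + s) * e)"
    using \<rho>0 Vsub Vbase[of r "Suc r"] by (simp add: s_def)
  finally have "s * Suc r \<le> d * e * r + s * (d * e)" by (simp add: algebra_simps)
  moreover have "s * Suc r = s * (d * e) + s * Suc d" by (simp add: r_def algebra_simps)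
  ultimately have "s * Suc d \<le> d * e * r" by linarith
  moreover have "s * 1 \<le> s * Suc d" by (intro mult_le_mono) auto
  ultimately show False by (simp add: s_def)
qed

end

lemma extend_chain:
  assumes "prime_chain A n P" "prime_in r A" "P n \<subset> r"
  shows "prime_chain A (Suc n) (P(Suc n := r))"
  using assms by (auto simp: prime_chain_def le_Suc_eq less_Suc_eq)

text \<open>\<open>h\<close> bounds the height of \<open>p\<close>. The sharper bound for Q m = p[Z]
  carries the induction; the general bound adds at most one prime over \<open>p\<close> above p[Z],
  by \<open>primes_over_same\<close>.\<close>

lemma poly_chain_bound:
  assumes A: "subring_on A" and N: "noeth A"
  shows "prime_in p A \<Longrightarrow> (\<And>n P. prime_chain A n P \<Longrightarrow> P n = p \<Longrightarrow> n \<le> h) \<Longrightarrow> 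
     prime_chain (polys_over A) m Q \<Longrightarrow> {a\<in>A. [:a:] \<in> Q m} = p \<Longrightarrow>
     m \<le> Suc h \<and> (Q m = polys_over p \<longrightarrow> m \<le> h)"
proof (induction h arbitrary: p m Q rule: less_induct)
  case (less h)
  note P = less.prems(1) and ht = less.prems(2)
  have pr: "prime_in (Q i) (polys_over A)" if "i \<le> m" "prime_chain (polys_over A) m Q" for m i 
    using that by (auto simp: prime_chain_def)
  have down: "\<exists>h'<h. h = Suc h' \<and> (\<forall>n P. prime_chain A n P \<longrightarrow> P n = p' \<longrightarrow> n \<le> h')" if p': "prime_in p' A" "p' \<subset> p" for p'
  proof -
    have ext: "Suc n \<le> h" if "prime_chain A n P'" "P' n = p'" for n P'
      using ht[OF extend_chain[OF that(1) P]] that p' by simp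
    have "prime_chain A 0 (\<lambda>_. p')" using p' by (auto simp: prime_chain_def)
    then have "h > 0" using ext[of 0 "\<lambda>_. p'"] by simp
    then obtain h' where "h = Suc h'" by (cases h) auto
    then show ?thesis using ext by auto
  qed
  have second: "m \<le> h" if ch: "prime_chain (polys_over A) m Q" and Qm: "Q m = polys_over p" for m Q
  proof (cases m)
    case (Suc l)
    have Ql: "prime_in (Q l) (polys_over A)" "Q l \<subset> polys_over p" and chl: "prime_chain (polys_over A) l Q"
      using ch Suc Qm by (auto simp: prime_chain_def)
    let ?p = "{a\<in>A. [:a:] \<in> Q l}"
    have p': "prime_in ?p A" by (rule contract_prime[OF hom_on_const A _ Ql(1)]) (use polys_over_const[OF A] in blast)
    have "?p \<subseteq> p"
    proof
      fix a assume "a \<in> ?p"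
      then have "[:a:] \<in> polys_over p" using Ql(2) by blast
      then show "a \<in> p" using polys_over_coeff[of "[:a:]" p 0] by simp
    qed
    moreover have "?p \<noteq> p" using extend_ideal_subset[OF A prime_in_ideal[OF Ql(1)]] Ql(2) by blast
    ultimately have p'p: "?p \<subset> p" by blast
    obtain h' where h': "h = Suc h'" "\<And>n P. prime_chain A n P \<Longrightarrow> P n = ?p \<Longrightarrow> n \<le> h'" using down[OF p' p'p] by blast
    show ?thesis
    proof (cases "Q l = polys_over ?p")
      case True
      have "l \<le> Suc h' \<and> (Q l = polys_over ?p \<longrightarrow> l \<le> h')"
        by (rule less.IH[OF _ p' _ chl refl]) (use h' in auto)
      then have "l \<le> h'" using True by blast
      then show ?thesis using Suc h' by simp
    next
      case False
      \<comment> \<open>If no prime lies strictly between, \<open>no_prime_between\<close>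
        contradicts the present case. Otherwise the height of the contraction drops by 2, which
        compensates for \<open>Q l\<close> being larger than the extension of its
        contraction.\<close>
      show ?thesis
      proof (cases "\<exists>r. prime_in r A \<and> ?p \<subset> r \<and> r \<subset> p")
        case False
        have "adjacent_primes A ?p p"
          by (unfold_locales) (use A N p' P p'p False in blast)+
        then have "Q l = polys_over ?p" 
          using adjacent_primes.no_prime_between[of A ?p p "Q l"] Ql by blast
        then show ?thesis using \<open>Q l \<noteq> polys_over ?p\<close> by blast
      next
        case True
        then obtain r where r: "prime_in r A" "?p \<subset> r" "r \<subset> p" by blast
        obtain h1 where h1: "h = Suc h1" "\<And>n P. prime_chain A n P \<Longrightarrow> P n = r \<Longrightarrow> n \<le> h1" using down[OF r(1,3)] by blast
        have ext: "Suc n \<le> h1" if "prime_chain A n P'" "P' n = ?p" for n P'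
          using h1(2)[OF extend_chain[OF that(1) r(1)]] that r(2) by simp
        have "prime_chain A 0 (\<lambda>_. ?p)" using p' by (auto simp: prime_chain_def)
        then have "h1 > 0" using ext[of 0 "\<lambda>_. ?p"] by simp
        then obtain h2 where h2: "h1 = Suc h2" by (cases h1) auto
        have "l \<le> Suc h2 \<and> (Q l = polys_over ?p \<longrightarrow> l \<le> h2)"
          by (rule less.IH[OF _ p' _ chl refl]) (use ext h1(1) h2 in auto)
        then show ?thesis using Suc h1 h2 by simp
      qed
    qed
  qed simp
  have "m \<le> Suc h"
  proof (cases m)
    case (Suc l)
    have Ql: "prime_in (Q l) (polys_over A)" "Q l \<subset> Q m" and chl: "prime_chain (polys_over A) l Q"
      and Qm: "prime_in (Q m) (polys_over A)"
      using less.prems(3) Suc by (auto simp: prime_chain_def)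
    let ?p = "{a\<in>A. [:a:] \<in> Q l}"
    have p': "prime_in ?p A" by (rule contract_prime[OF hom_on_const A _ Ql(1)]) (use polys_over_const[OF A] in blast)
    have "?p \<subseteq> p" using Ql(2) less.prems(4) by blast
    show ?thesis
    proof (cases "?p = p")
      case True
      then have "Q l = polys_over p" using primes_over_same[OF A Ql(1) Qm Ql(2) _ less.prems(4) P] by blast
      then show ?thesis using second[OF chl] Suc by simp
    next
      case False
      then have p'p: "?p \<subset> p" using \<open>?p \<subseteq> p\<close> by blast
      obtain h' where h': "h = Suc h'" "\<And>n P. prime_chain A n P \<Longrightarrow> P n = ?p \<Longrightarrow> n \<le> h'" using down[OF p' p'p] by blast
      have "l \<le> Suc h' \<and> (Q l = polys_over ?p \<longrightarrow> l \<le> h')"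
        by (rule less.IH[OF _ p' _ chl refl]) (use h' in auto)
      then show ?thesis using Suc h' by simp
    qed
  qed simp
  then show ?case using second[OF less.prems(3)] by blast
qed

theorem dim_le_polys_over:
  assumes A: "subring_on A" and N: "noeth A" and d: "dim_le A d" shows "dim_le (polys_over A) (Suc d)"
  unfolding dim_le_def
proof (intro allI impI)
  fix m assume "has_chain (polys_over A) m"
  then obtain Q where Q: "prime_chain (polys_over A) m Q" by (auto simp: has_chain_def)
  then have "prime_in (Q m) (polys_over A)" by (auto simp: prime_chain_def)
  then have "prime_in {a\<in>A. [:a:] \<in> Q m} A"
    using contract_prime[OF hom_on_const A, of "polys_over A"] polys_over_const[OF A] by blast
  then show "m \<le> Suc d" using poly_chain_bound[OF A N _ _ Q refl, of d] d by (auto simp: dim_le_def has_chain_def)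
qed

lemma dim_le_adjoin1:
  assumes A: "subring_on A" and N: "noeth A" and d: "dim_le A d" shows "dim_le (adjoin1 A y) (Suc d)"
  using dim_le_polys_over[OF assms] has_chain_surj[OF hom_on_eval subring_on_polys_over[OF A] refl]
  unfolding adjoin1_def dim_le_def by blast

section \<open>Polynomials in several variables and factoriality\<close>

lemma has_chain_adjoin1:
  assumes "subring_on A" "transc A y" "has_chain A n" shows "has_chain (adjoin1 A y) (Suc n)"
  unfolding adjoin1_def 
  using has_chain_iso[OF hom_on_eval subring_on_polys_over[OF assms(1)] transc_inj[OF assms(1,2)]] 
    has_chain_polys_over[OF assms(1,3)] by blast

lemma mpoly_sum_monomials: "(\<Sum>m\<in>Poly_Mapping.keys p. Poly_Mapping.single m (Poly_Mapping.lookup p m)) = p"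
  by (rule poly_mapping_eqI) 
    (auto simp: lookup_sum lookup_single when_def sum.delta' in_keys_iff)

definition mvar :: "nat \<Rightarrow> 'a::comm_ring_1 mpoly_type" where
  "mvar n = Poly_Mapping.single (Poly_Mapping.single n 1) 1"

lemma mvar_power: "mvar n ^ i = Poly_Mapping.single (Poly_Mapping.single n i) 1"
  by (induction i) (auto simp: mvar_def mult_single single_add[symmetric])

lemma mpolys_single:
  "subring_on D \<Longrightarrow> c \<in> D \<Longrightarrow> Poly_Mapping.keys m \<subseteq> {..<n} \<Longrightarrow> Poly_Mapping.single m c \<in> mpolys D n"
  by (auto simp: mpolys_def lookup_single when_def split: if_splits)

lemma mpolys_add:
  assumes "subring_on D" "p \<in> mpolys D n" "q \<in> mpolys D n" shows "p + q \<in> mpolys D n"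
  using assms Poly_Mapping.keys_add[of p q] unfolding mpolys_def by (auto simp: lookup_add subset_iff)

lemma mpolys_sum:
  assumes "subring_on D" "\<And>i. i \<in> S \<Longrightarrow> f i \<in> mpolys D n" shows "sum f S \<in> mpolys D n"
  using assms(2)
proof (induction S rule: infinite_finite_induct)
  case (insert x F) then show ?case using mpolys_add[OF assms(1)] by auto
qed (use assms(1) in \<open>auto simp: mpolys_def\<close>)

lemma subring_mpolys:
  assumes D: "subring_on D" shows "subring_on (mpolys D n)"
proof (rule subring_onI)
  show "1 \<in> mpolys D n" using mpolys_single[OF D subring_on_1[OF D], of 0 n] by simp
  fix a b assume ab: "a \<in> mpolys D n" "b \<in> mpolys D n"
  then show "a + b \<in> mpolys D n" using mpolys_add[OF D] by blast
  have "a * b = (\<Sum>m\<in>Poly_Mapping.keys a. \<Sum>l\<in>Poly_Mapping.keys b. 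
      Poly_Mapping.single (m + l) (Poly_Mapping.lookup a m * Poly_Mapping.lookup b l))"
    by (subst (1) mpoly_sum_monomials[of a, symmetric], subst (1) mpoly_sum_monomials[of b, symmetric])
      (simp add: sum_product mult_single)
  also have "\<dots> \<in> mpolys D n"
  proof (intro mpolys_sum[OF D] mpolys_single[OF D])
    fix m l assume "m \<in> Poly_Mapping.keys a" "l \<in> Poly_Mapping.keys b"
    then have "Poly_Mapping.keys m \<subseteq> {..<n}" "Poly_Mapping.keys l \<subseteq> {..<n}" using ab by (auto simp: mpolys_def)
    then show "Poly_Mapping.keys (m + l) \<subseteq> {..<n}" using Poly_Mapping.keys_add[of m l] by blast
  qed (use ab D in \<open>auto simp: mpolys_def\<close>)
  finally show "a * b \<in> mpolys D n" .
next
  fix a assume "a \<in> mpolys D n" 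
  then show "- a \<in> mpolys D n" using D by (auto simp: mpolys_def in_keys_iff)
qed

lemma mpolys_mono: "D \<subseteq> E \<Longrightarrow> mpolys D n \<subseteq> mpolys E n"
  by (auto simp: mpolys_def)

lemma hom_on_mconst: "hom_on (Poly_Mapping.single 0 :: 'a::comm_ring_1 \<Rightarrow> 'a mpoly_type) D"
  by (auto simp: hom_on_def single_add mult_single)

lemma inj_on_mconst: "inj_on (Poly_Mapping.single 0) D"
  using inj_single by (rule inj_on_subset) simp

lemma mpolys_0: 
  assumes "subring_on D" shows "mpolys D 0 = Poly_Mapping.single 0 ` D"
proof (intro equalityI subsetI)
  fix p assume p: "p \<in> mpolys D 0"
  then have "Poly_Mapping.keys p \<subseteq> {0}" by (auto simp: mpolys_def)
  then have "Poly_Mapping.lookup p m = 0" if "m \<noteq> 0" for m using that by (auto simp: in_keys_iff)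
  then have "p = Poly_Mapping.single 0 (Poly_Mapping.lookup p 0)"
    by (intro poly_mapping_eqI) (auto simp: lookup_single when_def)
  then show "p \<in> Poly_Mapping.single 0 ` D" using p by (auto simp: mpolys_def)
qed (use mpolys_single[OF assms] in auto)

text \<open>Splitting off the last variable turns statements about \<open>mpolys\<close> into
  iterated one-variable statements; \<open>transc_mvar\<close> provides the freeness.\<close>

lemma mpolys_Suc:
  assumes D: "subring_on D" shows "mpolys D (Suc n) = adjoin1 (mpolys D n) (mvar n)"
proof (rule equalityI)
  have S: "subring_on (mpolys D n)" "subring_on (mpolys D (Suc n))" using subring_mpolys[OF D] by blast+
  have SA: "subring_on (adjoin1 (mpolys D n) (mvar n))" by (rule adjoin1_subring[OF S(1)])
  have sub: "mpolys D n \<subseteq> mpolys D (Suc n)" by (force simp: mpolys_def)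
  have "mvar n \<in> mpolys D (Suc n)" unfolding mvar_def using D by (intro mpolys_single) auto
  then show "adjoin1 (mpolys D n) (mvar n) \<subseteq> mpolys D (Suc n)" by (rule adjoin1_least[OF S(2) sub])
  show "mpolys D (Suc n) \<subseteq> adjoin1 (mpolys D n) (mvar n)"
  proof
    fix p assume p: "p \<in> mpolys D (Suc n)"
    have "Poly_Mapping.single m (Poly_Mapping.lookup p m) \<in> adjoin1 (mpolys D n) (mvar n)" if m: "m \<in> Poly_Mapping.keys p" for m
    proof -
      let ?i = "Poly_Mapping.lookup m n" and ?u = "Poly_Mapping.update n 0 m"
      have "m = ?u + Poly_Mapping.single n ?i"
        by (rule poly_mapping_eqI) (auto simp: lookup_add lookup_update lookup_single when_def)
      then have "Poly_Mapping.single m (Poly_Mapping.lookup p m) = 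
          Poly_Mapping.single ?u (Poly_Mapping.lookup p m) * mvar n ^ ?i"
        by (metis mult_single mvar_power mult.right_neutral)
      moreover have "Poly_Mapping.keys m \<subseteq> {..<Suc n}" using p m by (auto simp: mpolys_def)
      then have "Poly_Mapping.keys ?u \<subseteq> {..<n}" by (auto simp: keys_update)
      then have "Poly_Mapping.single ?u (Poly_Mapping.lookup p m) \<in> mpolys D n"
        using p by (intro mpolys_single[OF D]) (auto simp: mpolys_def)
      ultimately show ?thesis
        using subring_on_mult[OF SA adjoin1_base[OF S(1)] subring_on_power[OF SA adjoin1_gen[OF S(1)]]] by simp
    qed
    then have "(\<Sum>m\<in>Poly_Mapping.keys p. Poly_Mapping.single m (Poly_Mapping.lookup p m)) \<in> adjoin1 (mpolys D n) (mvar n)"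
      by (intro subring_on_sum[OF SA])
    then show "p \<in> adjoin1 (mpolys D n) (mvar n)" by (simp add: mpoly_sum_monomials)
  qed
qed

lemma lookup_times_mvar_power:
  assumes q: "q \<in> mpolys D n" and m: "Poly_Mapping.lookup m n = 0"
  shows "Poly_Mapping.lookup (q * mvar n ^ i) (m + Poly_Mapping.single n j) = (if i = j then Poly_Mapping.lookup q m else 0)"
proof -
  have "q * mvar n ^ i = (\<Sum>u\<in>Poly_Mapping.keys q. Poly_Mapping.single (u + Poly_Mapping.single n i) (Poly_Mapping.lookup q u))"
    by (subst (1) mpoly_sum_monomials[of q, symmetric]) (simp add: mvar_power sum_distrib_right mult_single)
  then have "Poly_Mapping.lookup (q * mvar n ^ i) (m + Poly_Mapping.single n j) =
     (\<Sum>u\<in>Poly_Mapping.keys q. Poly_Mapping.lookup q u when u + Poly_Mapping.single n i = m + Poly_Mapping.single n j)"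
    by (simp add: lookup_sum lookup_single)
  also have "\<dots> = (\<Sum>u\<in>Poly_Mapping.keys q. if u = m then (if i = j then Poly_Mapping.lookup q m else 0) else 0)"
  proof (rule sum.cong[OF refl])
    fix u assume "u \<in> Poly_Mapping.keys q"
    then have "Poly_Mapping.keys u \<subseteq> {..<n}" using q by (auto simp: mpolys_def)
    then have u: "Poly_Mapping.lookup u n = 0" by (auto simp: in_keys_iff)
    have "u + Poly_Mapping.single n i = m + Poly_Mapping.single n j \<longleftrightarrow> u = m \<and> i = j"
    proof
      assume *: "u + Poly_Mapping.single n i = m + Poly_Mapping.single n j"
      then have "Poly_Mapping.lookup (u + Poly_Mapping.single n i) n = Poly_Mapping.lookup (m + Poly_Mapping.single n j) n" by simp
      then have "i = j" using u m by (simp add: lookup_add)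
      then show "u = m \<and> i = j" using * by simp
    qed simp
    then show "(Poly_Mapping.lookup q u when u + Poly_Mapping.single n i = m + Poly_Mapping.single n j) = 
       (if u = m then (if i = j then Poly_Mapping.lookup q m else 0) else 0)" by (auto simp: when_def)
  qed
  also have "\<dots> = (if i = j then Poly_Mapping.lookup q m else 0)"
    by (auto simp: sum.delta in_keys_iff)
  finally show ?thesis .
qed

lemma transc_mvar:
  assumes D: "subring_on D" shows "transc (mpolys D n) (mvar n)"
  unfolding transc_def
proof (intro ballI impI)
  fix p assume p: "p \<in> polys_over (mpolys D n)" and 0: "poly p (mvar n) = 0"
  have "Poly_Mapping.lookup (pcoeff p j) m = 0" for j m
  proof (cases "Poly_Mapping.lookup m n = 0")
    case True
    have "(0::'a) = Poly_Mapping.lookup (poly p (mvar n)) (m + Poly_Mapping.single n j)" using 0 by simp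
    also have "\<dots> = (\<Sum>i\<le>pdeg p. if i = j then Poly_Mapping.lookup (pcoeff p i) m else 0)"
      unfolding poly_altdef lookup_sum 
      by (intro sum.cong refl) (use lookup_times_mvar_power[OF polys_over_coeff[OF p] True] in auto)
    also have "\<dots> = Poly_Mapping.lookup (pcoeff p j) m" by (auto simp: sum.delta coeff_eq_0)
    finally show ?thesis by simp
  next
    case False
    then have "n \<in> Poly_Mapping.keys m" by (simp add: in_keys_iff)
    then have "m \<notin> Poly_Mapping.keys (pcoeff p j)" using polys_over_coeff[OF p, of j] by (auto simp: mpolys_def)
    then show ?thesis by (simp add: in_keys_iff)
  qed
  then show "p = 0" by (intro poly_eqI poly_mapping_eqI) simp
qed

lemma has_chain_mpolys:
  assumes D: "subring_on D" and "has_chain D d" shows "has_chain (mpolys D n) (n + d)"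
proof (induction n)
  case 0
  show ?case unfolding mpolys_0[OF D] using has_chain_iso[OF hom_on_mconst D inj_on_mconst] assms(2) by simp
next
  case (Suc n)
  then show ?case unfolding mpolys_Suc[OF D] using has_chain_adjoin1[OF subring_mpolys[OF D] transc_mvar[OF D]] by simp
qed

text \<open>The Noetherian property is carried along because each further variable uses it in
  \<open>dim_le_adjoin1\<close>.\<close>

lemma noeth_dim_mpolys:
  assumes D: "subring_on D" and "noeth D" "dim_le D d" shows "noeth (mpolys D n) \<and> dim_le (mpolys D n) (n + d)"
proof (induction n)
  case 0
  show ?case unfolding mpolys_0[OF D] 
    using dim_le_iso[OF hom_on_mconst D inj_on_mconst] noeth_surj[OF assms(2) hom_on_mconst D] assms(3) by simp
next
  case (Suc n)
  then show ?case unfolding mpolys_Suc[OF D] 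
    using dim_le_adjoin1[OF subring_mpolys[OF D]] noeth_adjoin1[OF subring_mpolys[OF D]] by simp
qed

text \<open>For a Noetherian domain this is Kaplansky's characterization of unique factorization.\<close>

definition primes_contain_prime :: "'r::comm_ring_1 set \<Rightarrow> bool" where
  "primes_contain_prime A \<longleftrightarrow> (\<forall>P. prime_in P A \<and> P \<noteq> {0} \<longrightarrow> (\<exists>\<pi>\<in>P. \<pi> \<noteq> 0 \<and> prime_in (princ A \<pi>) A))"

lemma polys_over_princ:
  assumes A: "subring_on A" and c: "c \<in> A" shows "polys_over (princ A c) = princ (polys_over A) [:c:]"
proof (intro equalityI subsetI)
  fix f assume f: "f \<in> polys_over (princ A c)"
  have id: "ideal_in (princ (polys_over A) [:c:]) (polys_over A)"
    by (rule princ_ideal[OF subring_on_polys_over[OF A] polys_over_const[OF A c]])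
  have "princ A c \<subseteq> {a\<in>A. [:a:] \<in> princ (polys_over A) [:c:]}"
  proof
    fix x assume "x \<in> princ A c"
    then obtain r where r: "r \<in> A" "x = r * c" unfolding princ_def by blast
    then have "[:x:] = [:r:] * [:c:]" by simp
    then show "x \<in> {a\<in>A. [:a:] \<in> princ (polys_over A) [:c:]}" 
      using r A c polys_over_const[OF A r(1)] unfolding princ_def by blast
  qed
  then show "f \<in> princ (polys_over A) [:c:]" 
    using extend_ideal_subset[OF A id] f polys_over_mono by blast
next
  fix f assume "f \<in> princ (polys_over A) [:c:]"
  then show "f \<in> polys_over (princ A c)" by (auto simp: princ_def polys_over_def mult.commute)
qed

text \<open>Gauss's lemma in terms of primes. If \<open>I\<close> contains nonzero constants, a
  prime element of \<open>A\<close> is available. Otherwise \<open>I\<close> is principal, generated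
  by an element of least degree that no prime element of \<open>A\<close> divides.\<close>

lemma primes_contain_prime_polys_over:
  fixes A :: "'r::idom set"
  assumes A: "subring_on A" and N: "noeth A" and K: "primes_contain_prime A"
  shows "primes_contain_prime (polys_over A)"
  unfolding primes_contain_prime_def
proof (intro allI impI, elim conjE)
  note SA = subring_on_polys_over[OF A]
  fix I assume I: "prime_in I (polys_over A)" and I0: "I \<noteq> {0}"
  note id = prime_in_ideal[OF I]
  let ?p = "{a\<in>A. [:a:] \<in> I}"
  have P: "prime_in ?p A" using contract_prime[OF hom_on_const A _ I] polys_over_const[OF A] by blast
  show "\<exists>\<pi>\<in>I. \<pi> \<noteq> 0 \<and> prime_in (princ (polys_over A) \<pi>) (polys_over A)"
  proof (cases "?p = {0}")
    case False
    then obtain c where c: "c \<in> ?p" "c \<noteq> 0" "prime_in (princ A c) A" 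
      using K P unfolding primes_contain_prime_def by blast
    then have "prime_in (princ (polys_over A) [:c:]) (polys_over A)" 
      using prime_polys_over[OF A c(3)] polys_over_princ[OF A] by auto
    then show ?thesis using c by (intro bexI[of _ "[:c:]"]) auto
  next
    case True
    have p0: "polys_over {0::'r} = {0}" by (auto simp: polys_over_def intro: poly_eqI)
    obtain F0 where F0: "F0 \<in> I" "F0 \<noteq> 0" "pdeg F0 > 0" "\<And>G. G \<in> I \<Longrightarrow> G \<noteq> 0 \<Longrightarrow> pdeg F0 \<le> pdeg G"
      using min_degree_elem[OF A I True] I0 unfolding p0 by (metis singletonD singletonI)
    \<comment> \<open>Among the elements of least degree, one with maximal principal ideal is
      primitive: dividing it by a prime constant would enlarge the ideal.\<close>
    let ?C = "princ (polys_over A) ` {F\<in>I. F \<noteq> 0 \<and> pdeg F = pdeg F0}"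
    have "ideal_in J (polys_over A)" if "J \<in> ?C" for J using that princ_ideal[OF SA] ideal_in_sub[OF id] by blast
    then obtain M where M: "M \<in> ?C" "\<And>J. J \<in> ?C \<Longrightarrow> M \<subseteq> J \<Longrightarrow> J = M"
      using noeth_max[OF Hilbert_basis[OF A N], of ?C] F0 by blast
    then obtain F where F: "M = princ (polys_over A) F" "F \<in> I" "F \<noteq> 0" "pdeg F = pdeg F0" by blast
    have FA: "F \<in> polys_over A" using F ideal_in_sub[OF id] by blast
    have Mid: "ideal_in M (polys_over A)" unfolding F(1) by (rule princ_ideal[OF SA FA])
    have MI: "M \<subseteq> I" unfolding F(1) by (rule princ_least[OF id F(2)])
    have prim: False if c: "c \<in> A" "c \<noteq> 0" "prime_in (princ A c) A" and G: "G \<in> polys_over A" "F = [:c:] * G" for c G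
    proof -
      have "[:c:] \<notin> I" using True c by blast
      then have GI: "G \<in> I" using prime_in_mult[OF I polys_over_const[OF A c(1)] G(1)] F(2) G(2) by blast
      have G0: "G \<noteq> 0" using F G by auto
      have "pdeg G = pdeg F0" using F(4) G(2) c by simp
      moreover have "M \<subseteq> princ (polys_over A) G" unfolding F(1) 
      proof (rule princ_least[OF princ_ideal[OF SA G(1)]])
        show "F \<in> princ (polys_over A) G" unfolding princ_def G(2) 
          by (rule image_eqI[OF refl polys_over_const[OF A c(1)]])
      qed
      ultimately have "princ (polys_over A) G = M" using M(2) GI G0 by blast
      then have "G \<in> princ (polys_over A) F" using F(1) princ_self[OF SA] by blast
      then obtain H where H: "H \<in> polys_over A" "G = H * F" unfolding princ_def by blast
      then have "G * ([:c:] * H) = G * 1" using G(2) by (simp add: algebra_simps)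
      then have "[:c:] * H = 1" using G0 by (metis mult_left_cancel)
      then have "pcoeff ([:c:] * H) 0 = pcoeff 1 0" by (simp only:)
      then have "pcoeff H 0 * c = 1" by (simp add: mult.commute)
      then have "1 \<in> princ A c" using polys_over_coeff[OF H(1), of 0] unfolding princ_def by force
      then show False using prime_in_1[OF c(3)] by blast
    qed
    have "I \<subseteq> M"
    proof (rule ccontr)
      assume "\<not> I \<subseteq> M"
      then obtain h0 where h0: "h0 \<in> I" "h0 \<notin> M" by blast
      \<comment> \<open>These are the constants that carry \<open>h\<close> into \<open>M\<close>. A
        maximal such ideal is prime, and pseudo-division makes it nonzero, so it contains a prime
        element \<open>c\<close>. Then \<open>c\<close> divides H F but not \<open>F\<close>; it
        divides \<open>H\<close>, and cancelling it puts \<open>h\<close> into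
        \<open>M\<close>.\<close>
      let ?q = "\<lambda>h. {a\<in>A. [:a:] * h \<in> M}"
      have idq: "ideal_in (?q h) A" for h
        unfolding ideal_in_def
      proof (intro conjI ballI)
        show "0 \<in> ?q h" using A ideal_in_0[OF Mid] by auto
        fix a b assume ab: "a \<in> ?q h" "b \<in> ?q h"
        have "[:a + b:] * h = [:a:] * h + [:b:] * h" by (simp add: smult_add_left)
        then show "a + b \<in> ?q h" using ab A ideal_in_add[OF Mid] by auto
      next
        fix r a assume r: "r \<in> A" "a \<in> ?q h"
        have "[:r * a:] * h = [:r:] * ([:a:] * h)" by (simp add: mult.commute)
        also have "\<dots> \<in> M" using r by (intro ideal_in_mult[OF Mid polys_over_const[OF A r(1)]]) blast
        finally show "r * a \<in> ?q h" using r A by blast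
      qed auto
      obtain L where L: "L \<in> ?q ` (I - M)" "\<And>J. J \<in> ?q ` (I - M) \<Longrightarrow> L \<subseteq> J \<Longrightarrow> J = L"
      proof -
        have ne: "?q ` (I - M) \<noteq> {}" using h0 by blast
        have qid: "\<And>J. J \<in> ?q ` (I - M) \<Longrightarrow> ideal_in J A" by (erule imageE) (simp only: idq)
        show ?thesis by (rule noeth_max[OF N ne qid]) (use that in blast)+
      qed
      then obtain h where h: "L = ?q h" "h \<in> I" "h \<notin> M" by blast
      have hA: "h \<in> polys_over A" using h ideal_in_sub[OF id] by blast
      have "prime_in L A"
        unfolding prime_in_def
      proof (intro conjI ballI impI)
        show "ideal_in L A" using h idq by blast
        show "1 \<notin> L" using h by (simp add: one_poly_def[symmetric])
        fix x y assume xy: "x \<in> A" "y \<in> A" "x * y \<in> L"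
        show "x \<in> L \<or> y \<in> L"
        proof (rule disjCI)
          assume "y \<notin> L"
          then have "[:y:] * h \<in> I - M" using h xy ideal_in_mult[OF id polys_over_const[OF A xy(2)]] by blast
          moreover have "L \<subseteq> ?q ([:y:] * h)"
          proof
            fix z assume z: "z \<in> L"
            have "[:z:] * ([:y:] * h) = [:y:] * ([:z:] * h)" by (rule mult.left_commute)
            also have "\<dots> \<in> M" using z h by (intro ideal_in_mult[OF Mid polys_over_const[OF A xy(2)]]) blast
            finally show "z \<in> ?q ([:y:] * h)" using z h(1) by blast
          qed
          ultimately have qL: "?q ([:y:] * h) = L" using L(2)[OF imageI] by blast
          have "[:x:] * ([:y:] * h) = [:x * y:] * h" by (simp add: mult.commute)
          also have "\<dots> \<in> M" using xy(3) h(1) by blast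
          finally show "x \<in> L" using xy(1) qL by blast
        qed
      qed
      moreover have "L \<noteq> {0}"
      proof -
        let ?a = "pcoeff F (pdeg F)"
        have a: "?a \<in> A" "?a \<noteq> 0" using FA F(3) by (auto simp: polys_over_def)
        obtain H R where HR: "H \<in> polys_over A" "R \<in> polys_over A" "[:?a ^ pdeg h:] * h = F * H + R" "pdeg R < pdeg F"
          using pseudo_division[OF A FA _ hA order_refl] F(4) F0(3) by metis
        have "R = [:?a ^ pdeg h:] * h - H * F" using HR(3) by (simp add: algebra_simps)
        also have "\<dots> \<in> I" using h F HR a A polys_over_const[OF A]
          by (intro ideal_in_diff[OF SA id] ideal_in_mult[OF id]) auto
        finally have "R = 0" using F0(4) HR(4) F(4) by force
        then have "[:?a ^ pdeg h:] * h \<in> M" unfolding HR(3) using HR(1) F(1) by (auto simp: princ_def mult.commute)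
        then have "?a ^ pdeg h \<in> L" using h(1) a A by blast
        then show ?thesis using a by auto
      qed
      ultimately obtain c where c: "c \<in> L" "c \<noteq> 0" "prime_in (princ A c) A" 
        using K unfolding primes_contain_prime_def by blast
      have cA: "c \<in> A" "[:c:] * h \<in> M" using c(1) h(1) by auto
      then obtain H where H: "H \<in> polys_over A" "[:c:] * h = H * F" unfolding F(1) princ_def by blast
      have pc: "polys_over (princ A c) = princ (polys_over A) [:c:]" by (rule polys_over_princ[OF A cA(1)])
      have "[:c:] * h \<in> princ (polys_over A) [:c:]" unfolding princ_def by (rule image_eqI[OF mult.commute hA])
      then have "H * F \<in> polys_over (princ A c)" unfolding pc H(2) .
      then have "H \<in> polys_over (princ A c) \<or> F \<in> polys_over (princ A c)"
        using prime_in_mult[OF prime_polys_over[OF A c(3)] H(1) FA] by blast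
      then show False
      proof
        assume "H \<in> polys_over (princ A c)"
        then have "H \<in> princ (polys_over A) [:c:]" unfolding pc .
        then obtain G where G: "G \<in> polys_over A" "H = G * [:c:]" unfolding princ_def by blast
        have "[:c:] * h = [:c:] * (G * F)" using H(2) G(2) by (simp only: mult_ac)
        then have "h = G * F" using c(2) mult_left_cancel[of "[:c:]" h "G * F"] by fastforce
        then have "h \<in> M" unfolding F(1) princ_def by (rule image_eqI[OF _ G(1)])
        then show False using h(3) by blast
      next
        assume "F \<in> polys_over (princ A c)"
        then have "F \<in> princ (polys_over A) [:c:]" unfolding pc .
        then obtain G where "G \<in> polys_over A" "F = G * [:c:]" unfolding princ_def by blast
        then show False using prim[OF cA(1) c(2,3)] by (metis mult.commute)
      qed
    qed
    then have "M = I" using MI by blast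
    then show ?thesis using F I by metis
  qed
qed

lemma primes_contain_prime_iso:
  assumes f: "hom_on f A" "inj_on f A" and A: "subring_on A" and K: "primes_contain_prime A"
  shows "primes_contain_prime (f ` A)"
  unfolding primes_contain_prime_def
proof (intro allI impI, elim conjE)
  fix P assume P: "prime_in P (f ` A)" "P \<noteq> {0}"
  note id = prime_in_ideal[OF P(1)]
  let ?p = "{a\<in>A. f a \<in> P}"
  have "prime_in ?p A" by (rule contract_prime[OF f(1) A subset_refl P(1)])
  moreover have "?p \<noteq> {0}"
  proof -
    obtain b where b: "b \<in> P" "b \<noteq> 0" using P ideal_in_0[OF id] by blast
    then obtain a where a: "a \<in> A" "b = f a" using ideal_in_sub[OF id] by blast
    then have "a \<in> ?p" "a \<noteq> 0" using b hom_on_0[OF f(1)] by auto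
    then show ?thesis by blast
  qed
  ultimately obtain c where c: "c \<in> ?p" "c \<noteq> 0" "prime_in (princ A c) A" 
    using K unfolding primes_contain_prime_def by blast
  let ?g = "inv_into A f"
  have "{b \<in> f ` A. ?g b \<in> princ A c} = princ (f ` A) (f c)"
  proof (intro equalityI subsetI)
    fix b assume "b \<in> {b \<in> f ` A. ?g b \<in> princ A c}"
    then obtain u r where u: "u \<in> A" "b = f u" "r \<in> A" "?g b = r * c" unfolding princ_def by blast
    then have "u = r * c" using f(2) by simp
    then have "b = f r * f c" using u c hom_on_mult[OF f(1)] by auto
    then show "b \<in> princ (f ` A) (f c)" using u unfolding princ_def by blast
  next
    fix b assume "b \<in> princ (f ` A) (f c)"
    then obtain r where r: "r \<in> A" "b = f r * f c" unfolding princ_def by blast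
    then have rc: "b = f (r * c)" "r * c \<in> A" using c A hom_on_mult[OF f(1)] by auto
    then have "?g b = r * c" using f(2) by simp
    then show "b \<in> {b \<in> f ` A. ?g b \<in> princ A c}" using rc r unfolding princ_def by blast
  qed
  then have "prime_in (princ (f ` A) (f c)) (f ` A)"
    using contract_prime[OF hom_on_inv[OF f A] subring_on_image[OF f(1) A] _ c(3)] inv_into_image[OF f(2)] by auto
  moreover have "f c \<noteq> 0" using c f A hom_on_0[OF f(1)] by (metis (no_types, lifting) inj_onD mem_Collect_eq subring_on_0)
  ultimately show "\<exists>\<pi>\<in>P. \<pi> \<noteq> 0 \<and> prime_in (princ (f ` A) \<pi>) (f ` A)" using c by blast
qed

lemma primes_contain_prime_adjoin1:
  fixes A :: "'r::idom set"
  assumes A: "subring_on A" and N: "noeth A" and K: "primes_contain_prime A" and y: "transc A y"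
  shows "primes_contain_prime (adjoin1 A y)"
  unfolding adjoin1_def
  by (rule primes_contain_prime_iso[OF hom_on_eval transc_inj[OF A y] subring_on_polys_over[OF A] 
      primes_contain_prime_polys_over[OF A N K]])

section \<open>Cohen's theorem and localization\<close>

lemma transc_swap:
  assumes A: "subring_on A" and b: "transc A b" and c: "transc (adjoin1 A b) c"
  shows "transc (adjoin1 A c) b"
  unfolding transc_def
proof (intro ballI impI)
  fix p assume p: "p \<in> polys_over (adjoin1 A c)" and 0: "poly p b = 0"
  have "\<exists>q\<in>polys_over A. poly q c = pcoeff p i" for i
    using polys_over_coeff[OF p, of i] unfolding adjoin1_def by auto
  then obtain q where q: "\<And>i. q i \<in> polys_over A" "\<And>i. poly (q i) c = pcoeff p i" by metis
  define N where "N = pdeg p"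
  define M where "M = Max ((\<lambda>i. pdeg (q i)) ` {..N})"
  have M: "pdeg (q i) \<le> M" if "i \<le> N" for i using that by (auto simp: M_def)
  have ev: "poly (q i) c = (\<Sum>j\<le>M. pcoeff (q i) j * c ^ j)" if "i \<le> N" for i
    unfolding poly_altdef using M[OF that] by (intro sum.mono_neutral_left) (auto simp: coeff_eq_0)
  \<comment> \<open>\<open>R j\<close> collects the coefficient of c^j, so that the relation for
    \<open>b\<close> over A[c] becomes the relation \<open>T\<close> for \<open>c\<close> over
    A[b].\<close>
  define R where "R j = (\<Sum>i\<le>N. Polynomial.monom (pcoeff (q i) j) i)" for j
  define T where "T = (\<Sum>j\<le>M. Polynomial.monom (poly (R j) b) j)"
  have R: "R j \<in> polys_over A" for j unfolding R_def
    using q polys_over_coeff by (intro subring_on_sum[OF subring_on_polys_over[OF A]] polys_over_monom[OF A]) blast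
  have T: "T \<in> polys_over (adjoin1 A b)" unfolding T_def using R
    by (intro subring_on_sum[OF subring_on_polys_over[OF adjoin1_subring[OF A]]] polys_over_monom[OF adjoin1_subring[OF A]])
      (auto simp: adjoin1_def)
  have "poly T c = (\<Sum>j\<le>M. \<Sum>i\<le>N. pcoeff (q i) j * b ^ i * c ^ j)"
    by (simp add: T_def R_def poly_sum poly_monom sum_distrib_right)
  also have "\<dots> = (\<Sum>i\<le>N. (\<Sum>j\<le>M. pcoeff (q i) j * c ^ j) * b ^ i)"
    by (subst sum.swap) (simp add: sum_distrib_right mult.assoc mult.commute[of "b ^ _"])
  also have "\<dots> = (\<Sum>i\<le>N. pcoeff p i * b ^ i)" using ev q(2) by simp
  also have "\<dots> = 0" using 0 unfolding poly_altdef N_def .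
  finally have T0: "T = 0" using transcD[OF c T] by blast
  have "poly (R j) b = 0" if "j \<le> M" for j
  proof -
    have "pcoeff T j = poly (R j) b" using that by (simp add: T_def coeff_sum when_def sum.delta)
    then show ?thesis using T0 by simp
  qed
  then have R0: "R j = 0" if "j \<le> M" for j using transcD[OF b R] that by blast
  have "pcoeff p i = 0" for i
  proof (cases "i \<le> N")
    case True
    have "pcoeff (q i) j = 0" for j
    proof (cases "j \<le> M")
      case jM: True
      have "pcoeff (R j) i = pcoeff (q i) j" using True by (simp add: R_def coeff_sum when_def sum.delta)
      then show ?thesis using R0[OF jM] by simp
    next
      case False
      then show ?thesis using M[OF True] by (intro coeff_eq_0) linarith
    qed
    then have "q i = 0" by (intro poly_eqI) simp
    then show ?thesis using q(2)[of i] by simp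
  next
    case False then show ?thesis by (auto simp: N_def intro: coeff_eq_0)
  qed
  then show "p = 0" by (intro poly_eqI) simp
qed

lemma adjoin1_swap: 
  assumes A: "subring_on A" shows "adjoin1 (adjoin1 A b) c = adjoin1 (adjoin1 A c) b"
proof -
  have sub: "adjoin1 (adjoin1 A b) c \<subseteq> adjoin1 (adjoin1 A c) b" for b c
  proof (rule adjoin1_least)
    show "subring_on (adjoin1 (adjoin1 A c) b)" by (intro adjoin1_subring A)
    show "adjoin1 A b \<subseteq> adjoin1 (adjoin1 A c) b" using adjoin1_base[OF A] by (intro adjoin1_mono) blast
    show "c \<in> adjoin1 (adjoin1 A c) b" by (intro adjoin1_base[OF adjoin1_subring[OF A]] adjoin1_gen[OF A])
  qed
  show ?thesis using sub by blast
qed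

section \<open>Cohen's theorem\<close>

definition ideal_hull :: "'r::comm_ring_1 set \<Rightarrow> 'r set \<Rightarrow> 'r set" where
  "ideal_hull A F = \<Inter>{I. ideal_in I A \<and> F \<subseteq> I}"

definition fin_gen :: "'r::comm_ring_1 set \<Rightarrow> 'r set \<Rightarrow> bool" where
  "fin_gen A I \<longleftrightarrow> (\<exists>F. finite F \<and> F \<subseteq> I \<and> I \<subseteq> ideal_hull A F)"

lemma ideal_hull_least: "ideal_in I A \<Longrightarrow> F \<subseteq> I \<Longrightarrow> ideal_hull A F \<subseteq> I"
  by (auto simp: ideal_hull_def)

lemma ideal_hull_ideal: 
  assumes "subring_on A" "F \<subseteq> A" shows "ideal_in (ideal_hull A F) A"
proof -
  have "ideal_in A A" using assms by (auto simp: ideal_in_def)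
  then have "ideal_hull A F \<subseteq> A" using assms ideal_hull_least by blast
  then show ?thesis unfolding ideal_in_def by (auto simp: ideal_hull_def ideal_in_def)
qed

lemma ideal_hull_incl: "F \<subseteq> ideal_hull A F"
  by (auto simp: ideal_hull_def)

lemma finite_subset_chain:
  assumes "finite F" "F \<subseteq> \<Union>C" "C \<noteq> {}" "\<And>U V. U \<in> C \<Longrightarrow> V \<in> C \<Longrightarrow> U \<subseteq> V \<or> V \<subseteq> U"
  shows "\<exists>U\<in>C. F \<subseteq> U"
  using assms(1,2)
proof (induction F rule: finite_induct)
  case empty then show ?case using assms(3) by blast
next
  case (insert x F)
  then obtain U where U: "U \<in> C" "F \<subseteq> U" by blast
  obtain V where V: "V \<in> C" "x \<in> V" using insert.prems by blast
  show ?case using assms(4)[OF U(1) V(1)] U V by blast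
qed

lemma ideal_Union_chain:
  assumes "\<And>U. U \<in> C \<Longrightarrow> ideal_in U A" "C \<noteq> {}" "\<And>U V. U \<in> C \<Longrightarrow> V \<in> C \<Longrightarrow> U \<subseteq> V \<or> V \<subseteq> U"
  shows "ideal_in (\<Union>C) A"
  unfolding ideal_in_def
proof (intro conjI ballI)
  show "\<Union>C \<subseteq> A" using assms(1) ideal_in_sub by blast
  show "0 \<in> \<Union>C" using assms(1,2) ideal_in_0 by blast
  fix a b assume "a \<in> \<Union>C" "b \<in> \<Union>C"
  then obtain U where "U \<in> C" "a \<in> U" "b \<in> U" using assms(3) by blast
  then show "a + b \<in> \<Union>C" using ideal_in_add[OF assms(1)] by blast
next
  fix r b assume "r \<in> A" "b \<in> \<Union>C"
  then show "r * b \<in> \<Union>C" using ideal_in_mult[OF assms(1)] by blast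
qed

text \<open>An ideal \<open>M\<close> maximal among those that are not finitely generated is prime:
  if \<open>a * b\<close> lies in \<open>M\<close> but neither factor does, then M + (a) and (M : a)
  are strictly larger, hence finitely generated, and \<open>M\<close> would be finitely generated
  too.\<close>

theorem Cohen:
  assumes A: "subring_on A" and primes: "\<And>P. prime_in P A \<Longrightarrow> fin_gen A P" shows "noeth A"
proof -
  have all: "fin_gen A I" if "ideal_in I A" for I
  proof (rule ccontr)
    assume nI: "\<not> fin_gen A I"
    let ?S = "{I. ideal_in I A \<and> \<not> fin_gen A I}"
    have "\<exists>M\<in>?S. \<forall>U\<in>?S. M \<subseteq> U \<longrightarrow> U = M"
    proof (rule subset_Zorn_nonempty)
      show "?S \<noteq> {}" using that nI by blast
      fix C assume C: "C \<noteq> {}" "subset.chain ?S C"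
      have id: "\<And>U. U \<in> C \<Longrightarrow> ideal_in U A" "\<And>U. U \<in> C \<Longrightarrow> \<not> fin_gen A U" 
        and tot: "\<And>U V. U \<in> C \<Longrightarrow> V \<in> C \<Longrightarrow> U \<subseteq> V \<or> V \<subseteq> U" 
        using C(2) unfolding subset_chain_def by (simp_all add: subset_iff)
      have "\<not> fin_gen A (\<Union>C)"
      proof
        assume "fin_gen A (\<Union>C)"
        then obtain F where F: "finite F" "F \<subseteq> \<Union>C" "\<Union>C \<subseteq> ideal_hull A F" unfolding fin_gen_def by blast
        obtain U where U: "U \<in> C" "F \<subseteq> U" using finite_subset_chain[OF F(1,2) C(1) tot] by blast
        have "U \<subseteq> ideal_hull A F" using F(3) U(1) by blast
        then have "fin_gen A U" using F(1) U(2) unfolding fin_gen_def by (intro exI[of _ F] conjI)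
        then show False using id U by blast
      qed
      then show "\<Union>C \<in> ?S" using ideal_Union_chain[OF id(1) C(1) tot] by blast
    qed
    then obtain M where M: "ideal_in M A" "\<not> fin_gen A M" "\<And>U. ideal_in U A \<Longrightarrow> \<not> fin_gen A U \<Longrightarrow> M \<subseteq> U \<Longrightarrow> U = M" by blast
    have "prime_in M A"
      unfolding prime_in_def
    proof (intro conjI ballI impI)
      show "ideal_in M A" by (rule M)
      show "1 \<notin> M"
      proof
        assume 1: "1 \<in> M"
        have "M \<subseteq> ideal_hull A {1}"
        proof
          fix a assume "a \<in> M"
          then have "a \<in> A" using ideal_in_sub[OF M(1)] by blast
          then have "a * 1 \<in> ideal_hull A {1}" 
            using ideal_hull_ideal[OF A, of "{1}"] ideal_hull_incl[of "{1}" A] A by (intro ideal_in_mult[of _ A]) auto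
          then show "a \<in> ideal_hull A {1}" by simp
        qed
        then show False using M(2) 1 unfolding fin_gen_def by blast
      qed
      fix a b assume ab: "a \<in> A" "b \<in> A" "a * b \<in> M"
      show "a \<in> M \<or> b \<in> M"
      proof (rule ccontr)
        assume nab: "\<not> ?thesis"
        let ?J = "ideal_sum M (princ A a)" and ?Q = "{r\<in>A. r * a \<in> M}"
        have pr: "ideal_in (princ A a) A" by (rule princ_ideal[OF A ab(1)])
        have Jid: "ideal_in ?J A" by (rule ideal_sum_ideal[OF M(1) pr A])
        have Qid: "ideal_in ?Q A"
          unfolding ideal_in_def
        proof (intro conjI ballI)
          show "0 \<in> ?Q" using A ideal_in_0[OF M(1)] by auto
          show "r + s \<in> ?Q" if "r \<in> ?Q" "s \<in> ?Q" for r s 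
            using that A ideal_in_add[OF M(1)] by (auto simp: distrib_right)
          show "r * s \<in> ?Q" if "r \<in> A" "s \<in> ?Q" for r s 
            using that A ideal_in_mult[OF M(1)] by (auto simp: mult.assoc)
        qed auto
        have "M \<subseteq> ?J" by (rule ideal_sum_left[OF pr])
        moreover have "a \<in> ?J" using ideal_sum_right[OF M(1)] princ_self[OF A] by blast
        ultimately have "fin_gen A ?J" using M(3)[OF Jid] nab by blast
        moreover have "M \<subseteq> ?Q" using ideal_in_sub[OF M(1)] ideal_in_mult'[OF M(1) ab(1)] by blast
        moreover have "b \<in> ?Q" using ab by (simp add: mult.commute)
        ultimately have "fin_gen A ?J" "fin_gen A ?Q" using M(3)[OF Qid] nab by blast+
        then obtain F G where F: "finite F" "F \<subseteq> ?J" "?J \<subseteq> ideal_hull A F" and G: "finite G" "G \<subseteq> ?Q" "?Q \<subseteq> ideal_hull A G"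
          unfolding fin_gen_def by blast
        have "\<exists>y\<in>M. \<exists>r\<in>A. f = y + r * a" if "f \<in> F" for f
          using F(2) that unfolding ideal_sum_def princ_def by blast
        then obtain y where y: "\<And>f. f \<in> F \<Longrightarrow> y f \<in> M \<and> (\<exists>r\<in>A. f = y f + r * a)" by metis
        \<comment> \<open>The components in \<open>M\<close> of the generators of M + (a), together
          with \<open>a\<close> times the generators of (M : a), generate \<open>M\<close>.\<close>
        let ?T = "y ` F \<union> (\<lambda>r. r * a) ` G"
        have TM: "?T \<subseteq> M" using y G(2) by blast
        then have TA: "?T \<subseteq> A" using ideal_in_sub[OF M(1)] by blast
        have Hid: "ideal_in (ideal_hull A ?T) A" by (rule ideal_hull_ideal[OF A TA])
        have inc: "?T \<subseteq> ideal_hull A ?T" by (rule ideal_hull_incl)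
        have "F \<subseteq> ideal_sum (ideal_hull A ?T) (princ A a)"
        proof
          fix f assume f: "f \<in> F"
          then obtain r where r: "r \<in> A" "f = y f + r * a" using y by blast
          have "y f \<in> ideal_hull A ?T" using inc f by blast
          then show "f \<in> ideal_sum (ideal_hull A ?T) (princ A a)" using r unfolding ideal_sum_def princ_def by blast
        qed
        then have J: "?J \<subseteq> ideal_sum (ideal_hull A ?T) (princ A a)"
          using F(3) ideal_hull_least[OF ideal_sum_ideal[OF Hid pr A]] by blast
        have "ideal_in {r\<in>A. r * a \<in> ideal_hull A ?T} A"
          unfolding ideal_in_def
        proof (intro conjI ballI)
          show "0 \<in> {r\<in>A. r * a \<in> ideal_hull A ?T}" using A ideal_in_0[OF Hid] by auto
          show "r + s \<in> {r\<in>A. r * a \<in> ideal_hull A ?T}" 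
            if "r \<in> {r\<in>A. r * a \<in> ideal_hull A ?T}" "s \<in> {r\<in>A. r * a \<in> ideal_hull A ?T}" for r s 
            using that A ideal_in_add[OF Hid] by (auto simp: distrib_right)
          show "r * s \<in> {r\<in>A. r * a \<in> ideal_hull A ?T}" 
            if "r \<in> A" "s \<in> {r\<in>A. r * a \<in> ideal_hull A ?T}" for r s 
            using that A ideal_in_mult[OF Hid] by (auto simp: mult.assoc)
        qed auto
        moreover have "G \<subseteq> {r\<in>A. r * a \<in> ideal_hull A ?T}" using G(2) inc by blast
        ultimately have Q: "?Q \<subseteq> {r\<in>A. r * a \<in> ideal_hull A ?T}" using G(3) ideal_hull_least by blast
        have "M \<subseteq> ideal_hull A ?T"
        proof
          fix z assume z: "z \<in> M"
          then have "z \<in> ideal_sum (ideal_hull A ?T) (princ A a)" using \<open>M \<subseteq> ?J\<close> J by blast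
          then obtain u r where u: "u \<in> ideal_hull A ?T" "r \<in> A" "z = u + r * a" unfolding ideal_sum_def princ_def by blast
          have "u \<in> M" using u(1) ideal_hull_least[OF M(1) TM] by blast
          then have "r * a \<in> M" using ideal_in_diff[OF A M(1) z, of u] u(3) by simp
          then have "r * a \<in> ideal_hull A ?T" using Q u(2) by blast
          then show "z \<in> ideal_hull A ?T" using u ideal_in_add[OF Hid] by blast
        qed
        moreover have "finite ?T" using F(1) G(1) by simp
        ultimately have "fin_gen A M" unfolding fin_gen_def using TM by (intro exI[of _ ?T] conjI)
        then show False using M(2) by blast
      qed
    qed
    then show False using primes M(2) by blast
  qed
  show ?thesis
  proof (rule noethI)
    fix I :: "nat \<Rightarrow> 'a set"
    assume id: "\<And>i. ideal_in (I i) A" and ss: "\<And>i. I i \<subset> I (Suc i)"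
    have mono: "I i \<subseteq> I j" if "i \<le> j" for i j using lift_Suc_mono_le[of I i j] ss that by blast
    have tot: "U \<subseteq> V \<or> V \<subseteq> U" if "U \<in> range I" "V \<in> range I" for U V
      using that mono by (metis nat_le_linear rangeE)
    have "ideal_in (\<Union>(range I)) A" by (rule ideal_Union_chain[OF _ _ tot]) (use id in auto)
    then obtain F where F: "finite F" "F \<subseteq> \<Union>(range I)" "\<Union>(range I) \<subseteq> ideal_hull A F" 
      using all[of "\<Union>(range I)"] unfolding fin_gen_def by blast
    obtain U where U: "U \<in> range I" "F \<subseteq> U" using finite_subset_chain[OF F(1,2) _ tot] by auto
    then obtain i where i: "F \<subseteq> I i" by (elim rangeE) simp
    have "I (Suc i) \<subseteq> I i" using F(3) ideal_hull_least[OF id i] by blast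
    then show False using ss[of i] by blast
  qed
qed

section \<open>Localization at a prime inside the ambient field\<close>

locale prime_localization =
  fixes J P :: "'a::field set"
  assumes J: "subring_on J" and P: "prime_in P J"
begin

abbreviation "R \<equiv> localization_at J P"

lemma denom_nz: "b \<in> J - P \<Longrightarrow> b \<noteq> 0"
  using ideal_in_0[OF prime_in_ideal[OF P]] by blast

lemma denom_1: "1 \<in> J - P"
  using prime_in_1[OF P] J by auto

lemma denom_mult: "b \<in> J - P \<Longrightarrow> c \<in> J - P \<Longrightarrow> b * c \<in> J - P"
  using prime_in_mult[OF P] J by auto

lemma locI: "a \<in> J \<Longrightarrow> b \<in> J - P \<Longrightarrow> a / b \<in> R"
  unfolding localization_at_def by blast

lemma loc_base: "J \<subseteq> R"
  using locI[OF _ denom_1] by force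

lemma loc_subring: "subring_on R"
proof (rule subring_onI)
  show "1 \<in> R" using loc_base J by blast
  fix u v assume "u \<in> R" "v \<in> R"
  then obtain a b c d where *: "u = a / b" "a \<in> J" "b \<in> J - P" "v = c / d" "c \<in> J" "d \<in> J - P"
    unfolding localization_at_def by blast
  have "u + v = (a * d + c * b) / (b * d)" using * denom_nz by (simp add: field_simps)
  moreover have "a * d + c * b \<in> J" using * J by auto
  ultimately show "u + v \<in> R" using locI denom_mult * by metis
  have "u * v = (a * c) / (b * d)" using * by simp
  moreover have "a * c \<in> J" using * J by auto
  ultimately show "u * v \<in> R" using locI denom_mult * by metis
next
  fix u assume "u \<in> R"
  then obtain a b where *: "u = a / b" "a \<in> J" "b \<in> J - P" unfolding localization_at_def by blast
  then have "- u = (- a) / b" "- a \<in> J" using J by auto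
  then show "- u \<in> R" using locI * by metis
qed

lemma loc_inverse: "b \<in> J - P \<Longrightarrow> inverse b \<in> R"
  using locI[of 1 b] J by (auto simp: inverse_eq_divide)

lemma loc_ideal_mem:
  assumes I: "ideal_in I R" and u: "u \<in> R"
  shows "u \<in> I \<longleftrightarrow> (\<exists>a\<in>J. a \<in> I \<and> (\<exists>b\<in>J-P. u = a / b))"
proof
  assume uI: "u \<in> I"
  obtain a b where *: "u = a / b" "a \<in> J" "b \<in> J - P" using u unfolding localization_at_def by blast
  then have "b * u \<in> I" using ideal_in_mult[OF I _ uI] loc_base by blast
  moreover have "b * u = a" using * denom_nz by simp
  ultimately show "\<exists>a\<in>J. a \<in> I \<and> (\<exists>b\<in>J-P. u = a / b)" using * by metis
next
  assume "\<exists>a\<in>J. a \<in> I \<and> (\<exists>b\<in>J-P. u = a / b)"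
  then obtain a b where "a \<in> I" "b \<in> J - P" "u = inverse b * a" by (auto simp: divide_inverse mult.commute)
  then show "u \<in> I" using ideal_in_mult[OF I loc_inverse] by blast
qed

lemma loc_ideal_eq:
  assumes "ideal_in I R" "ideal_in I' R" "{a\<in>J. a \<in> I} = {a\<in>J. a \<in> I'}" shows "I = I'"
proof -
  have "u \<in> I \<longleftrightarrow> u \<in> I'" if "u \<in> R" for u
    using loc_ideal_mem[OF assms(1) that] loc_ideal_mem[OF assms(2) that] assms(3) by blast
  then show ?thesis using ideal_in_sub[OF assms(1)] ideal_in_sub[OF assms(2)] by blast
qed

lemma noeth_loc: "noeth J \<Longrightarrow> noeth R"
  by (rule noeth_contract[OF _ hom_on_id J]) (use loc_base loc_ideal_eq in auto)

lemma loc_contract: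
  assumes I: "prime_in I R"
  shows "prime_in {a\<in>J. a \<in> I} J" "{a\<in>J. a \<in> I} \<subseteq> P"
proof -
  show "prime_in {a\<in>J. a \<in> I} J" by (rule contract_prime[OF hom_on_id J _ I]) (use loc_base in auto)
  show "{a\<in>J. a \<in> I} \<subseteq> P"
  proof (clarify, rule ccontr)
    fix a assume a: "a \<in> J" "a \<in> I" "a \<notin> P"
    then have "inverse a * a \<in> I" using ideal_in_mult[OF prime_in_ideal[OF I] loc_inverse] by blast
    moreover have "inverse a * a = 1" using denom_nz a by simp
    ultimately show False using prime_in_1[OF I] by simp
  qed
qed

lemma loc_extend:
  assumes q: "prime_in q J" "q \<subseteq> P"
  defines "e \<equiv> {a / b | a b. a \<in> q \<and> b \<in> J - P}"
  shows "prime_in e R" "{a\<in>J. a \<in> e} = q"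
proof -
  note id = prime_in_ideal[OF q(1)]
  have eI: "a / b \<in> e" if "a \<in> q" "b \<in> J - P" for a b using that unfolding e_def by blast
  have mem: "a \<in> q" if ab: "a / b \<in> e" and a: "a \<in> J" and b: "b \<in> J - P" for a b
  proof -
    obtain c d where cd: "a / b = c / d" "c \<in> q" "d \<in> J - P" using ab unfolding e_def by blast
    then have "d * a = b * c" using denom_nz[OF b] denom_nz[of d] by (simp add: field_simps)
    moreover have "b * c \<in> q" using ideal_in_mult[OF id] b cd by blast
    ultimately show ?thesis using prime_in_mult[OF q(1), of d a] a cd(3) q(2) by auto
  qed
  show "{a\<in>J. a \<in> e} = q"
  proof (intro equalityI subsetI)
    fix a assume "a \<in> {a\<in>J. a \<in> e}"
    then show "a \<in> q" using mem[of a 1] denom_1 by simp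
  next
    fix a assume a: "a \<in> q"
    then show "a \<in> {a\<in>J. a \<in> e}" using eI[OF a denom_1] ideal_in_sub[OF id] by simp
  qed
  show "prime_in e R"
    unfolding prime_in_def ideal_in_def
  proof (intro conjI ballI impI)
    show "e \<subseteq> R" unfolding e_def using ideal_in_sub[OF id] locI by blast
    show "0 \<in> e" using eI[OF ideal_in_0[OF id] denom_1] by simp
    show "1 \<notin> e" using mem[of 1 1] denom_1 prime_in_1[OF q(1)] J by auto
  next
    fix u v assume "u \<in> e" "v \<in> e"
    then obtain a b c d where *: "u = a / b" "a \<in> q" "b \<in> J - P" "v = c / d" "c \<in> q" "d \<in> J - P"
      unfolding e_def by blast
    have "u + v = (d * a + b * c) / (b * d)" using * denom_nz[of b] denom_nz[of d] by (simp add: field_simps)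
    moreover have "d * a + b * c \<in> q" using * by (intro ideal_in_add[OF id] ideal_in_mult[OF id]) auto
    ultimately show "u + v \<in> e" using eI denom_mult * by metis
  next
    fix u v assume "u \<in> R" "v \<in> e"
    then obtain a b c d where *: "u = a / b" "a \<in> J" "b \<in> J - P" "v = c / d" "c \<in> q" "d \<in> J - P"
      unfolding e_def localization_at_def by blast
    have "u * v = (a * c) / (b * d)" using * by simp
    moreover have "a * c \<in> q" using * by (intro ideal_in_mult[OF id]) auto
    ultimately show "u * v \<in> e" using eI denom_mult * by metis
  next
    fix u v assume "u \<in> R" "v \<in> R" and uv: "u * v \<in> e"
    then obtain a b c d where *: "u = a / b" "a \<in> J" "b \<in> J - P" "v = c / d" "c \<in> J" "d \<in> J - P"
      unfolding localization_at_def by blast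
    have "(a * c) / (b * d) \<in> e" using uv * by simp
    then have "a * c \<in> q" using mem[of "a * c" "b * d"] denom_mult * J by blast
    then show "u \<in> e \<or> v \<in> e" using prime_in_mult[OF q(1)] * eI by blast
  qed
qed

lemma loc_chain:
  assumes Q: "prime_chain J n Q" "Q n \<subseteq> P" shows "has_chain R n"
proof -
  have sub: "Q i \<subseteq> P" if "i \<le> n" for i
  proof -
    have "Q i \<subseteq> Q n" using that
    proof (induction rule: inc_induct)
      case (step i) then show ?case using Q(1) by (auto simp: prime_chain_def)
    qed simp
    then show ?thesis using Q(2) by blast
  qed
  define e where "e i = {a / b | a b. a \<in> Q i \<and> b \<in> J - P}" for i
  have e: "prime_in (e i) R" "{a\<in>J. a \<in> e i} = Q i" if "i \<le> n" for i
    using loc_extend[of "Q i"] sub[OF that] Q(1) that unfolding prime_chain_def e_def by blast+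
  have "e i \<subset> e (Suc i)" if i: "i < n" for i
  proof -
    have "Q i \<subset> Q (Suc i)" using Q(1) i by (auto simp: prime_chain_def)
    then have "e i \<subseteq> e (Suc i)" unfolding e_def by blast
    moreover have "e i \<noteq> e (Suc i)" using e(2)[of i] e(2)[of "Suc i"] i \<open>Q i \<subset> Q (Suc i)\<close> by auto
    ultimately    show ?thesis by blast
  qed
  then show ?thesis using e unfolding has_chain_def prime_chain_def by blast
qed

text \<open>By \<open>Cohen\<close> it suffices to treat primes, and those of \<open>R\<close> are
  determined by primes of \<open>J\<close> inside \<open>P\<close>. Generation is asked only up to a
  denominator \<open>w\<close>, which is a unit of \<open>R\<close>.\<close>

lemma noeth_locI:
  assumes "\<And>q. prime_in q J \<Longrightarrow> q \<subseteq> P \<Longrightarrow> \<exists>F. finite F \<and> F \<subseteq> q \<and> (\<forall>a\<in>q. \<exists>w\<in>J-P. w * a \<in> ideal_hull J F)"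
  shows "noeth R"
proof (rule Cohen[OF loc_subring])
  fix I assume I: "prime_in I R"
  note id = prime_in_ideal[OF I]
  obtain F where F: "finite F" "F \<subseteq> {a\<in>J. a \<in> I}" "\<And>a. a \<in> {a\<in>J. a \<in> I} \<Longrightarrow> \<exists>w\<in>J-P. w * a \<in> ideal_hull J F"
    using assms[OF loc_contract[OF I]] by blast
  have FR: "F \<subseteq> R" using F(2) loc_base by blast
  have Hid: "ideal_in (ideal_hull R F) R" by (rule ideal_hull_ideal[OF loc_subring FR])
  have "ideal_in {a\<in>J. a \<in> ideal_hull R F} J"
    by (rule contract_ideal[OF hom_on_id J _ Hid]) (use loc_base in auto)
  moreover have "F \<subseteq> {a\<in>J. a \<in> ideal_hull R F}" using F(2) ideal_hull_incl by blast
  ultimately have HH: "ideal_hull J F \<subseteq> {a\<in>J. a \<in> ideal_hull R F}" by (rule ideal_hull_least)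
  have "I \<subseteq> ideal_hull R F"
  proof
    fix u assume u: "u \<in> I"
    then obtain a b where ab: "a \<in> J" "a \<in> I" "b \<in> J - P" "u = a / b" 
      using loc_ideal_mem[OF id] ideal_in_sub[OF id] by blast
    then obtain w where w: "w \<in> J - P" "w * a \<in> ideal_hull R F" using F(3) HH by blast
    have "inverse (w * b) * (w * a) \<in> ideal_hull R F"
      by (rule ideal_in_mult[OF Hid loc_inverse w(2)]) (use w ab denom_mult in blast)
    moreover have "inverse (w * b) * (w * a) = u" using ab(3,4) w(1) denom_nz[of w] denom_nz[of b] by (simp add: field_simps)
    ultimately show "u \<in> ideal_hull R F" by simp
  qed
  then show "fin_gen R I" unfolding fin_gen_def using F(1,2) by blast
qed

lemma common_denominator:
  assumes "finite S" "\<And>i. i \<in> S \<Longrightarrow> f i \<in> R"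
  shows "\<exists>b\<in>J-P. \<forall>i\<in>S. b * f i \<in> J"
  using assms
proof (induction S rule: finite_induct)
  case empty then show ?case using denom_1 by blast
next
  case (insert x S)
  then obtain b where b: "b \<in> J - P" "\<And>i. i \<in> S \<Longrightarrow> b * f i \<in> J" by auto
  obtain c d where cd: "f x = c / d" "c \<in> J" "d \<in> J - P" using insert.prems[of x] unfolding localization_at_def by blast
  have "(b * d) * f x = b * c" using cd denom_nz by simp
  moreover have "b * c \<in> J" using b cd J by auto
  moreover have "(b * d) * f i \<in> J" if "i \<in> S" for i
    using subring_on_mult[OF J, of d "b * f i"] b(2)[OF that] cd by (simp add: mult.assoc mult.left_commute)
  ultimately show ?case using denom_mult[OF b(1) cd(3)] by (metis insertE)
qed

text \<open>A chain in a polynomial ring over \<open>R\<close> already shows up over a member of a directed family of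
  subrings of \<open>R\<close> that exhausts \<open>J\<close>, since numerators of finitely many witnesses suffice.\<close>

lemma dim_le_mpolys_directed:
  fixes B :: "nat \<Rightarrow> 'a set"
  assumes B: "\<And>i. subring_on (B i)" "\<And>i. B i \<subseteq> R" 
    and cov: "\<And>a. a \<in> J \<Longrightarrow> \<exists>i. \<forall>j\<ge>i. a \<in> B j"
    and dim: "\<And>i. dim_le (mpolys (B i) n) d"
  shows "dim_le (mpolys R n) d"
  unfolding dim_le_def
proof (intro allI impI)
  fix m assume "has_chain (mpolys R n) m"
  then obtain Q where Q: "prime_chain (mpolys R n) m Q" by (auto simp: has_chain_def)
  have "\<exists>f i. f \<in> mpolys J n \<and> (\<forall>j\<ge>i. f \<in> mpolys (B j) n) \<and> f \<in> Q (Suc l) \<and> f \<notin> Q l" if l: "l < m" for l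
  proof -
    have pr: "prime_in (Q l) (mpolys R n)" "prime_in (Q (Suc l)) (mpolys R n)" "Q l \<subset> Q (Suc l)" 
      using Q l by (auto simp: prime_chain_def)
    obtain f where f: "f \<in> Q (Suc l)" "f \<notin> Q l" using pr(3) by blast
    have fR: "f \<in> mpolys R n" using f ideal_in_sub[OF prime_in_ideal[OF pr(2)]] by blast
    obtain b where b: "b \<in> J - P" "\<forall>u\<in>Poly_Mapping.keys f. b * Poly_Mapping.lookup f u \<in> J"
      using common_denominator[OF finite_keys[of f], of "Poly_Mapping.lookup f"] fR by (auto simp: mpolys_def)
    \<comment> \<open>Multiplying by a common denominator \<open>b\<close> moves the witness into
      polynomials over \<open>J\<close>; \<open>b\<close> is a unit of \<open>R\<close>, so
      membership in the primes is unaffected.\<close>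
    let ?g = "Poly_Mapping.single 0 b * f"
    have lk: "Poly_Mapping.lookup ?g u = b * Poly_Mapping.lookup f u" for u
      by (simp add: mult_map_scale_conv_mult[symmetric] Poly_Mapping.map.rep_eq when_def in_keys_iff)
    have gJ: "?g \<in> mpolys J n"
      unfolding mpolys_def
    proof (intro CollectI conjI allI ballI)
      fix u show "Poly_Mapping.lookup ?g u \<in> J"
        using b(2) J unfolding lk by (cases "u \<in> Poly_Mapping.keys f") (auto simp: in_keys_iff)
    next
      fix u assume "u \<in> Poly_Mapping.keys ?g"
      then have "u \<in> Poly_Mapping.keys f" unfolding in_keys_iff lk by auto
      then show "Poly_Mapping.keys u \<subseteq> {..<n}" using fR by (auto simp: mpolys_def)
    qed
    have cR: "Poly_Mapping.single 0 c \<in> mpolys R n" if "c \<in> R" for c :: 'a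
      by (rule mpolys_single[OF loc_subring that]) simp
    have "?g \<in> Q (Suc l)" using ideal_in_mult[OF prime_in_ideal[OF pr(2)] cR f(1)] b(1) loc_base by blast
    moreover have "?g \<notin> Q l"
    proof
      assume "?g \<in> Q l"
      then have "Poly_Mapping.single 0 (inverse b) * ?g \<in> Q l" 
        using ideal_in_mult[OF prime_in_ideal[OF pr(1)] cR] loc_inverse[OF b(1)] by blast
      moreover have "Poly_Mapping.single 0 (inverse b) * ?g = f" 
        using denom_nz[OF b(1)] by (simp add: mult.assoc[symmetric] mult_single)
      ultimately show False using f by simp
    qed
    moreover have "\<exists>i. \<forall>j\<ge>i. ?g \<in> mpolys (B j) n"
    proof -
      have "\<exists>i. \<forall>j\<ge>i. Poly_Mapping.lookup ?g u \<in> B j" for u using cov gJ by (auto simp: mpolys_def)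
      then obtain i where i: "\<And>u j. j \<ge> i u \<Longrightarrow> Poly_Mapping.lookup ?g u \<in> B j" by metis
      have "?g \<in> mpolys (B j) n" if "j \<ge> Max (i ` Poly_Mapping.keys ?g)" for j
      proof -
        have "Poly_Mapping.lookup ?g u \<in> B j" for u
        proof (cases "u \<in> Poly_Mapping.keys ?g")
          case True
          then have "i u \<le> Max (i ` Poly_Mapping.keys ?g)" by (intro Max_ge) auto
          then show ?thesis using i that by force
        next
          case False then show ?thesis using B(1)[of j] by (auto simp: in_keys_iff)
        qed
        then show ?thesis using gJ by (auto simp: mpolys_def)
      qed
      then show ?thesis by blast
    qed
    ultimately show ?thesis using gJ by blast
  qed
  then obtain f i where fi: "\<And>l j. l < m \<Longrightarrow> j \<ge> i l \<Longrightarrow> f l \<in> mpolys (B j) n" 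
    "\<And>l. l < m \<Longrightarrow> f l \<in> Q (Suc l) \<and> f l \<notin> Q l" by metis
  \<comment> \<open>Each witness has its coefficients in all \<open>B j\<close> from some index on,
    so one index serves all \<open>m\<close> witnesses even if the family \<open>B\<close> is not
    increasing.\<close>
  define k where "k = Max (insert 0 (i ` {..<m}))"
  have k: "i l \<le> k" if "l < m" for l using that unfolding k_def by (intro Max_ge) auto
  have "\<exists>a\<in>mpolys (B k) n. a \<in> Q (Suc l) \<and> a \<notin> Q l" if "l < m" for l
    using fi(1)[OF that k[OF that]] fi(2)[OF that] by blast
  then have "prime_chain (mpolys (B k) n) m (\<lambda>l. {a\<in>mpolys (B k) n. a \<in> Q l})"
    using contract_chain[OF hom_on_id subring_mpolys[OF B(1)] _ Q] mpolys_mono[OF B(2)] by auto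
  then show "m \<le> d" using dim[of k] by (auto simp: dim_le_def has_chain_def)
qed

end

section \<open>Criteria for Jaffard domains\<close>

lemma jaffard_domainI:
  fixes D :: "'a::field set"
  assumes D: "subring_on D" and ch: "has_chain D d" and le: "dim_le D d" "\<And>n. dim_le (mpolys D n) (n + d)"
  shows "jaffard_domain D"
  unfolding jaffard_domain_def
  using krull_dim_eqI[OF D ch le(1)] krull_dim_eqI[OF subring_mpolys[OF D] has_chain_mpolys[OF D ch] le(2)]
    domain_sub_ring[OF D] by simp

text \<open>Any finite bound \<open>b\<close> guarantees a longest chain; with its length in place
  of \<open>b\<close>, the Noetherian upper bounds match the lower ones.\<close>

lemma jaffard_domain_noeth:
  fixes D :: "'a::field set"
  assumes D: "subring_on D" and N: "noeth D" and bd: "dim_le D b"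
  shows "jaffard_domain D"
proof -
  have "prime_chain D 0 (\<lambda>_. {0})" using prime_in_zero[OF D] by (auto simp: prime_chain_def)
  then have ne: "has_chain D 0" by (auto simp: has_chain_def)
  define d where "d = (GREATEST n. has_chain D n)"
  have "has_chain D d" unfolding d_def 
    by (rule GreatestI_nat[of "has_chain D" 0 b]) (use ne bd in \<open>simp_all add: dim_le_def\<close>)
  moreover have "dim_le D d" unfolding d_def dim_le_def using Greatest_le_nat[of "has_chain D" _ b] bd 
    by (simp add: dim_le_def)
  ultimately show ?thesis using jaffard_domainI[OF D] noeth_dim_mpolys[OF D N] by blast
qed

section \<open>Algebraic independence and adjunction\<close>

definition monom_eval :: "(nat \<Rightarrow> 'a::comm_ring_1) \<Rightarrow> (nat \<Rightarrow>\<^sub>0 nat) \<Rightarrow> 'a" where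
  "monom_eval v m = (\<Prod>i\<in>Poly_Mapping.keys m. v i ^ Poly_Mapping.lookup m i)"

lemma monom_eval_superset:
  "finite S \<Longrightarrow> Poly_Mapping.keys m \<subseteq> S \<Longrightarrow> monom_eval v m = (\<Prod>i\<in>S. v i ^ Poly_Mapping.lookup m i)"
  unfolding monom_eval_def by (rule prod.mono_neutral_left) (auto simp: in_keys_iff)

lemma monom_eval_add: "monom_eval v (m + l) = monom_eval v m * monom_eval v l"
proof -
  let ?S = "Poly_Mapping.keys m \<union> Poly_Mapping.keys l"
  have "monom_eval v (m + l) = (\<Prod>i\<in>?S. v i ^ Poly_Mapping.lookup (m + l) i)"
    by (rule monom_eval_superset) (use Poly_Mapping.keys_add[of m l] in auto)
  also have "\<dots> = (\<Prod>i\<in>?S. v i ^ Poly_Mapping.lookup m i) * (\<Prod>i\<in>?S. v i ^ Poly_Mapping.lookup l i)"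
    by (simp add: lookup_add power_add prod.distrib)
  also have "\<dots> = monom_eval v m * monom_eval v l"
    by (subst (1 2) monom_eval_superset[of ?S]) auto
  finally show ?thesis .
qed

lemma mpoly_eval_superset:
  "finite S \<Longrightarrow> Poly_Mapping.keys p \<subseteq> S \<Longrightarrow> mpoly_eval v p = (\<Sum>m\<in>S. Poly_Mapping.lookup p m * monom_eval v m)"
  unfolding mpoly_eval_def monom_eval_def[symmetric] by (rule sum.mono_neutral_left) (auto simp: in_keys_iff)

lemma mpoly_eval_single: "mpoly_eval v (Poly_Mapping.single m c) = c * monom_eval v m"
  by (subst mpoly_eval_superset[of "{m}"]) (auto split: if_splits)

lemma mpoly_eval_add: "mpoly_eval v (p + q) = mpoly_eval v p + mpoly_eval v q"
proof -
  let ?S = "Poly_Mapping.keys p \<union> Poly_Mapping.keys q"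
  have "mpoly_eval v (p + q) = (\<Sum>m\<in>?S. Poly_Mapping.lookup (p + q) m * monom_eval v m)"
    by (rule mpoly_eval_superset) (use Poly_Mapping.keys_add[of p q] in auto)
  also have "\<dots> = (\<Sum>m\<in>?S. Poly_Mapping.lookup p m * monom_eval v m) + (\<Sum>m\<in>?S. Poly_Mapping.lookup q m * monom_eval v m)"
    by (simp add: lookup_add distrib_right sum.distrib)
  also have "\<dots> = mpoly_eval v p + mpoly_eval v q"
    by (subst (1 2) mpoly_eval_superset[of ?S]) auto
  finally show ?thesis .
qed

lemma mpoly_eval_sum: "mpoly_eval v (sum f S) = (\<Sum>i\<in>S. mpoly_eval v (f i))"
  by (induction S rule: infinite_finite_induct) (auto simp: mpoly_eval_add, auto simp: mpoly_eval_def)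

lemma mpoly_eval_mult: "mpoly_eval v (p * q) = mpoly_eval v p * mpoly_eval v q"
proof -
  have "mpoly_eval v (p * q) = mpoly_eval v (\<Sum>m\<in>Poly_Mapping.keys p. \<Sum>l\<in>Poly_Mapping.keys q. 
      Poly_Mapping.single (m + l) (Poly_Mapping.lookup p m * Poly_Mapping.lookup q l))"
    by (subst (1) mpoly_sum_monomials[of p, symmetric], subst (1) mpoly_sum_monomials[of q, symmetric])
      (simp add: sum_product mult_single)
  also have "\<dots> = mpoly_eval v p * mpoly_eval v q"
    unfolding mpoly_eval_superset[OF finite_keys[of p] order_refl] mpoly_eval_superset[OF finite_keys[of q] order_refl]
    by (simp add: mpoly_eval_sum mpoly_eval_single monom_eval_add sum_product mult_ac)
  finally show ?thesis .
qed

lemma hom_on_mpoly_eval: "hom_on (mpoly_eval v) A"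
proof -
  have "mpoly_eval v 1 = 1" using mpoly_eval_single[of v 0 1] by (simp add: monom_eval_def)
  then show ?thesis by (auto simp: hom_on_def mpoly_eval_add mpoly_eval_mult) (simp add: mpoly_eval_def)
qed

lemma mpoly_eval_mvar: "mpoly_eval v (mvar n) = v n"
  by (simp add: mvar_def mpoly_eval_single monom_eval_def)

lemma hom_poly:
  assumes f: "hom_on f UNIV" and p: "\<And>i. pcoeff q i = f (pcoeff p i)"
  shows "f (poly p y) = poly q (f y)"
proof -
  have "pdeg q \<le> pdeg p" by (rule degree_le) (simp add: p coeff_eq_0 hom_on_0[OF f])
  then have "poly q (f y) = (\<Sum>i\<le>pdeg p. pcoeff q i * f y ^ i)"
    unfolding poly_altdef by (intro sum.mono_neutral_left) (auto simp: coeff_eq_0)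
  moreover have pw: "f (y ^ i) = f y ^ i" for i using f by (induction i) (auto simp: hom_on_def)
  moreover have "f (sum g S) = (\<Sum>i\<in>S. f (g i))" for g and S :: "nat set"
    using f by (induction S rule: infinite_finite_induct) (auto simp: hom_on_def)
  ultimately show ?thesis using f unfolding poly_altdef by (simp add: p hom_on_def)
qed

lemma hom_adjoin1:
  assumes f: "hom_on f UNIV" and A: "subring_on A" shows "f ` adjoin1 A y = adjoin1 (f ` A) (f y)"
proof (rule equalityI)
  have fA: "hom_on f B" for B using f by (auto simp: hom_on_def)
  show "f ` adjoin1 A y \<subseteq> adjoin1 (f ` A) (f y)"
  proof
    fix b assume "b \<in> f ` adjoin1 A y"
    then obtain p where p: "p \<in> polys_over A" "b = f (poly p y)" unfolding adjoin1_def by blast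
    have "b = poly (map_poly f p) (f y)" unfolding p(2) by (rule hom_poly[OF f]) (simp add: coeff_map_poly hom_on_0[OF f])
    moreover have "map_poly f p \<in> polys_over (f ` A)" using p by (auto simp: polys_over_def coeff_map_poly hom_on_0[OF f])
    ultimately show "b \<in> adjoin1 (f ` A) (f y)" unfolding adjoin1_def by blast
  qed
  show "adjoin1 (f ` A) (f y) \<subseteq> f ` adjoin1 A y"
    using adjoin1_base[OF A] adjoin1_gen[OF A] 
    by (intro adjoin1_least subring_on_image[OF fA adjoin1_subring[OF A]]) auto
qed

lemma transc_hom:
  assumes f: "hom_on f UNIV" and A: "subring_on A" and y: "transc A y" 
    and inj: "\<And>u. u \<in> adjoin1 A y \<Longrightarrow> f u = 0 \<Longrightarrow> u = 0"
  shows "transc (f ` A) (f y)"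
  unfolding transc_def
proof (intro ballI impI)
  fix q assume q: "q \<in> polys_over (f ` A)" "poly q (f y) = 0"
  have "\<exists>c\<in>A. f c = pcoeff q i" for i using polys_over_coeff[OF q(1), of i] by auto
  then obtain c where c: "\<And>i. c i \<in> A" "\<And>i. f (c i) = pcoeff q i" by metis
  define p where "p = (\<Sum>i\<le>pdeg q. Polynomial.monom (c i) i)"
  have pq: "pcoeff q i = f (pcoeff p i)" for i
    using c hom_on_0[OF f] by (auto simp: p_def coeff_sum when_def sum.delta coeff_eq_0)
  have p: "p \<in> polys_over A" using c A by (auto simp: p_def polys_over_def coeff_sum when_def sum.delta)
  have "f (poly p y) = 0" using hom_poly[OF f pq] q(2) by simp
  moreover have "poly p y \<in> adjoin1 A y" using p by (auto simp: adjoin1_def)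
  ultimately have "p = 0" using inj transcD[OF y p] by blast
  then show "q = 0" using pq hom_on_0[OF f] by (intro poly_eqI) simp
qed

text \<open>Independence says that evaluation is injective on polynomials in three variables, so the
  transcendence of each formal variable over the preceding ones is carried over to \<open>a\<close>,
  \<open>b\<close> and \<open>c\<close>.\<close>

lemma alg_independent_3:
  fixes k :: "'a::field set"
  assumes k: "subring_on k" and ind: "alg_independent k [a, b, c]"
  shows "transc k a" "transc (adjoin1 k a) b" "transc (adjoin1 (adjoin1 k a) b) c"
proof -
  define v where "v = (\<lambda>i. [a, b, c] ! i)"
  let ?f = "mpoly_eval v"
  have f: "hom_on ?f A" for A by (rule hom_on_mpoly_eval)
  have S: "subring_on (mpolys k n)" for n by (rule subring_mpolys[OF k])
  have inj: "u = 0" if "u \<in> mpolys k 3" "?f u = 0" for u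
    using ind that unfolding alg_independent_def v_def by (simp add: numeral_3_eq_3)
  have sub: "mpolys k n \<subseteq> mpolys k 3" if "n \<le> 3" for n using that by (force simp: mpolys_def)
  have v: "?f (mvar 0) = a" "?f (mvar 1) = b" "?f (mvar 2) = c" by (simp_all add: mpoly_eval_mvar v_def)
  have t: "transc (?f ` mpolys k n) (?f (mvar n))" if "n < 3" for n
  proof (rule transc_hom[OF f S transc_mvar[OF k]])
    fix u assume "u \<in> adjoin1 (mpolys k n) (mvar n)" "?f u = 0"
    then show "u = 0" using inj sub[of "Suc n"] that mpolys_Suc[OF k] by auto
  qed
  have i: "?f ` mpolys k (Suc n) = adjoin1 (?f ` mpolys k n) (?f (mvar n))" for n
    unfolding mpolys_Suc[OF k] by (rule hom_adjoin1[OF f S])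
  have "?f (Poly_Mapping.single 0 c) = c" for c by (simp add: mpoly_eval_single monom_eval_def)
  then have i0: "?f ` mpolys k 0 = k" unfolding mpolys_0[OF k] by (simp add: image_image)
  show "transc k a" "transc (adjoin1 k a) b" "transc (adjoin1 (adjoin1 k a) b) c"
    using t[of 0] t[of 1] t[of 2] i[of 0] i[of 1] unfolding v i0 by (simp_all add: v i0 numeral_2_eq_2)
qed

text \<open>Here \<open>w\<close> is affine in \<open>y\<close> over the fraction field of
  \<open>B\<close>. Multiplying a relation for \<open>w\<close> by a power of \<open>u\<close> gives
  a relation for \<open>y + c\<close> over \<open>B\<close>, and substitution gives one for
  \<open>y\<close>.\<close>

lemma transc_affine:
  fixes B :: "'a::field set"
  assumes B: "subring_on B" and y: "transc B y" and uc: "u \<in> B" "u \<noteq> 0" "c \<in> B" and w: "u * w = y + c"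
  shows "transc B w"
  unfolding transc_def
proof (intro ballI impI)
  note SB = subring_on_polys_over[OF B]
  fix p assume p: "p \<in> polys_over B" "poly p w = 0"
  define r where "r = (\<Sum>i\<le>pdeg p. Polynomial.monom (pcoeff p i * u ^ (pdeg p - i)) i)"
  have r: "r \<in> polys_over B" unfolding r_def using polys_over_coeff[OF p(1)] uc B
    by (intro subring_on_sum[OF SB] polys_over_monom[OF B]) auto
  let ?q = "pcompose r [:c, 1:]"
  have lin: "[:c, 1:] \<in> polys_over B" using uc B by (intro polys_over_pCons polys_over_const) auto
  have "pcompose r [:c, 1:] \<in> polys_over B" if "r \<in> polys_over B" for r
    using that
  proof (induction r)
    case 0 then show ?case using SB by auto
  next
    case (pCons a r)
    have "a \<in> B" using polys_over_coeff[OF pCons.prems, of 0] by simp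
    moreover have "r \<in> polys_over B" using polys_over_coeff[OF pCons.prems, of "Suc _"] by (simp add: polys_over_def)
    ultimately show ?case unfolding pcompose_pCons using pCons.IH
      by (intro subring_on_add[OF SB] polys_over_const[OF B] subring_on_mult[OF SB lin])
  qed
  then have q: "?q \<in> polys_over B" using r by blast
  have "poly ?q y = (\<Sum>i\<le>pdeg p. pcoeff p i * u ^ (pdeg p - i) * (u * w) ^ i)"
    unfolding w by (simp add: poly_pcompose r_def poly_sum poly_monom add.commute)
  also have "\<dots> = (\<Sum>i\<le>pdeg p. u ^ pdeg p * (pcoeff p i * w ^ i))"
  proof (rule sum.cong[OF refl])
    fix i assume "i \<in> {..pdeg p}"
    then have "u ^ pdeg p = u ^ (pdeg p - i) * u ^ i" by (simp add: power_add[symmetric])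
    then show "pcoeff p i * u ^ (pdeg p - i) * (u * w) ^ i = u ^ pdeg p * (pcoeff p i * w ^ i)"
      by (simp add: power_mult_distrib)
  qed
  also have "\<dots> = u ^ pdeg p * poly p w" by (simp add: poly_altdef sum_distrib_left)
  finally have "?q = 0" using p(2) transcD[OF y q] by simp
  then have r0: "r = 0" using pcompose_eq_0[of r "[:c,1:]"] by simp
  have "pcoeff r i = pcoeff p i * u ^ (pdeg p - i)" if "i \<le> pdeg p" for i
    using that by (simp add: r_def coeff_sum when_def sum.delta)
  then have "pcoeff p i = 0" if "i \<le> pdeg p" for i using r0 that uc(2) by simp
  then show "p = 0" using leading_coeff_0_iff by blast
qed

section \<open>Subrings and subfields of the ambient field\<close>

lemma subring_type_algebra:
  "subring_on (A :: 'a::field set) \<Longrightarrow> subring A (ring_of_type_algebra :: 'a ring)"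
  and subring_type_algebra': "subring A (ring_of_type_algebra :: 'a ring) \<Longrightarrow> subring_on A"
proof -
  interpret R: cring "ring_of_type_algebra :: 'a ring" by (rule cring_from_type_algebra)
  have s: "carrier (ring_of_type_algebra :: 'a ring) = UNIV" "\<one>\<^bsub>ring_of_type_algebra :: 'a ring\<^esub> = 1"
    "monoid.mult (ring_of_type_algebra :: 'a ring) = (*)" "ring.add (ring_of_type_algebra :: 'a ring) = (+)"
    "\<zero>\<^bsub>ring_of_type_algebra :: 'a ring\<^esub> = 0"
    by (auto simp: ring_of_type_algebra_def fun_eq_iff)
  have neg: "\<ominus>\<^bsub>ring_of_type_algebra :: 'a ring\<^esub> h = - h" for h :: 'a
    by (rule R.minus_equality) (auto simp: s)
  show "subring_on A \<Longrightarrow> subring A (ring_of_type_algebra :: 'a ring)"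
    by (rule R.subringI) (auto simp: s neg)
  show "subring A (ring_of_type_algebra :: 'a ring) \<Longrightarrow> subring_on A"
    by (rule subring_onI) (use subringE[of A "ring_of_type_algebra :: 'a ring"] in \<open>auto simp: s neg\<close>)
qed

lemma adjoin_subring: "subring_on (adjoin (k :: 'a::field set) A)"
  and adjoin_incl: "k \<union> A \<subseteq> adjoin k A"
  and adjoin_least: "subring_on B \<Longrightarrow> k \<subseteq> B \<Longrightarrow> A \<subseteq> B \<Longrightarrow> adjoin k A \<subseteq> B"
proof -
  interpret R: cring "ring_of_type_algebra :: 'a ring" by (rule cring_from_type_algebra)
  have s: "carrier (ring_of_type_algebra :: 'a ring) = UNIV" by (auto simp: ring_of_type_algebra_def)
  show "subring_on (adjoin k A)" unfolding adjoin_def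
    by (rule subring_type_algebra') (rule R.generate_ring_is_subring, simp add: s)
  show "k \<union> A \<subseteq> adjoin k A" unfolding adjoin_def by (auto intro: generate_ring.incl)
  show "subring_on B \<Longrightarrow> k \<subseteq> B \<Longrightarrow> A \<subseteq> B \<Longrightarrow> adjoin k A \<subseteq> B" unfolding adjoin_def
    by (rule R.generate_ring_min_subring1) (auto simp: s subring_type_algebra)
qed

lemma subfield_type_algebra:
  assumes "subfield (k :: 'a::field set) ring_of_type_algebra"
  shows "subring_on k" "\<And>a. a \<in> k \<Longrightarrow> inverse a \<in> k"
proof -
  interpret subfield k "ring_of_type_algebra :: 'a ring" by (rule assms)
  show k: "subring_on k" by (rule subring_type_algebra'[OF subring_axioms])
  fix a assume a: "a \<in> k"
  show "inverse a \<in> k"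
  proof (cases "a = 0")
    case False
    then have "a \<in> Units (ring_of_type_algebra\<lparr>carrier := k\<rparr>)" unfolding subfield_Units using a
      by (simp add: ring_of_type_algebra_def)
    then obtain b where "b \<in> k" "b * a = 1" by (auto simp: Units_def ring_of_type_algebra_def)
    then show ?thesis using False by (metis inverse_unique mult.commute)
  qed (use a in simp)
qed

text \<open>The only ideals are 0 and \<open>k\<close>. This starts the inductions on the number of
  variables, both over \<open>k\<close> and over the fields k(z_i).\<close>

lemma subfield_dim:
  fixes k :: "'a::field set"
  assumes k: "subring_on k" and inv: "\<And>a. a \<in> k \<Longrightarrow> inverse a \<in> k"
  shows "noeth k" "dim_le k 0" "primes_contain_prime k"
proof -
  have id: "I = {0} \<or> I = k" if I: "ideal_in I k" for I
  proof (rule disjCI)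
    assume "I \<noteq> k"
    have "1 \<notin> I" 
    proof
      assume "1 \<in> I"
      then have "a \<in> I" if "a \<in> k" for a using ideal_in_mult[OF I that, of 1] by simp
      then show False using \<open>I \<noteq> k\<close> ideal_in_sub[OF I] by blast
    qed
    then have "a = 0" if "a \<in> I" for a
      using ideal_in_mult[OF I inv that, of a] ideal_in_sub[OF I that] by (metis left_inverse)
    then show "I = {0}" using ideal_in_0[OF I] by blast
  qed
  have pr: "P = {0}" if "prime_in P k" for P
    using id[OF prime_in_ideal[OF that]] prime_in_1[OF that] k by auto
  show "noeth k"
  proof (rule noethI)
    fix I :: "nat \<Rightarrow> 'a set" assume I: "\<And>i. ideal_in (I i) k" "\<And>i. I i \<subset> I (Suc i)"
    have "I 1 = k" using id[OF I(1)[of 1]] I(2)[of 0] ideal_in_0[OF I(1)[of 0]] by auto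
    then show False using I(2)[of 1] ideal_in_sub[OF I(1)[of 2]] by (auto simp: numeral_2_eq_2)
  qed
  show "dim_le k 0" unfolding dim_le_def has_chain_def
  proof (intro allI impI, elim exE)
    fix n P assume P: "prime_chain k n P"
    show "n \<le> 0"
    proof (rule ccontr)
      assume "\<not> n \<le> 0"
      then have "prime_in (P 0) k" "prime_in (P 1) k" "P 0 \<subset> P 1" using P by (auto simp: prime_chain_def)
      then show False using pr by blast
    qed
  qed
  show "primes_contain_prime k" unfolding primes_contain_prime_def using pr by blast
qed

lemma ideal_cong_poly:
  assumes J: "subring_on J" and I: "ideal_in I J" and p: "p \<in> polys_over J" and ab: "a \<in> J" "b \<in> J" "a - b \<in> I"
  shows "poly p a - poly p b \<in> I"
  using p
proof (induction p)
  case 0 then show ?case using ideal_in_0[OF I] by simp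
next
  case (pCons c p)
  have p: "p \<in> polys_over J" using polys_over_coeff[OF pCons.prems, of "Suc _"] by (simp add: polys_over_def)
  have "poly (pCons c p) a - poly (pCons c p) b = a * (poly p a - poly p b) + poly p b * (a - b)"
    by (simp add: algebra_simps)
  then show ?case using pCons.IH[OF p] ab poly_in_subring[OF J p ab(2)] 
    by (auto intro!: ideal_in_add[OF I] ideal_in_mult[OF I])
qed

lemma prime_image:
  assumes f: "hom_on f A" "inj_on f A" and A: "subring_on A" and P: "prime_in P A"
  shows "prime_in (f ` P) (f ` A)"
proof -
  have "f ` P = {b \<in> f ` A. inv_into A f b \<in> P}" using ideal_in_sub[OF prime_in_ideal[OF P]] f(2) by (auto simp: image_iff)
  then show ?thesis 
    using contract_prime[OF hom_on_inv[OF f A] subring_on_image[OF f(1) A] _ P] inv_into_image[OF f(2)] by auto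
qed

section \<open>David's ring\<close>

locale david =
  fixes k :: "'a::field_char_0 set" and s :: "nat \<Rightarrow> nat" and x :: 'a and z :: "nat \<Rightarrow> 'a"
  assumes k: "subring_on k" and kinv: "\<And>a. a \<in> k \<Longrightarrow> inverse a \<in> k"
    and s_pos: "\<And>n. n \<ge> 2 \<Longrightarrow> s n > 0"
    and ind: "alg_independent k [x, z 0, z 1]"
    and rec: "\<And>n. n \<ge> 2 \<Longrightarrow> x * z n = z (n - 1) ^ s n + z (n - 2)"
begin

text \<open>\<open>B n\<close> is the ring called \<open>J\<close> with index \<open>n + 1\<close> in the paper.\<close>

definition B :: "nat \<Rightarrow> 'a set" where
  "B n = adjoin1 (adjoin1 (adjoin1 k x) (z n)) (z (Suc n))"

abbreviation "J \<equiv> david_J k x z"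

lemma rec': "z n = x * z (n + 2) - z (n + 1) ^ s (n + 2)"
  using rec[of "n + 2"] by simp

lemma s_pos': "s (n + 2) > 0"
  using s_pos[of "n + 2"] by simp

lemma x_nz: "x \<noteq> 0"
proof
  assume "x = 0"
  then have "poly [:0, 1:] x = 0" by simp
  moreover have "[:0, 1:] \<in> polys_over k" using k by (intro polys_over_pCons polys_over_const) auto
  ultimately have "[:0, 1::'a:] = 0" by (rule transcD[OF alg_independent_3(1)[OF k ind], rotated])
  then show False by simp
qed

lemma kx: "subring_on (adjoin1 k x)" and kxz: "subring_on (adjoin1 (adjoin1 k x) y)"
  by (intro adjoin1_subring k)+

lemma B_subring: "subring_on (B n)"
  unfolding B_def by (intro adjoin1_subring k)

lemma B_k: "k \<subseteq> B n" and B_x: "x \<in> B n" and B_z: "z n \<in> B n" and B_z': "z (Suc n) \<in> B n"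
  unfolding B_def 
  by (auto intro!: adjoin1_base[OF kxz] adjoin1_base[OF kx] adjoin1_base[OF k] adjoin1_gen[OF k] adjoin1_gen[OF kx] adjoin1_gen[OF kxz])

lemma B_least: "subring_on S \<Longrightarrow> k \<subseteq> S \<Longrightarrow> x \<in> S \<Longrightarrow> z n \<in> S \<Longrightarrow> z (Suc n) \<in> S \<Longrightarrow> B n \<subseteq> S"
  unfolding B_def by (intro adjoin1_least)

lemma B_Suc: "B n \<subseteq> B (Suc n)"
proof (rule B_least[OF B_subring B_k B_x])
  have "x * z (n + 2) - z (n + 1) ^ s (n + 2) \<in> B (Suc n)"
    using B_x[of "Suc n"] B_z[of "Suc n"] B_z'[of "Suc n"] 
    by (intro subring_on_diff[OF B_subring] subring_on_mult[OF B_subring] subring_on_power[OF B_subring]) auto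
  then show "z n \<in> B (Suc n)" by (simp only: rec'[symmetric])
qed (rule B_z)

lemma B_mono: "m \<le> n \<Longrightarrow> B m \<subseteq> B n"
  by (rule lift_Suc_mono_le[of B]) (rule B_Suc)

lemma david_J_n_eq: "n \<ge> 1 \<Longrightarrow> david_J_n k x z n = B (n - 1)"
proof (rule equalityI)
  assume n: "n \<ge> 1"
  show "david_J_n k x z n \<subseteq> B (n - 1)" unfolding david_J_n_def
    using B_k B_x B_z[of "n - 1"] B_z'[of "n - 1"] n by (intro adjoin_least[OF B_subring]) auto
  show "B (n - 1) \<subseteq> david_J_n k x z n" unfolding david_J_n_def
    using adjoin_incl[of k "{x, z (n - 1), z n}"] n by (intro B_least[OF adjoin_subring]) auto
qed

lemma J_eq: "J = (\<Union>n. B n)"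
proof -
  have "J = (\<Union>n\<in>{1..}. B (n - 1))" unfolding david_J_def using david_J_n_eq by (intro SUP_cong) auto
  also have "\<dots> = (\<Union>n. B n)"
  proof (intro equalityI subsetI)
    fix a assume "a \<in> (\<Union>n. B n)"
    then obtain n where "a \<in> B (Suc n - 1)" by auto
    moreover have "Suc n \<in> {1..}" by simp
    ultimately show "a \<in> (\<Union>n\<in>{1..}. B (n - 1))" by blast
  qed auto
  finally show ?thesis .
qed

lemma B_J: "B n \<subseteq> J"
  unfolding J_eq by blast

lemma J_subring: "subring_on J"
proof -
  have two: "\<exists>n. a \<in> B n \<and> b \<in> B n" if ab: "a \<in> J" "b \<in> J" for a b
  proof -
    obtain m n where "a \<in> B m" "b \<in> B n" using ab unfolding J_eq by blast
    then have "a \<in> B (max m n)" "b \<in> B (max m n)" using B_mono[of m "max m n"] B_mono[of n "max m n"] by auto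
    then show ?thesis by blast
  qed
  show ?thesis
  proof (rule subring_onI)
    show "1 \<in> J" using B_subring B_J by blast
    fix a b assume "a \<in> J" "b \<in> J"
    then obtain n where "a \<in> B n" "b \<in> B n" using two by blast
    then show "a + b \<in> J" "a * b \<in> J" using B_subring B_J by blast+
  next
    fix a assume "a \<in> J"
    then obtain n where "a \<in> B n" using two by blast
    then show "- a \<in> J" using B_subring B_J by blast
  qed
qed

lemma x_J: "x \<in> J" and z_J: "z n \<in> J" and k_J: "k \<subseteq> J"
  using B_x B_z B_k B_J by blast+

lemma kz_J: "p \<in> polys_over k \<Longrightarrow> poly p (z n) \<in> J"
  using poly_in_subring[OF J_subring _ z_J] polys_over_mono[OF k_J] by blast

lemma k_noeth: "noeth k" and k_dim: "dim_le k 0" and k_pcp: "primes_contain_prime k"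
  using subfield_dim[OF k kinv] by blast+

lemma B_noeth: "noeth (B n)"
  unfolding B_def by (intro noeth_adjoin1 kx kxz k k_noeth)

lemma B_dim: "dim_le (B n) 3"
  unfolding B_def numeral_3_eq_3 by (intro dim_le_adjoin1 noeth_adjoin1 kx kxz k k_noeth k_dim)

text \<open>Passing from \<open>(x, \<zeta>\<^sub>n, \<zeta>\<^sub>n\<^sub>+\<^sub>1)\<close> to \<open>(x, \<zeta>\<^sub>n\<^sub>+\<^sub>1, \<zeta>\<^sub>n\<^sub>+\<^sub>2)\<close> is an affine change of the last variable over the 
  fraction field of the first two.\<close>

lemma indep: "transc (adjoin1 k x) (z n) \<and> transc (adjoin1 (adjoin1 k x) (z n)) (z (Suc n))"
proof (induction n)
  case 0 then show ?case using alg_independent_3[OF k ind] by simp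
next
  case (Suc n)
  let ?A = "adjoin1 k x"
  have 1: "transc (adjoin1 ?A (z (Suc n))) (z n)" using transc_swap[OF kx] Suc by blast
  have 2: "transc ?A (z (Suc n))" using Suc transc_mono adjoin1_base[OF kx] by blast
  have "transc (adjoin1 ?A (z (Suc n))) (z (Suc (Suc n)))"
  proof (rule transc_affine[OF kxz 1, of x "z (Suc n) ^ s (n + 2)"])
    show "x \<in> adjoin1 ?A (z (Suc n))" by (intro adjoin1_base[OF kx] adjoin1_gen[OF k])
    show "z (Suc n) ^ s (n + 2) \<in> adjoin1 ?A (z (Suc n))" by (intro subring_on_power[OF kxz] adjoin1_gen[OF kx])
    show "x * z (Suc (Suc n)) = z n + z (Suc n) ^ s (n + 2)" using rec'[of n] by simp
  qed (rule x_nz)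
  then show ?case using 2 by blast
qed

lemma transc_x: "transc (adjoin1 (adjoin1 k (z n)) (z (Suc n))) x"
proof -
  have kz: "subring_on (adjoin1 k (z n))" by (intro adjoin1_subring k)
  have 1: "transc k x" using alg_independent_3(1)[OF k ind] .
  have 2: "transc (adjoin1 k (z n)) x" using transc_swap[OF k 1] indep by blast
  have "transc (adjoin1 (adjoin1 k (z n)) x) (z (Suc n))"
    using indep[of n] adjoin1_swap[OF k, of x "z n"] by simp
  then show ?thesis using transc_swap[OF kz 2] by blast
qed

lemma transc_z: "transc k (z n)"
  using indep[of n] transc_mono adjoin1_base[OF k] by blast

lemma B_pcp: "primes_contain_prime (B 0)"
  unfolding B_def using indep[of 0] alg_independent_3(1)[OF k ind]
  by (intro primes_contain_prime_adjoin1 noeth_adjoin1 kx kxz k k_noeth k_pcp) auto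

text \<open>The elements with this property form a subring, which contains every \<open>z n\<close>
  because the recurrence divides by \<open>x\<close> only. So \<open>J\<close> and
  \<open>B 0\<close> agree after inverting \<open>x\<close>.\<close>

lemma J_x_power: "a \<in> J \<Longrightarrow> \<exists>e. x ^ e * a \<in> B 0"
proof -
  let ?S = "{a. \<exists>e. x ^ e * a \<in> B 0}"
  have xe: "x ^ e \<in> B 0" for e using B_x B_subring by blast
  have S: "subring_on ?S"
  proof (rule subring_onI)
    show "1 \<in> ?S" using xe by auto
    fix a b assume "a \<in> ?S" "b \<in> ?S"
    then obtain e f where ef: "x ^ e * a \<in> B 0" "x ^ f * b \<in> B 0" by blast
    have "x ^ f * (x ^ e * a) + x ^ e * (x ^ f * b) \<in> B 0" using ef xe B_subring by blast
    moreover have "x ^ f * (x ^ e * a) + x ^ e * (x ^ f * b) = x ^ (e + f) * (a + b)" by (simp add: power_add algebra_simps)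
    ultimately show "a + b \<in> ?S" by auto
    have "(x ^ e * a) * (x ^ f * b) \<in> B 0" using ef B_subring by blast
    moreover have "(x ^ e * a) * (x ^ f * b) = x ^ (e + f) * (a * b)" by (simp add: power_add algebra_simps)
    ultimately show "a * b \<in> ?S" by auto
  next
    fix a assume "a \<in> ?S"
    then obtain e where "x ^ e * a \<in> B 0" by blast
    then have "- (x ^ e * a) \<in> B 0" using B_subring by blast
    then show "- a \<in> ?S" by (auto intro: exI[of _ e])
  qed
  have base: "B 0 \<subseteq> ?S" by (auto intro: exI[of _ 0])
  have zS: "z n \<in> ?S \<and> z (Suc n) \<in> ?S" for n
  proof (induction n)
    case 0 then show ?case using base B_z[of 0] B_z'[of 0] by blast
  next
    case (Suc n)
    have "z (n + 1) ^ s (n + 2) + z n \<in> ?S" using Suc S by (metis Suc_eq_plus1 subring_on_add subring_on_power)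
    then have "x * z (n + 2) \<in> ?S" using rec'[of n] by simp
    then obtain e where "x ^ e * (x * z (n + 2)) \<in> B 0" by blast
    then have "x ^ Suc e * z (Suc (Suc n)) \<in> B 0" by (simp add: mult.assoc mult.left_commute)
    then show ?case using Suc by blast
  qed
  have "B n \<subseteq> ?S" for n using zS[of n] base B_k[of 0] B_x[of 0] by (intro B_least[OF S]) blast+
  then show "\<exists>e. x ^ e * a \<in> B 0" if "a \<in> J" using that unfolding J_eq by blast
qed

section \<open>Reduction modulo x\<close>

abbreviation "xJ \<equiv> princ J x"

lemma xJ_ideal: "ideal_in xJ J"
  by (rule princ_ideal[OF J_subring x_J])

lemma xJ_memI: "a \<in> J \<Longrightarrow> x * a \<in> xJ"
  unfolding princ_def by (rule image_eqI[of _ _ a]) (auto simp: mult.commute)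

lemma xJ_memE: "a \<in> xJ \<Longrightarrow> \<exists>b\<in>J. a = x * b"
  unfolding princ_def by (auto simp: mult.commute)

text \<open>Modulo \<open>x\<close> the recurrence reads z_m = - z_(m+1)^s(m+2); iteration produces
  the sign \<open>c\<close> and the exponent \<open>N\<close>. The congruence is taken modulo x B_m
  because \<open>kz_xJ\<close> evaluates it in the polynomial ring \<open>B m\<close>.\<close>

lemma z_cong: 
  assumes "n \<le> m" shows "\<exists>c N. N \<ge> 1 \<and> (c = 1 \<or> c = -1) \<and> z n - c * z m ^ N \<in> princ (B m) x"
  using assms
proof (induction m rule: dec_induct)
  case base
  have "z n - 1 * z n ^ 1 = 0 * x" by simp
  then show ?case using B_subring[of n] unfolding princ_def by (intro exI[of _ 1]) auto
next
  case (step m)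
  then obtain c N where c: "N \<ge> 1" "c = 1 \<or> c = -1" "z n - c * z m ^ N \<in> princ (B m) x" by blast
  note S = B_subring[of "Suc m"]
  have id: "ideal_in (princ (B (Suc m)) x) (B (Suc m))" by (rule princ_ideal[OF S B_x])
  have 1: "z n - c * z m ^ N \<in> princ (B (Suc m)) x" using c(3) B_Suc[of m] unfolding princ_def by blast
  let ?w = "- (z (m + 1) ^ s (m + 2))"
  have w: "?w \<in> B (Suc m)" using S B_z[of "Suc m"] by auto
  have zm: "z m \<in> B (Suc m)" using B_z B_Suc by blast
  have "z m - ?w = z (m + 2) * x" using rec'[of m] by (simp add: mult.commute)
  then have "z m - ?w \<in> princ (B (Suc m)) x" using B_z'[of "Suc m"] unfolding princ_def by auto
  then have "poly (Polynomial.monom 1 N) (z m) - poly (Polynomial.monom 1 N) ?w \<in> princ (B (Suc m)) x"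
    using S by (intro ideal_cong_poly[OF S id] polys_over_monom zm w) auto
  then have 2: "z m ^ N - ?w ^ N \<in> princ (B (Suc m)) x" by (simp add: poly_monom)
  have cB: "c \<in> B (Suc m)" using c(2) S by auto
  have "(z n - c * z m ^ N) + c * (z m ^ N - ?w ^ N) \<in> princ (B (Suc m)) x"
    by (intro ideal_in_add[OF id 1] ideal_in_mult[OF id cB 2])
  moreover have "?w ^ N = (-1) ^ N * z (Suc m) ^ (s (m + 2) * N)" 
    by (subst power_minus) (simp add: power_mult)
  ultimately have "z n - (c * (-1) ^ N) * z (Suc m) ^ (s (m + 2) * N) \<in> princ (B (Suc m)) x"
    by (simp add: algebra_simps)
  moreover have "c * (-1) ^ N = 1 \<or> c * (-1) ^ N = -1" using c(2) by (cases "even N") auto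
  moreover have "s (m + 2) * N \<ge> 1" using s_pos'[of m] c(1) by simp
  ultimately show ?case by blast
qed

lemma princ_B_J: "princ (B m) x \<subseteq> xJ"
  unfolding princ_def using B_J by blast

lemma z_cong_poly:
  assumes "n \<le> m"
  obtains c N where "N \<ge> 1" "c = 1 \<or> c = -1" "z n - c * z m ^ N \<in> princ (B m) x"
    "\<And>p. p \<in> polys_over k \<Longrightarrow> pcompose p (Polynomial.monom c N) \<in> polys_over k"
    "\<And>p. p \<in> polys_over k \<Longrightarrow> poly p (z n) - poly (pcompose p (Polynomial.monom c N)) (z m) \<in> princ (B m) x"
proof -
  obtain c N where c: "N \<ge> 1" "c = 1 \<or> c = -1" "z n - c * z m ^ N \<in> princ (B m) x" using z_cong[OF assms] by blast
  have ck: "c \<in> k" using c(2) k by auto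
  have id: "ideal_in (princ (B m) x) (B m)" by (rule princ_ideal[OF B_subring B_x])
  have mk: "Polynomial.monom c N \<in> polys_over k" by (rule polys_over_monom[OF k ck])
  have comp: "pcompose p (Polynomial.monom c N) \<in> polys_over k" if "p \<in> polys_over k" for p
    using that
  proof (induction p)
    case 0 then show ?case using subring_on_polys_over[OF k] by auto
  next
    case (pCons a p)
    have "a \<in> k" using polys_over_coeff[OF pCons.prems, of 0] by simp
    moreover have "p \<in> polys_over k" using polys_over_coeff[OF pCons.prems, of "Suc _"] by (simp add: polys_over_def)
    ultimately show ?case unfolding pcompose_pCons using pCons.IH subring_on_polys_over[OF k] polys_over_const[OF k] mk by blast
  qed
  have zn: "z n \<in> B m" using B_z B_mono[OF assms] by blast
  have zm: "c * z m ^ N \<in> B m" using B_z[of m] ck B_k[of m] B_subring[of m] by blast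
  have "poly p (z n) - poly p (c * z m ^ N) \<in> princ (B m) x" if "p \<in> polys_over k" for p
    by (rule ideal_cong_poly[OF B_subring id _ zn zm c(3)]) (use that polys_over_mono[OF B_k] in blast)
  then show ?thesis using that c comp by (simp add: poly_pcompose poly_monom)
qed

text \<open>Both p(z_n) and its quotient by \<open>x\<close> are moved to a common level
  \<open>m\<close>, where p(z_n) becomes a polynomial in z_m modulo \<open>x\<close>. As
  \<open>B m\<close> is a polynomial ring in \<open>x\<close> over k[z_m, z_(m+1)], a multiple of
  \<open>x\<close> that is free of \<open>x\<close> vanishes.\<close>

lemma kz_xJ:
  assumes p: "p \<in> polys_over k" and xp: "poly p (z n) \<in> xJ" shows "p = 0"
proof -
  obtain b m0 where b: "b \<in> B m0" "poly p (z n) = x * b" using xJ_memE[OF xp] unfolding J_eq by blast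
  define m where "m = max n m0"
  have nm: "n \<le> m" and bm: "b \<in> B m" using b B_mono[of m0 m] by (auto simp: m_def)
  obtain c N where c: "N \<ge> 1" "c = 1 \<or> c = -1" and cp: "pcompose p (Polynomial.monom c N) \<in> polys_over k"
    "poly p (z n) - poly (pcompose p (Polynomial.monom c N)) (z m) \<in> princ (B m) x"
    using z_cong_poly[OF nm] p by metis
  let ?q = "pcompose p (Polynomial.monom c N)"
  have id: "ideal_in (princ (B m) x) (B m)" by (rule princ_ideal[OF B_subring B_x])
  have "poly p (z n) \<in> princ (B m) x" using bm b(2) unfolding princ_def by (auto simp: mult.commute)
  then have "poly ?q (z m) \<in> princ (B m) x" using ideal_in_diff_cancel'[OF B_subring id cp(2)] by blast
  then obtain r where r: "r \<in> B m" "poly ?q (z m) = r * x" unfolding princ_def by blast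
  let ?D = "adjoin1 (adjoin1 k (z m)) (z (Suc m))"
  have kz: "subring_on (adjoin1 k (z m))" and D: "subring_on ?D" by (intro adjoin1_subring k)+
  have "B m = adjoin1 ?D x"
    unfolding B_def using adjoin1_swap[OF k, of x "z m"] adjoin1_swap[OF kz, of x "z (Suc m)"] by simp
  then obtain f where f: "f \<in> polys_over ?D" "r = poly f x" using r(1) unfolding adjoin1_def by blast
  have u: "poly ?q (z m) \<in> ?D" using cp(1) by (intro adjoin1_base[OF kz]) (auto simp: adjoin1_def)
  have "pCons (- poly ?q (z m)) f \<in> polys_over ?D" using f(1) u D by (intro polys_over_pCons) auto
  moreover have "poly (pCons (- poly ?q (z m)) f) x = 0" using r(2) f(2) by (simp add: mult.commute)
  ultimately have "pCons (- poly ?q (z m)) f = 0" using transcD[OF transc_x] by blast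
  then have "poly ?q (z m) = 0" by simp
  then have "?q = 0" using transcD[OF transc_z cp(1)] by blast
  \<comment> \<open>Composition with a polynomial of positive degree is injective; for this reason
    \<open>N \<ge> 1\<close> is recorded in \<open>z_cong\<close>, where it rests on the positivity
    of \<open>s\<close>.\<close>
  moreover have "pdeg (Polynomial.monom c N) > 0" using c by (auto simp: degree_monom_eq)
  ultimately show "p = 0" using pcompose_eq_0[of p "Polynomial.monom c N"] by blast
qed

text \<open>The elements congruent to a polynomial in z_(n+1) form a subring. It contains
  \<open>x\<close>, which goes to 0, and z_n, which goes to - z_(n+1)^s(n+2) with error x
  z_(n+2).\<close>

lemma B_cong: assumes "a \<in> B n" shows "\<exists>p\<in>polys_over k. a - poly p (z (Suc n)) \<in> xJ"
proof -
  note id = xJ_ideal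
  let ?S = "{a\<in>J. \<exists>p\<in>polys_over k. a - poly p (z (Suc n)) \<in> xJ}"
  note Sk = subring_on_polys_over[OF k]
  have "subring_on ?S"
  proof (rule subring_onI)
    show "1 \<in> ?S" using J_subring Sk ideal_in_0[OF id] by (auto intro!: bexI[of _ 1])
    fix a b assume "a \<in> ?S" "b \<in> ?S"
    then obtain p q where *: "a \<in> J" "b \<in> J" "p \<in> polys_over k" "q \<in> polys_over k" 
       "a - poly p (z (Suc n)) \<in> xJ" "b - poly q (z (Suc n)) \<in> xJ" by blast
    have "(a - poly p (z (Suc n))) + (b - poly q (z (Suc n))) \<in> xJ" by (rule ideal_in_add[OF id *(5,6)])
    then have "a + b - poly (p + q) (z (Suc n)) \<in> xJ" by (simp add: algebra_simps)
    then show "a + b \<in> ?S" using * J_subring Sk by blast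
    have "b * (a - poly p (z (Suc n))) + poly p (z (Suc n)) * (b - poly q (z (Suc n))) \<in> xJ" 
      using * kz_J by (intro ideal_in_add[OF id] ideal_in_mult[OF id]) auto
    then have "a * b - poly (p * q) (z (Suc n)) \<in> xJ" by (simp add: algebra_simps)
    then show "a * b \<in> ?S" using * J_subring Sk by blast
  next
    fix a assume "a \<in> ?S"
    then obtain p where *: "a \<in> J" "p \<in> polys_over k" "a - poly p (z (Suc n)) \<in> xJ" by blast
    have "- (a - poly p (z (Suc n))) \<in> xJ" by (rule ideal_in_uminus[OF J_subring id *(3)])
    then have "- a - poly (- p) (z (Suc n)) \<in> xJ" by simp
    then show "- a \<in> ?S" using * J_subring Sk by blast
  qed
  moreover have "k \<subseteq> ?S"
  proof
    fix a assume a: "a \<in> k"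
    then show "a \<in> ?S" using k_J polys_over_const[OF k a] ideal_in_0[OF id] by (auto intro!: bexI[of _ "[:a:]"])
  qed
  moreover have "x \<in> ?S" using x_J Sk princ_self[OF J_subring] by (auto intro!: bexI[of _ 0])
  moreover have "z (Suc n) \<in> ?S" 
  proof -
    have "[:0,1:] \<in> polys_over k" using k by (intro polys_over_pCons polys_over_const) auto
    moreover have "z (Suc n) - poly [:0,1:] (z (Suc n)) \<in> xJ" using ideal_in_0[OF id] by simp
    ultimately show ?thesis using z_J by blast
  qed
  moreover have "z n \<in> ?S"
  proof -
    let ?p = "Polynomial.monom (-1) (s (n + 2)) :: 'a poly"
    have "?p \<in> polys_over k" using k by (intro polys_over_monom) auto
    moreover have "z n - poly ?p (z (Suc n)) = x * z (n + 2)" using rec'[of n] by (simp add: poly_monom)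
    then have "z n - poly ?p (z (Suc n)) \<in> xJ" using xJ_memI[OF z_J] by metis
    ultimately show ?thesis using z_J by blast
  qed
  ultimately have "B n \<subseteq> ?S" by (intro B_least)
  then show ?thesis using assms by blast
qed

lemma J_cong: assumes "a \<in> J" shows "\<exists>n\<ge>m. \<exists>p\<in>polys_over k. a - poly p (z n) \<in> xJ"
proof -
  obtain n where "a \<in> B n" using assms unfolding J_eq by blast
  then have "a \<in> B (max n m)" using B_mono[of n "max n m"] by auto
  then show ?thesis using B_cong[of a "max n m"] by (intro exI[of _ "Suc (max n m)"]) auto
qed

lemma xJ_prime: "prime_in xJ J"
  unfolding prime_in_def
proof (intro conjI ballI impI)
  show "ideal_in xJ J" by (rule xJ_ideal)
  show "1 \<notin> xJ"
  proof
    assume "1 \<in> xJ"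
    then have "poly 1 (z 0) \<in> xJ" by simp
    moreover have "(1::'a poly) \<in> polys_over k" using subring_on_polys_over[OF k] by blast
    ultimately have "(1::'a poly) = 0" by (intro kz_xJ)
    then show False by simp
  qed
  fix a b assume a: "a \<in> J" and b: "b \<in> J" and ab: "a * b \<in> xJ"
  obtain n0 where "a \<in> B n0" using a unfolding J_eq by blast
  moreover obtain n1 where "b \<in> B n1" using b unfolding J_eq by blast
  ultimately have "a \<in> B (max n0 n1)" "b \<in> B (max n0 n1)" using B_mono[of n0 "max n0 n1"] B_mono[of n1 "max n0 n1"] by auto
  then obtain p q where p: "p \<in> polys_over k" "a - poly p (z (Suc (max n0 n1))) \<in> xJ" 
    and q: "q \<in> polys_over k" "b - poly q (z (Suc (max n0 n1))) \<in> xJ" using B_cong by meson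
  let ?z = "z (Suc (max n0 n1))"
  have pq: "p * q \<in> polys_over k" using p q subring_on_polys_over[OF k] by blast
  have "b * (a - poly p ?z) + poly p ?z * (b - poly q ?z) \<in> xJ" 
    using a b p q kz_J by (intro ideal_in_add[OF xJ_ideal] ideal_in_mult[OF xJ_ideal]) auto
  then have "a * b - poly (p * q) ?z \<in> xJ" by (simp add: algebra_simps)
  then have "poly (p * q) ?z \<in> xJ" using ideal_in_diff_cancel'[OF J_subring xJ_ideal] ab by blast
  then have "p = 0 \<or> q = 0" using kz_xJ[OF pq] by auto
  then show "a \<in> xJ \<or> b \<in> xJ" using p q by auto
qed

section \<open>Divisibility by all powers of x\<close>

definition Xinf :: "'a set" where
  "Xinf = {a\<in>J. \<forall>e. \<exists>b\<in>J. a = x ^ e * b}"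

lemma x_factor:
  assumes a: "a \<in> J" "a \<notin> Xinf"
  obtains e b where "a = x ^ e * b" "b \<in> J" "b \<notin> xJ"
proof -
  have "\<exists>e. \<not> (\<exists>b\<in>J. a = x ^ e * b)" using a by (auto simp: Xinf_def)
  define e where "e = (LEAST e. \<not> (\<exists>b\<in>J. a = x ^ e * b))"
  have e: "\<not> (\<exists>b\<in>J. a = x ^ e * b)" unfolding e_def by (rule LeastI_ex) fact
  then have "e \<noteq> 0" using a(1) by (metis mult_1 power_0)
  then obtain f where f: "e = Suc f" by (cases e) auto
  then have "\<exists>b\<in>J. a = x ^ f * b" using not_less_Least[of f "\<lambda>e. \<not> (\<exists>b\<in>J. a = x ^ e * b)"] by (auto simp: e_def)
  then obtain b where b: "b \<in> J" "a = x ^ f * b" by blast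
  have "b \<notin> xJ"
  proof
    assume "b \<in> xJ"
    then obtain c where "c \<in> J" "b = x * c" using xJ_memE by blast
    then have "c \<in> J" "a = x ^ e * c" using b(2) f by (auto simp: mult.assoc mult.left_commute)
    then show False using e by blast
  qed
  then show ?thesis using that b by blast
qed

lemma Xinf_ideal: "ideal_in Xinf J"
  unfolding ideal_in_def
proof (intro conjI ballI)
  show "Xinf \<subseteq> J" by (auto simp: Xinf_def)
  show "0 \<in> Xinf" using J_subring by (auto simp: Xinf_def intro!: bexI[of _ 0])
  fix a b assume ab: "a \<in> Xinf" "b \<in> Xinf"
  have "\<exists>c\<in>J. a + b = x ^ e * c" for e
  proof -
    obtain c d where "c \<in> J" "d \<in> J" "a = x ^ e * c" "b = x ^ e * d" using ab unfolding Xinf_def by blast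
    then show ?thesis using J_subring by (intro bexI[of _ "c + d"]) (auto simp: distrib_left)
  qed
  then show "a + b \<in> Xinf" using ab J_subring by (auto simp: Xinf_def)
next
  fix r a assume r: "r \<in> J" and a: "a \<in> Xinf"
  have "\<exists>c\<in>J. r * a = x ^ e * c" for e
  proof -
    obtain c where "c \<in> J" "a = x ^ e * c" using a unfolding Xinf_def by blast
    then show ?thesis using J_subring r by (intro bexI[of _ "r * c"]) auto
  qed
  then show "r * a \<in> Xinf" using a r J_subring by (auto simp: Xinf_def)
qed

lemma Xinf_xJ: "Xinf \<subseteq> xJ"
proof
  fix a assume "a \<in> Xinf"
  then obtain b where "b \<in> J" "a = x ^ 1 * b" unfolding Xinf_def by blast
  then show "a \<in> xJ" using xJ_memI by simp
qed

lemma x_Xinf: "x \<notin> Xinf"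
proof
  assume "x \<in> Xinf"
  then obtain b where "b \<in> J" "x = x ^ 2 * b" unfolding Xinf_def by blast
  then have "1 = x * b" using x_nz by (simp add: power2_eq_square)
  then have "1 \<in> xJ" using xJ_memI[OF \<open>b \<in> J\<close>] by simp
  then show False using prime_in_1[OF xJ_prime] by blast
qed

text \<open>Outside \<open>Xinf\<close> every element has a finite x-adic order by
  \<open>x_factor\<close>, and orders add because \<open>xJ\<close> is prime.\<close>

lemma Xinf_prime: "prime_in Xinf J"
  unfolding prime_in_def
proof (intro conjI ballI impI)
  show "ideal_in Xinf J" by (rule Xinf_ideal)
  show "1 \<notin> Xinf" using Xinf_xJ prime_in_1[OF xJ_prime] by blast
  fix a b assume ab: "a \<in> J" "b \<in> J" "a * b \<in> Xinf"
  show "a \<in> Xinf \<or> b \<in> Xinf"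
  proof (rule ccontr)
    assume "\<not> ?thesis"
    then obtain e a' f b' where *: "a = x ^ e * a'" "a' \<in> J" "a' \<notin> xJ" "b = x ^ f * b'" "b' \<in> J" "b' \<notin> xJ"
      using x_factor ab by metis
    obtain c where c: "c \<in> J" "a * b = x ^ Suc (e + f) * c" using ab(3) unfolding Xinf_def by blast
    have "a * b = x ^ (e + f) * (a' * b')" using * by (simp add: power_add)
    then have "a' * b' = x * c" using c(2) x_nz by (simp add: mult.assoc)
    then have "a' * b' \<in> xJ" using xJ_memI[OF c(1)] by simp
    then show False using prime_in_mult[OF xJ_prime] * by blast
  qed
qed

text \<open>The prime of \<open>J\<close> that corresponds to a prime \<open>q\<close> of
  \<open>B 0\<close> without \<open>x\<close>, as both rings agree after inverting \<open>x\<close>.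
  It transports explicit primes of the polynomial ring \<open>B 0\<close> to
  \<open>J\<close>.\<close>

definition extend :: "'a set \<Rightarrow> 'a set" where
  "extend q = {a\<in>J. \<exists>e. x ^ e * a \<in> q}"

lemma extend_prime:
  assumes q: "prime_in q (B 0)" "x \<notin> q"
  shows "prime_in (extend q) J" "extend q \<inter> B 0 = q"
proof -
  note id = prime_in_ideal[OF q(1)]
  have xe: "x ^ e \<in> B 0" for e using B_x B_subring by blast
  have xq: "x ^ e \<notin> q" for e using prime_in_power[OF q(1) B_subring B_x] q(2) by blast
  show ext: "extend q \<inter> B 0 = q"
  proof (intro equalityI subsetI)
    fix a assume "a \<in> extend q \<inter> B 0"
    then show "a \<in> q" using prime_in_mult[OF q(1) xe] xq unfolding extend_def by blast
  next
    fix a assume a: "a \<in> q"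
    then have "a \<in> B 0" using ideal_in_sub[OF id] by blast
    moreover have "x ^ 0 * a \<in> q" using a by simp
    ultimately show "a \<in> extend q \<inter> B 0" using B_J unfolding extend_def by blast
  qed
  show "prime_in (extend q) J"
    unfolding prime_in_def ideal_in_def
  proof (intro conjI ballI impI)
    show "extend q \<subseteq> J" by (auto simp: extend_def)
    show "0 \<in> extend q" using J_subring ideal_in_0[OF id] by (auto simp: extend_def)
    show "1 \<notin> extend q" using xq by (auto simp: extend_def)
  next
    fix a b assume "a \<in> extend q" "b \<in> extend q"
    then obtain e f where *: "a \<in> J" "b \<in> J" "x ^ e * a \<in> q" "x ^ f * b \<in> q" unfolding extend_def by blast
    have "x ^ f * (x ^ e * a) + x ^ e * (x ^ f * b) \<in> q" 
      by (intro ideal_in_add[OF id] ideal_in_mult[OF id xe] *)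
    then have "x ^ (e + f) * (a + b) \<in> q" by (simp add: power_add algebra_simps)
    then show "a + b \<in> extend q" using * J_subring unfolding extend_def by blast
  next
    fix r a assume "r \<in> J" "a \<in> extend q"
    then obtain e f where *: "r \<in> J" "a \<in> J" "x ^ e * a \<in> q" "x ^ f * r \<in> B 0" using J_x_power unfolding extend_def by blast
    have "(x ^ f * r) * (x ^ e * a) \<in> q" by (rule ideal_in_mult[OF id *(4,3)])
    then have "x ^ (e + f) * (r * a) \<in> q" by (simp add: power_add algebra_simps)
    then show "r * a \<in> extend q" using * J_subring unfolding extend_def by blast
  next
    fix a b assume ab: "a \<in> J" "b \<in> J" "a * b \<in> extend q"
    then obtain e f g where *: "x ^ e * a \<in> B 0" "x ^ f * b \<in> B 0" "x ^ g * (a * b) \<in> q" 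
      using J_x_power unfolding extend_def by blast
    have "(x ^ (e + f)) * (x ^ g * (a * b)) \<in> q" by (rule ideal_in_mult[OF id xe *(3)])
    then have "x ^ g * ((x ^ e * a) * (x ^ f * b)) \<in> q" by (simp add: power_add algebra_simps)
    then have "(x ^ e * a) * (x ^ f * b) \<in> q" using prime_in_mult[OF q(1) xe] xq * B_subring by blast
    then have "x ^ e * a \<in> q \<or> x ^ f * b \<in> q" using prime_in_mult[OF q(1)] * by blast
    then show "a \<in> extend q \<or> b \<in> extend q" using ab unfolding extend_def by blast
  qed
qed

end

section \<open>Localizations at primes without x and at xJ\<close>

lemma dim_le_mpolys_0: "subring_on D \<Longrightarrow> dim_le (mpolys D 0) d \<longleftrightarrow> dim_le D d"
  using dim_le_iso[OF hom_on_mconst _ inj_on_mconst] by (simp add: mpolys_0)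

text \<open>\<open>U\<close> is p[y], and \<open>V\<close> adds \<open>y\<close> to it. Iterating
  this gives the primes (z_0) and (z_0, z_1) for \<open>chain3_z\<close>; the last clause controls
  the contraction.\<close>

lemma adjoin1_prime_pair:
  assumes A: "subring_on A" and y: "transc A y" and p: "prime_in p A"
  obtains U V where "prime_in U (adjoin1 A y)" "prime_in V (adjoin1 A y)" "p \<subseteq> U" "U \<subseteq> V" 
    "y \<in> V" "y \<notin> U" "V \<inter> A \<subseteq> p"
proof -
  note id = prime_in_ideal[OF p] and SA = subring_on_polys_over[OF A]
  let ?f = "\<lambda>f. poly f y"
  let ?V = "{f\<in>polys_over A. poly f 0 \<in> p}"
  have inj: "inj_on ?f (polys_over A)" by (rule transc_inj[OF A y])
  have pA: "polys_over p \<subseteq> polys_over A" using polys_over_mono ideal_in_sub[OF id] by blast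
  have lin: "[:0,1:] \<in> polys_over A" using A by (intro polys_over_pCons polys_over_const) auto
  have "prime_in (?f ` polys_over p) (adjoin1 A y)" unfolding adjoin1_def
    by (rule prime_image[OF hom_on_eval inj SA prime_polys_over[OF A p]])
  moreover have "prime_in ?V (polys_over A)"
    using contract_prime[OF hom_on_eval SA _ p, of 0] A by (auto simp: poly_0_coeff_0 polys_over_def)
  then have "prime_in (?f ` ?V) (adjoin1 A y)" unfolding adjoin1_def
    by (rule prime_image[OF hom_on_eval inj SA])
  moreover have "p \<subseteq> ?f ` polys_over p"
  proof
    fix a assume "a \<in> p"
    then have "[:a:] \<in> polys_over p" using ideal_in_0[OF id] by (auto simp: polys_over_def coeff_pCons split: nat.split)
    then show "a \<in> ?f ` polys_over p" by (intro image_eqI[of _ _ "[:a:]"]) auto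
  qed
  moreover have "?f ` polys_over p \<subseteq> ?f ` ?V" 
    by (rule image_mono) (use pA in \<open>auto simp: poly_0_coeff_0 polys_over_def\<close>)
  moreover have "y \<in> ?f ` ?V" using lin ideal_in_0[OF id] by (intro image_eqI[of _ _ "[:0,1:]"]) auto
  moreover have "y \<notin> ?f ` polys_over p"
  proof
    assume "y \<in> ?f ` polys_over p"
    then obtain f where f: "f \<in> polys_over p" "poly f y = poly [:0,1:] y" by auto
    then have "f = [:0,1:]" using inj_onD[OF inj f(2)] pA lin by blast
    then have "1 \<in> p" using polys_over_coeff[OF f(1), of 1] by simp
    then show False using prime_in_1[OF p] by blast
  qed
  moreover have "?f ` ?V \<inter> A \<subseteq> p"
  proof
    fix a assume "a \<in> ?f ` ?V \<inter> A"
    then obtain f where f: "f \<in> ?V" "poly f y = poly [:a:] y" "a \<in> A" by auto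
    then have "f = [:a:]" using inj_onD[OF inj f(2)] polys_over_const[OF A] by blast
    then show "a \<in> p" using f(1) by simp
  qed
  ultimately show ?thesis using that by blast
qed

lemma ideal_hull_memI: "subring_on A \<Longrightarrow> F \<subseteq> A \<Longrightarrow> r \<in> A \<Longrightarrow> f \<in> F \<Longrightarrow> r * f \<in> ideal_hull A F"
  using ideal_in_mult[OF ideal_hull_ideal] ideal_hull_incl by blast

context david
begin

lemma prime_loc: "prime_in P J \<Longrightarrow> prime_localization J P"
  by (simp add: prime_localization_def J_subring)

lemma loc_dim_le: 
  assumes P: "prime_in P J" shows "dim_le (mpolys (localization_at J P) n) (n + 3)"
proof -
  interpret prime_localization J P by (rule prime_loc[OF P])
  show ?thesis
  proof (rule dim_le_mpolys_directed[OF B_subring])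
    show "B i \<subseteq> R" for i using B_J loc_base by blast
    show "\<exists>i. \<forall>j\<ge>i. a \<in> B j" if "a \<in> J" for a using that B_mono unfolding J_eq by blast
    show "dim_le (mpolys (B i) n) (n + 3)" for i using noeth_dim_mpolys[OF B_subring B_noeth B_dim] by blast
  qed
qed

lemma jaffard_if_noeth:
  assumes P: "prime_in P J" and N: "noeth (localization_at J P)" shows "jaffard_domain (localization_at J P)"
proof -
  interpret prime_localization J P by (rule prime_loc[OF P])
  have "dim_le R 3" using loc_dim_le[OF P, of 0] dim_le_mpolys_0[OF loc_subring] by simp
  then show ?thesis by (rule jaffard_domain_noeth[OF loc_subring N])
qed

text \<open>Height at least 3, and then exactly 3 in view of \<open>loc_dim_le\<close>.\<close>

definition chain3 :: "'a set \<Rightarrow> bool" where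
  "chain3 P \<longleftrightarrow> (\<exists>Q. prime_chain J 3 Q \<and> Q 3 = P)"

lemma chain3I:
  assumes "prime_in A0 J" "prime_in A1 J" "prime_in A2 J" "prime_in P J" "A0 \<subset> A1" "A1 \<subset> A2" "A2 \<subset> P"
  shows "chain3 P"
  unfolding chain3_def
  by (rule exI[of _ "\<lambda>i. if i = 0 then A0 else if i = 1 then A1 else if i = 2 then A2 else P"])
    (use assms in \<open>auto simp: prime_chain_def less_Suc_eq numeral_3_eq_3 numeral_2_eq_2\<close>)

lemma jaffard_if_chain3:
  assumes P: "prime_in P J" and ch: "chain3 P" shows "jaffard_domain (localization_at J P)"
proof -
  interpret prime_localization J P by (rule prime_loc[OF P])
  have "has_chain R 3" using ch loc_chain unfolding chain3_def by blast
  moreover have "dim_le R 3" using loc_dim_le[OF P, of 0] dim_le_mpolys_0[OF loc_subring] by simp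
  ultimately show ?thesis using jaffard_domainI[OF loc_subring] loc_dim_le[OF P] by blast
qed

lemma jaffard_x_notin:
  assumes P: "prime_in P J" and xP: "x \<notin> P" shows "jaffard_domain (localization_at J P)"
proof -
  let ?p = "{a\<in>B 0. a \<in> P}"
  have p: "prime_in ?p (B 0)" by (rule contract_prime[OF hom_on_id B_subring _ P]) (use B_J in auto)
  have xe: "x ^ e \<in> B 0 \<and> x ^ e \<notin> P" for e 
    using B_x B_subring prime_in_power[OF P J_subring x_J] xP by blast
  interpret L: prime_localization "B 0" ?p by (simp add: prime_localization_def B_subring p)
  have "localization_at J P = localization_at (B 0) ?p"
  proof (intro equalityI subsetI)
    fix u assume "u \<in> localization_at J P"
    then obtain a b where ab: "u = a / b" "a \<in> J" "b \<in> J" "b \<notin> P" unfolding localization_at_def by blast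
    obtain e f where ef: "x ^ e * a \<in> B 0" "x ^ f * b \<in> B 0" using J_x_power ab by meson
    have "u = (x ^ f * (x ^ e * a)) / (x ^ e * (x ^ f * b))" using ab x_nz by simp
    moreover have "x ^ f * (x ^ e * a) \<in> B 0" "x ^ e * (x ^ f * b) \<in> B 0" using xe ef B_subring by blast+
    moreover have "x ^ e * (x ^ f * b) \<notin> P"
      using prime_in_mult[OF P, of "x ^ e" "x ^ f * b"] prime_in_mult[OF P, of "x ^ f" b] xe ab ef(2) B_J by blast
    ultimately show "u \<in> localization_at (B 0) ?p" unfolding localization_at_def by blast
  next
    fix u assume "u \<in> localization_at (B 0) ?p"
    then obtain a b where "u = a / b" "a \<in> B 0" "b \<in> B 0 - ?p" unfolding localization_at_def by blast
    then show "u \<in> localization_at J P" using B_J unfolding localization_at_def by blast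
  qed
  then show ?thesis using jaffard_if_noeth[OF P] L.noeth_loc[OF B_noeth] by simp
qed

text \<open>A prime inside \<open>xJ\<close> is 0 or \<open>xJ\<close>: if it omits \<open>x\<close>
  and contains x^e b with \<open>b\<close> outside \<open>xJ\<close>, then it contains
  \<open>b\<close>, which is impossible.\<close>

lemma jaffard_xJ_dvr:
  assumes X0: "Xinf = {0}" shows "jaffard_domain (localization_at J xJ)"
proof -
  interpret prime_localization J xJ by (rule prime_loc[OF xJ_prime])
  have "noeth R"
  proof (rule noeth_locI)
    fix q assume q: "prime_in q J" "q \<subseteq> xJ"
    note id = prime_in_ideal[OF q(1)]
    show "\<exists>F. finite F \<and> F \<subseteq> q \<and> (\<forall>a\<in>q. \<exists>w\<in>J - xJ. w * a \<in> ideal_hull J F)"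
    proof (cases "x \<in> q")
      case True
      have "1 * a \<in> ideal_hull J {x}" if "a \<in> q" for a
      proof -
        have "a \<in> xJ" using that q(2) by blast
        then obtain b where "b \<in> J" "a = b * x" unfolding princ_def by blast
        then show ?thesis using ideal_hull_memI[OF J_subring, of "{x}"] x_J by simp
      qed
      then show ?thesis using True denom_1 by (intro exI[of _ "{x}"]) blast
    next
      case False
      have zero: "a = 0" if a: "a \<in> q" for a
      proof (rule ccontr)
        assume "a \<noteq> 0"
        then have "a \<notin> Xinf" "a \<in> J" using X0 a ideal_in_sub[OF id] by auto
        then obtain e b where b: "a = x ^ e * b" "b \<in> J" "b \<notin> xJ" using x_factor by blast
        have "x ^ e \<notin> q" using prime_in_power[OF q(1) J_subring x_J] False by blast
        then have "b \<in> q" using prime_in_mult[OF q(1), of "x ^ e" b] a b x_J J_subring by blast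
        then show False using b q(2) by blast
      qed
      have "0 \<in> ideal_hull J {}" using ideal_in_0[OF ideal_hull_ideal[OF J_subring]] by blast
      then have "1 * a \<in> ideal_hull J {}" if "a \<in> q" for a using zero[OF that] by simp
      then show ?thesis using denom_1 by (intro exI[of _ "{}"]) blast
    qed
  qed
  then show ?thesis by (rule jaffard_if_noeth[OF xJ_prime])
qed

text \<open>Here \<open>xJ\<close> has height 2. Nonzero polynomials in \<open>\<zeta>\<^sub>i\<close> over \<open>k\<close> are units of the localization, so it is the 
  directed union of localizations of the rings \<open>k(\<zeta>\<^sub>i\<^sub>+\<^sub>1)[x, \<zeta>\<^sub>i]\<close> of dimension 2.\<close>

lemma jaffard_xJ_height2:
  assumes X0: "Xinf \<noteq> {0}" shows "jaffard_domain (localization_at J xJ)"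
proof -
  interpret prime_localization J xJ by (rule prime_loc[OF xJ_prime])
  define Fr where "Fr i = localization_at (adjoin1 k (z i)) {0}" for i
  have kz: "subring_on (adjoin1 k (z i))" for i by (rule adjoin1_subring[OF k])
  have L: "prime_localization (adjoin1 k (z i)) {0}" for i
    by (simp add: prime_localization_def kz prime_in_zero)
  have Fr: "subring_on (Fr i)" for i unfolding Fr_def by (rule prime_localization.loc_subring[OF L])
  have Frinv: "inverse a \<in> Fr i" if a: "a \<in> Fr i" for a i
  proof (cases "a = 0")
    case False
    obtain b c where bc: "a = b / c" "b \<in> adjoin1 k (z i)" "c \<in> adjoin1 k (z i) - {0}" 
      using a unfolding Fr_def localization_at_def by blast
    then have "inverse a = c / b" "b \<in> adjoin1 k (z i) - {0}" using False by auto
    then show ?thesis unfolding Fr_def using bc prime_localization.locI[OF L] by auto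
  qed (use a in simp)
  \<comment> \<open>By \<open>kz_xJ\<close> a nonzero polynomial in z_i lies outside
    \<open>xJ\<close> and is a unit of \<open>R\<close>, so the field k(z_i) embeds in
    \<open>R\<close>.\<close>
  have kzR: "a \<in> J \<and> (a \<noteq> 0 \<longrightarrow> a \<notin> xJ)" if "a \<in> adjoin1 k (z i)" for a i
  proof -
    obtain p where p: "p \<in> polys_over k" "a = poly p (z i)" using \<open>a \<in> adjoin1 k (z i)\<close> unfolding adjoin1_def by blast
    have "a = 0" if "a \<in> xJ"
    proof -
      have "p = 0" using kz_xJ[OF p(1), of i] that p(2) by blast
      then show ?thesis using p(2) by simp
    qed
    moreover have "a \<in> J" unfolding p(2) by (rule kz_J[OF p(1)])
    ultimately show ?thesis by blast
  qed
  have FrR: "Fr i \<subseteq> R" for i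
  proof
    fix u assume "u \<in> Fr i"
    then obtain b c where "u = b / c" "b \<in> adjoin1 k (z i)" "c \<in> adjoin1 k (z i) - {0}" 
      unfolding Fr_def localization_at_def by blast
    then show "u \<in> R" using locI kzR by auto
  qed
  define C where "C i = adjoin1 (adjoin1 (Fr (Suc i)) x) (z i)" for i
  have C: "subring_on (C i)" for i unfolding C_def by (intro adjoin1_subring Fr)
  have FrC: "Fr (Suc i) \<subseteq> C i" for i unfolding C_def using adjoin1_base[OF Fr] adjoin1_base[OF adjoin1_subring[OF Fr]] by blast
  have kzFr: "adjoin1 k (z i) \<subseteq> Fr i" for i unfolding Fr_def by (rule prime_localization.loc_base[OF L])
  have BC: "B i \<subseteq> C i" for i
  proof (rule B_least[OF C])
    show "k \<subseteq> C i" using adjoin1_base[OF k] kzFr[of "Suc i"] FrC[of i] by blast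
    show "z (Suc i) \<in> C i" using adjoin1_gen[OF k] kzFr[of "Suc i"] FrC[of i] by blast
    show "x \<in> C i" unfolding C_def by (intro adjoin1_base[OF adjoin1_subring[OF Fr]] adjoin1_gen[OF Fr])
    show "z i \<in> C i" unfolding C_def by (intro adjoin1_gen[OF adjoin1_subring[OF Fr]])
  qed
  have Fd: "noeth (Fr i)" "dim_le (Fr i) 0" for i using subfield_dim[OF Fr Frinv] by blast+
  have Cd: "noeth (C i)" "dim_le (C i) 2" for i
    unfolding C_def numeral_2_eq_2 by (intro dim_le_adjoin1 noeth_adjoin1 adjoin1_subring Fr Fd)+
  have bd: "dim_le (mpolys R n) (n + 2)" for n
  proof (rule dim_le_mpolys_directed[OF C])
    show "C i \<subseteq> R" for i unfolding C_def using FrR x_J z_J loc_base by (intro adjoin1_least loc_subring) auto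
    show "\<exists>i. \<forall>j\<ge>i. a \<in> C j" if "a \<in> J" for a using that B_mono BC unfolding J_eq by blast
    show "dim_le (mpolys (C i) n) (n + 2)" for i using noeth_dim_mpolys[OF C Cd] by blast
  qed
  have "prime_chain J 2 (\<lambda>i. if i = 0 then {0} else if i = 1 then Xinf else xJ)"
    using prime_in_zero[OF J_subring] Xinf_prime xJ_prime X0 ideal_in_0[OF Xinf_ideal] Xinf_xJ x_Xinf princ_self[OF J_subring, of x]
    by (auto simp: prime_chain_def less_Suc_eq numeral_2_eq_2)
  then have "has_chain R 2" by (rule loc_chain) simp
  moreover have "dim_le R 2" using bd[of 0] dim_le_mpolys_0[OF loc_subring] by (simp only: add_0_left)
  ultimately show ?thesis using jaffard_domainI[OF loc_subring] bd by blast
qed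

text \<open>Once \<open>P\<close> contains \<open>x\<close> and one z_m, the recurrence read in both
  directions puts every z_n into \<open>P\<close>. The chain consists of 0, the extensions of (z_0)
  and (z_0, z_1) from \<open>B 0\<close>, and \<open>P\<close>. The last inclusion is the delicate
  one, since the extension may contain elements outside \<open>B 0\<close>.\<close>

lemma chain3_z:
  assumes P: "prime_in P J" and xP: "x \<in> P" and zP: "z m \<in> P" shows "chain3 P"
proof -
  note idP = prime_in_ideal[OF P]
  have step: "z n \<in> P \<longleftrightarrow> z (Suc n) \<in> P" for n
  proof
    assume zn: "z n \<in> P"
    have "z (Suc n) ^ s (n + 2) = z (n + 2) * x - z n" using rec'[of n] by (simp add: mult.commute)
    also have "\<dots> \<in> P" using zn xP z_J by (intro ideal_in_diff[OF J_subring idP] ideal_in_mult[OF idP])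
    finally show "z (Suc n) \<in> P" by (rule prime_in_power[OF P J_subring z_J])
  next
    assume zn: "z (Suc n) \<in> P"
    obtain t where t: "s (n + 2) = Suc t" using s_pos'[of n] gr0_implies_Suc by blast
    have "z n = z (n + 2) * x - z (Suc n) ^ t * z (Suc n)" using rec'[of n] t by (simp add: mult.commute)
    also have "\<dots> \<in> P" using zn xP z_J J_subring by (intro ideal_in_diff[OF J_subring idP] ideal_in_mult[OF idP]) auto
    finally show "z n \<in> P" .
  qed
  have z0: "z 0 \<in> P" using zP by (induction m) (use step in auto)
  have zall: "z n \<in> P" for n using z0 by (induction n) (use step in auto)
  let ?A = "adjoin1 k x"
  obtain V0 where V0: "prime_in V0 (adjoin1 ?A (z 0))" "z 0 \<in> V0" "V0 \<inter> ?A \<subseteq> {0}"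
    using adjoin1_prime_pair[OF kx _ prime_in_zero[OF kx], of "z 0"] indep[of 0] by metis
  obtain U V where UV: "prime_in U (B 0)" "prime_in V (B 0)" "V0 \<subseteq> U" "U \<subseteq> V" "z 1 \<in> V" "z 1 \<notin> U" 
    "V \<inter> adjoin1 ?A (z 0) \<subseteq> V0"
    using adjoin1_prime_pair[OF kxz _ V0(1), of "z 1"] indep[of 0] unfolding B_def by (metis One_nat_def)
  have VA: "V \<inter> ?A \<subseteq> {0}" using UV(7) V0(3) adjoin1_base[OF kx] by blast
  have xV: "x \<notin> V" using VA x_nz adjoin1_gen[OF k] by blast
  then have xU: "x \<notin> U" using UV by blast
  have mem: "a \<in> extend q" if "a \<in> q" "q \<subseteq> B 0" for a q
  proof -
    have "x ^ 0 * a \<in> q" using that by simp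
    then show ?thesis using that B_J unfolding extend_def by blast
  qed
  have UB: "U \<subseteq> B 0" "V \<subseteq> B 0" using ideal_in_sub prime_in_ideal UV(1,2) by blast+
  have zU: "z 0 \<in> extend U" using mem[OF _ UB(1)] UV V0 by blast
  have z1V: "z 1 \<in> extend V" using mem[OF _ UB(2)] UV by blast
  have z1U: "z 1 \<notin> extend U" using extend_prime(2)[OF UV(1) xU] UV(6) B_z'[of 0] by auto
  have xeV: "x \<notin> extend V" using extend_prime(2)[OF UV(2) xV] xV B_x by blast
  note EV = extend_prime(1)[OF UV(2) xV] and EU = extend_prime(1)[OF UV(1) xU]
  note idV = prime_in_ideal[OF EV]
  \<comment> \<open>x z_(n+2) lies in the extended prime and \<open>x\<close> does not, so this
    prime contains all z_n and not just the first two.\<close>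
  have zV: "z n \<in> extend V \<and> z (Suc n) \<in> extend V" for n
  proof (induction n)
    case 0 then show ?case using z1V mem[OF _ UB(2)] UV V0 by auto
  next
    case (Suc n)
    obtain t where t: "s (n + 2) = Suc t" using s_pos'[of n] gr0_implies_Suc by blast
    have "x * z (Suc (Suc n)) = z (Suc n) ^ t * z (Suc n) + z n" using rec'[of n] t by (simp add: mult.commute)
    also have "\<dots> \<in> extend V" using Suc z_J J_subring by (intro ideal_in_add[OF idV] ideal_in_mult[OF idV]) auto
    finally have "z (Suc (Suc n)) \<in> extend V" using prime_in_mult[OF EV x_J z_J] xeV by blast
    then show ?case using Suc by blast
  qed
  have "extend V \<subseteq> P"
  proof
    fix a assume aV: "a \<in> extend V"
    \<comment> \<open>Both \<open>extend V\<close> and \<open>P\<close> contain all z_n, so modulo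
      their intersection every element of \<open>J\<close> is represented by some \<open>h\<close>
      in k[x]. For an element of \<open>extend V\<close> this \<open>h\<close> lies in
      \<open>V\<close> as well, hence is 0.\<close>
    let ?I = "extend V \<inter> P"
    have I: "ideal_in ?I J" using idV idP by (auto simp: ideal_in_def)
    let ?S = "{a\<in>J. \<exists>h\<in>?A. a - h \<in> ?I}"
    have AJ: "?A \<subseteq> J" using B_J adjoin1_least[OF J_subring k_J x_J] by blast
    have "subring_on ?S"
    proof (rule subring_onI)
      show "1 \<in> ?S" using J_subring kx ideal_in_0[OF I] by (auto intro!: bexI[of _ 1])
      fix a b assume "a \<in> ?S" "b \<in> ?S"
      then obtain g h where *: "a \<in> J" "b \<in> J" "g \<in> ?A" "h \<in> ?A" "a - g \<in> ?I" "b - h \<in> ?I" by blast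
      have "(a + b) - (g + h) = (a - g) + (b - h)" by simp
      then have "(a + b) - (g + h) \<in> ?I" using ideal_in_add[OF I *(5,6)] by metis
      then show "a + b \<in> ?S" using * J_subring kx by blast
      have "a * b - g * h = b * (a - g) + g * (b - h)" by (simp add: algebra_simps)
      moreover have "b * (a - g) + g * (b - h) \<in> ?I" 
        using * AJ by (intro ideal_in_add[OF I] ideal_in_mult[OF I]) auto
      ultimately have "a * b - g * h \<in> ?I" by metis
      then show "a * b \<in> ?S" using * J_subring kx by blast
    next
      fix a assume "a \<in> ?S"
      then obtain g where *: "a \<in> J" "g \<in> ?A" "a - g \<in> ?I" by blast
      have "- a - (- g) = - (a - g)" by simp
      then have "- a - (- g) \<in> ?I" using ideal_in_uminus[OF J_subring I *(3)] by metis
      then show "- a \<in> ?S" using * J_subring kx by blast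
    qed
    moreover have AS: "?A \<subseteq> ?S"
    proof
      fix h assume h: "h \<in> ?A"
      have "h - h \<in> ?I" using ideal_in_0[OF I] by simp
      then show "h \<in> ?S" using h AJ by blast
    qed
    moreover have "z n \<in> ?S" for n
    proof -
      have "z n - 0 \<in> ?I" using zV zall by simp
      then show ?thesis using z_J kx by blast
    qed
    ultimately have "B n \<subseteq> ?S" for n using adjoin1_base[OF k] adjoin1_gen[OF k] by (intro B_least) blast+
    then obtain h where h: "h \<in> ?A" "a - h \<in> ?I" using aV idV ideal_in_sub unfolding J_eq by blast
    have "h \<in> extend V" using ideal_in_diff_cancel'[OF J_subring idV _ aV] h by blast
    moreover have "h \<in> B 0" using h adjoin1_least[OF B_subring B_k B_x] by blast
    ultimately have "h \<in> V" using extend_prime(2)[OF UV(2) xV] by blast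
    then have "h = 0" using VA h by blast
    then show "a \<in> P" using h by simp
  qed
  then have "extend V \<subset> P" using xP xeV by blast
  moreover have "extend U \<subset> extend V" using z1U z1V UV(4) unfolding extend_def by blast
  moreover have "{0} \<subset> extend U"
  proof -
    have "z 0 \<noteq> 0"
    proof
      assume "z 0 = 0"
      then have "poly [:0,1:] (z 0) = 0" by simp
      moreover have "[:0,1:] \<in> polys_over k" using k by (intro polys_over_pCons polys_over_const) auto
      ultimately have "[:0,1::'a:] = 0" by (rule transcD[OF transc_z, rotated])
      then show False by simp
    qed
    then show ?thesis using zU ideal_in_0[OF prime_in_ideal[OF EU]] by blast
  qed
  ultimately show ?thesis using chain3I[OF prime_in_zero[OF J_subring] EU EV P] by blast
qed

section \<open>Primes strictly above xJ\<close>

text \<open>The polynomials over \<open>k\<close> whose value at z_n lies in \<open>P\<close> form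
  an ideal of a principal ideal domain. Its generator is nonconstant because nonzero constants are
  units.\<close>

lemma field_poly_generator:
  assumes I: "prime_in P J" and I0: "p0 \<in> polys_over k" "p0 \<noteq> 0" "poly p0 (z n) \<in> P"
  obtains g where "g \<in> polys_over k" "pdeg g > 0" "poly g (z n) \<in> P"
    "\<And>p. p \<in> polys_over k \<Longrightarrow> poly p (z n) \<in> P \<Longrightarrow> \<exists>q\<in>polys_over k. p = g * q"
proof -
  note id = prime_in_ideal[OF I] and Sk = subring_on_polys_over[OF k]
  let ?Q = "\<lambda>p. p \<in> polys_over k \<and> p \<noteq> 0 \<and> poly p (z n) \<in> P"
  obtain g where g: "?Q g" "\<And>p. ?Q p \<Longrightarrow> pdeg g \<le> pdeg p"
    using ex_has_least_nat[of ?Q p0 pdeg] I0 by blast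
  have gk: "g \<in> polys_over k" using g by blast
  have unit: "c \<notin> P" if "c \<in> k" "c \<noteq> 0" for c
  proof
    assume "c \<in> P"
    then have "inverse c * c \<in> P" using ideal_in_mult[OF id, of "inverse c"] kinv[OF that(1)] k_J by blast
    then show False using that prime_in_1[OF I] by simp
  qed
  have deg: "pdeg g > 0"
  proof (rule ccontr)
    assume "\<not> ?thesis"
    then obtain c where c: "g = [:c:]" by (metis degree_eq_zeroE gr0I)
    then have "c \<in> k" "c \<noteq> 0" using polys_over_coeff[OF gk, of 0] g by auto
    then show False using unit[of c] g c by simp
  qed
  have "\<exists>q\<in>polys_over k. p = g * q" if p: "p \<in> polys_over k" "poly p (z n) \<in> P" for p
  proof -
    let ?c = "pcoeff g (pdeg g) ^ pdeg p"
    have c: "?c \<in> k" "?c \<noteq> 0" using polys_over_coeff[OF gk] g k by auto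
    obtain H R where HR: "H \<in> polys_over k" "R \<in> polys_over k" "[:?c:] * p = g * H + R" "pdeg R < pdeg g"
      using pseudo_division[OF k gk deg p(1) order_refl] by blast
    have "poly R (z n) = ?c * poly p (z n) - poly H (z n) * poly g (z n)"
      using arg_cong[OF HR(3), of "\<lambda>f. poly f (z n)"] by (simp add: algebra_simps)
    also have "\<dots> \<in> P" using g p c k_J kz_J[OF HR(1)] by (intro ideal_in_diff[OF J_subring id] ideal_in_mult[OF id]) auto
    finally have "R = 0" using g(2)[of R] HR(2,4) by force
    then have "[:inverse ?c:] * ([:?c:] * p) = [:inverse ?c:] * (g * H)" using HR(3) by simp
    then have "p = g * ([:inverse ?c:] * H)" using c by simp
    moreover have "[:inverse ?c:] * H \<in> polys_over k"
      using HR(1) polys_over_const[OF k kinv[OF c(1)]] Sk by blast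
    ultimately show ?thesis by blast
  qed
  then show ?thesis using that gk deg g by blast
qed

text \<open>The element \<open>\<gamma>\<close> is a uniformizer of the localization of \<open>J/xJ\<close> at \<open>P\<close>: for \<open>n \<ge> m\<close> the inclusion 
  \<open>k[\<zeta>\<^sub>m] \<subseteq> k[\<zeta>\<^sub>n]\<close> modulo \<open>x\<close> is \<open>\<zeta>\<^sub>m = \<plusminus>\<zeta>\<^sub>n\<^sup>N\<close>, which in characteristic 0 is unramified away from \<open>\<zeta>\<^sub>n = 0\<close>.\<close>

lemma uniformizer_mod_x:
  assumes P: "prime_in P J" and xP: "xJ \<subset> P" and zP: "\<And>n. z n \<notin> P"
  obtains \<gamma> where "\<gamma> \<in> P" 
    "\<And>a. a \<in> J \<Longrightarrow> a \<notin> xJ \<Longrightarrow> \<exists>w\<in>J-P. \<exists>w'\<in>J-P. \<exists>e. w * a - w' * \<gamma> ^ e \<in> xJ"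
proof -
  note id = prime_in_ideal[OF P] and Sk = subring_on_polys_over[OF k]
  interpret prime_localization J P by (rule prime_loc[OF P])
  obtain a0 where a0: "a0 \<in> P" "a0 \<notin> xJ" using xP by blast
  obtain m p0 where p0: "p0 \<in> polys_over k" "a0 - poly p0 (z m) \<in> xJ" 
    using J_cong[of a0 0] a0 ideal_in_sub[OF id] by blast
  have p0n: "p0 \<noteq> 0" using p0(2) a0(2) by auto
  have p0P: "poly p0 (z m) \<in> P" using ideal_in_diff_cancel'[OF J_subring id, of a0] p0(2) a0(1) xP by blast
  obtain g where g: "g \<in> polys_over k" "pdeg g > 0" "poly g (z m) \<in> P"
    "\<And>p. p \<in> polys_over k \<Longrightarrow> poly p (z m) \<in> P \<Longrightarrow> \<exists>q\<in>polys_over k. p = g * q"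
    using field_poly_generator[OF P p0(1) p0n p0P] by metis
  define \<gamma> where "\<gamma> = poly g (z m)"
  have g': "pderiv g \<in> polys_over k" using g(1) k by (auto simp: polys_over_def coeff_pderiv)
  \<comment> \<open>In characteristic 0 the derivative of \<open>g\<close> is nonzero of smaller
    degree, so it is not a multiple of \<open>g\<close>.\<close>
  have g'P: "poly (pderiv g) (z m) \<notin> P"
  proof
    assume "poly (pderiv g) (z m) \<in> P"
    then obtain q where q: "pderiv g = g * q" using g(4)[OF g'] by blast
    moreover have "pderiv g \<noteq> 0" using g(2) by (simp add: pderiv_eq_0_iff)
    ultimately have "pdeg (pderiv g) = pdeg g + pdeg q" by (metis degree_mult_eq mult_eq_0_iff)
    then show False using g(2) by (simp add: degree_pderiv)
  qed
  \<comment> \<open>Modulo \<open>x\<close>, \<gamma> is the generator \<open>h\<close> of level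
    \<open>n\<close> times some \<open>v\<close> outside \<open>P\<close>; thus one element serves
    all levels.\<close>
  have level: "\<exists>h v. h \<in> polys_over k \<and> v \<in> polys_over k \<and> pdeg h > 0 \<and> poly v (z n) \<notin> P \<and>
     \<gamma> - poly h (z n) * poly v (z n) \<in> xJ \<and> (\<forall>p\<in>polys_over k. poly p (z n) \<in> P \<longrightarrow> (\<exists>q\<in>polys_over k. p = h * q))"
    if n: "m \<le> n" for n
  proof -
    obtain c N where c: "N \<ge> 1" "c = 1 \<or> c = -1" 
      and comp: "\<And>p. p \<in> polys_over k \<Longrightarrow> pcompose p (Polynomial.monom c N) \<in> polys_over k"
      and cong0: "\<And>p. p \<in> polys_over k \<Longrightarrow> poly p (z m) - poly (pcompose p (Polynomial.monom c N)) (z n) \<in> princ (B n) x"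
      using z_cong_poly[OF n] by metis
    have cong: "poly p (z m) - poly (pcompose p (Polynomial.monom c N)) (z n) \<in> xJ" if "p \<in> polys_over k" for p
      using cong0[OF that] princ_B_J by blast
    let ?G = "pcompose g (Polynomial.monom c N)"
    have Gk: "?G \<in> polys_over k" by (rule comp[OF g(1)])
    have GP: "poly ?G (z n) \<in> P" using ideal_in_diff_cancel'[OF J_subring id _ g(3)] cong[OF g(1)] xP by blast
    have "pdeg ?G > 0" using g(2) c by (auto simp: degree_pcompose degree_monom_eq)
    then have "?G \<noteq> 0" by auto
    then obtain h where h: "h \<in> polys_over k" "pdeg h > 0" "poly h (z n) \<in> P"
      "\<And>p. p \<in> polys_over k \<Longrightarrow> poly p (z n) \<in> P \<Longrightarrow> \<exists>q\<in>polys_over k. p = h * q"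
      using field_poly_generator[OF P Gk _ GP] by metis
    obtain v where v: "v \<in> polys_over k" "?G = h * v" using h(4)[OF Gk GP] by blast
    \<comment> \<open>Otherwise \<open>h\<close> would divide the composed polynomial twice, hence
      also its derivative. By the chain rule that derivative takes at z_n the value g'(c z_n^N) N c
      z_n^(N-1), and neither g'(c z_n^N) nor N c z_n^(N-1) lies in \<open>P\<close>.\<close>
    have "poly v (z n) \<notin> P"
    proof
      assume "poly v (z n) \<in> P"
      then obtain v' where v': "v' \<in> polys_over k" "v = h * v'" using h(4)[OF v(1)] by blast
      have "pderiv ?G = h * (pderiv (h * v') + v' * pderiv h)"
        unfolding v(2) v'(2) by (simp add: pderiv_mult algebra_simps)
      then have "poly (pderiv ?G) (z n) = poly (pderiv (h * v') + v' * pderiv h) (z n) * poly h (z n)" by simp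
      moreover have "pderiv (h * v') + v' * pderiv h \<in> polys_over k"
      proof -
        have d: "pderiv f \<in> polys_over k" if "f \<in> polys_over k" for f using that k by (auto simp: polys_over_def coeff_pderiv)
        show ?thesis using d h(1) v'(1) Sk by blast
      qed
      ultimately have 1: "poly (pderiv ?G) (z n) \<in> P" using ideal_in_mult[OF id kz_J h(3)] by metis
      have 2: "poly (pderiv ?G) (z n) = poly (pcompose (pderiv g) (Polynomial.monom c N)) (z n) * (of_nat N * c * z n ^ (N - 1))"
        by (simp add: pderiv_pcompose pderiv_monom poly_monom)
      have "poly (pcompose (pderiv g) (Polynomial.monom c N)) (z n) \<notin> P"
        using ideal_in_diff_cancel[OF J_subring id] cong[OF g'] xP g'P by blast
      moreover have Nc: "of_nat N * c \<in> k" "of_nat N * c \<noteq> 0" using c k by auto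
      have "of_nat N * c * z n ^ (N - 1) \<notin> P"
      proof
        assume "of_nat N * c * z n ^ (N - 1) \<in> P"
        then have "inverse (of_nat N * c) * (of_nat N * c * z n ^ (N - 1)) \<in> P"
          using ideal_in_mult[OF id] kinv[OF Nc(1)] k_J by blast
        moreover have "inverse (of_nat N * c) * (of_nat N * c * z n ^ (N - 1)) = z n ^ (N - 1)"
        proof -
          have "inverse u * (u * y) = y" if "u \<noteq> 0" for u y :: 'a using that by (simp add: mult.assoc[symmetric])
          then show ?thesis using Nc(2) by blast
        qed
        ultimately show False using prime_in_power[OF P J_subring z_J] zP by metis
      qed
      moreover have "of_nat N * c * z n ^ (N - 1) \<in> J" using Nc k_J z_J J_subring by blast
      ultimately show False using prime_in_mult[OF P] 1 kz_J[OF comp[OF g']] unfolding 2 by blast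
    qed
    moreover have "\<gamma> - poly h (z n) * poly v (z n) \<in> xJ" using cong[OF g(1)] v(2) by (simp add: \<gamma>_def)
    ultimately show ?thesis using h v by blast
  qed
  have \<gamma>P: "\<gamma> \<in> P" using g(3) by (simp add: \<gamma>_def)
  then have \<gamma>J: "\<gamma> \<in> J" using ideal_in_sub[OF id] by blast
  \<comment> \<open>Factors \<open>h\<close> are split off one at a time. Each is traded for
    \<gamma> at the cost of a factor \<open>v\<close> outside \<open>P\<close>, and \<open>e\<close>
    counts them.\<close>
  have poly_case: "\<exists>w\<in>J-P. \<exists>w'\<in>J-P. \<exists>e. w * poly p (z n) - w' * \<gamma> ^ e \<in> xJ" 
    if mn: "m \<le> n" and p: "p \<in> polys_over k" "p \<noteq> 0" for n p
    using p
  proof (induction "pdeg p" arbitrary: p rule: less_induct)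
    case (less p)
    show ?case
    proof (cases "poly p (z n) \<in> P")
      case False
      have "1 * poly p (z n) - poly p (z n) * \<gamma> ^ 0 \<in> xJ" using ideal_in_0[OF xJ_ideal] by simp
      then show ?thesis using False kz_J[OF less.prems(1)] denom_1 by blast
    next
      case True
      obtain h v where hv: "h \<in> polys_over k" "v \<in> polys_over k" "pdeg h > 0" "poly v (z n) \<notin> P"
        "\<gamma> - poly h (z n) * poly v (z n) \<in> xJ" "\<exists>q\<in>polys_over k. p = h * q" 
        using level[OF mn] less.prems(1) True by blast
      then obtain q where q: "q \<in> polys_over k" "p = h * q" by blast
      have "pdeg q < pdeg p" "q \<noteq> 0" using q(2) less.prems(2) hv(3) by (auto simp: degree_mult_eq)
      then obtain w w' e where w: "w \<in> J - P" "w' \<in> J - P" "w * poly q (z n) - w' * \<gamma> ^ e \<in> xJ"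
        using less.hyps[OF _ q(1)] by blast
      let ?h = "poly h (z n)" and ?v = "poly v (z n)" and ?q = "poly q (z n)"
      have J1: "?h \<in> J" "?v \<in> J" using hv kz_J by blast+
      have "(w * ?v) * poly p (z n) - w' * \<gamma> ^ Suc e = 
          (?h * ?v) * (w * ?q - w' * \<gamma> ^ e) - (w' * \<gamma> ^ e) * (\<gamma> - ?h * ?v)"
        unfolding q(2) by (simp add: algebra_simps)
      also have "\<dots> \<in> xJ" using w(2) J1 \<gamma>J J_subring
        by (intro ideal_in_diff[OF J_subring xJ_ideal] ideal_in_mult[OF xJ_ideal _ w(3)] ideal_in_mult[OF xJ_ideal _ hv(5)]) auto
      finally have "(w * ?v) * poly p (z n) - w' * \<gamma> ^ Suc e \<in> xJ" .
      moreover have "w * ?v \<in> J - P" using denom_mult w(1) hv(4) J1 by blast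
      ultimately show ?thesis using w(2) by blast
    qed
  qed
  have "\<exists>w\<in>J-P. \<exists>w'\<in>J-P. \<exists>e. w * a - w' * \<gamma> ^ e \<in> xJ" if a: "a \<in> J" "a \<notin> xJ" for a
  proof -
    obtain n p where np: "n \<ge> m" "p \<in> polys_over k" "a - poly p (z n) \<in> xJ" using J_cong[OF a(1)] by blast
    have "p \<noteq> 0" using np(3) a(2) by auto
    then obtain w w' e where w: "w \<in> J - P" "w' \<in> J - P" "w * poly p (z n) - w' * \<gamma> ^ e \<in> xJ"
      using poly_case[OF np(1,2)] by blast
    have "w * (a - poly p (z n)) + (w * poly p (z n) - w' * \<gamma> ^ e) \<in> xJ"
      using w np(3) by (intro ideal_in_add[OF xJ_ideal] ideal_in_mult[OF xJ_ideal]) auto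
    then have "w * a - w' * \<gamma> ^ e \<in> xJ" by (simp add: algebra_simps)
    then show ?thesis using w by blast
  qed
  then show ?thesis using that \<gamma>P by blast
qed

text \<open>\<open>xJ\<close> is prime and does not contain \<open>f\<close>, so each factor
  \<open>x\<close> on the left divides the cofactor \<open>b\<close> and cancels.\<close>

lemma x_power_cancel:
  assumes f: "f \<in> J" "f \<notin> xJ"
  shows "a \<in> J \<Longrightarrow> b \<in> J \<Longrightarrow> x ^ i * a = f * b \<Longrightarrow> a \<in> princ J f"
proof (induction i arbitrary: b)
  case 0
  then have "a = b * f" by (simp add: mult.commute)
  then show ?case using 0(2) unfolding princ_def by blast
next
  case (Suc i)
  have "f * b = x * (x ^ i * a)" using Suc.prems(3) by (simp add: mult.assoc)
  moreover have "x ^ i * a \<in> J" using Suc.prems(1) x_J J_subring by blast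
  ultimately have "f * b \<in> xJ" using xJ_memI by metis
  then have "b \<in> xJ" using prime_in_mult[OF xJ_prime f(1) Suc.prems(2)] f(2) by blast
  then obtain b' where b': "b' \<in> J" "b = x * b'" using xJ_memE by blast
  have "x * (x ^ i * a) = x * (f * b')" using Suc.prems(3) b'(2) by (simp add: mult.assoc mult.left_commute)
  then have "x ^ i * a = f * b'" using x_nz by simp
  then show ?case using Suc.IH Suc.prems(1) b'(1) by blast
qed

text \<open>If the height of \<open>P\<close> is at most 2, all primes below \<open>P\<close> are finitely generated after localization: those 
  not containing \<open>x\<close> are principal because \<open>B 0\<close> is factorial and \<open>J\<close> is \<open>x\<close>-adically separated.\<close>

lemma jaffard_above_xJ:
  assumes P: "prime_in P J" and xP: "xJ \<subset> P" shows "jaffard_domain (localization_at J P)"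
proof (cases "chain3 P")
  case True then show ?thesis by (rule jaffard_if_chain3[OF P])
next
  case nch: False
  note id = prime_in_ideal[OF P] and zeroP = prime_in_zero[OF J_subring]
  interpret prime_localization J P by (rule prime_loc[OF P])
  have xinP: "x \<in> P" using xP princ_self[OF J_subring] by blast
  have zP: "z n \<notin> P" for n using chain3_z[OF P xinP] nch by blast
  have X0: "Xinf = {0}"
  proof (rule ccontr)
    assume "Xinf \<noteq> {0}"
    then have "{0} \<subset> Xinf" using ideal_in_0[OF Xinf_ideal] by blast
    moreover have "Xinf \<subset> xJ" using Xinf_xJ x_Xinf princ_self[OF J_subring] by blast
    ultimately show False using chain3I[OF zeroP Xinf_prime xJ_prime P] xP nch by blast
  qed
  obtain \<gamma> where \<gamma>: "\<gamma> \<in> P" 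
    "\<And>a. a \<in> J \<Longrightarrow> a \<notin> xJ \<Longrightarrow> \<exists>w\<in>J-P. \<exists>w'\<in>J-P. \<exists>e. w * a - w' * \<gamma> ^ e \<in> xJ"
    using uniformizer_mod_x[OF P xP zP] by metis
  have \<gamma>J: "\<gamma> \<in> J" using \<gamma>(1) ideal_in_sub[OF id] by blast
  have "noeth R"
  proof (rule noeth_locI)
    fix q assume q: "prime_in q J" "q \<subseteq> P"
    note idq = prime_in_ideal[OF q(1)]
    have qJ: "q \<subseteq> J" using ideal_in_sub[OF idq] by blast
    show "\<exists>F. finite F \<and> F \<subseteq> q \<and> (\<forall>a\<in>q. \<exists>w\<in>J - P. w * a \<in> ideal_hull J F)"
    proof (cases "x \<in> q")
      case True
      then have xq: "xJ \<subseteq> q" by (rule princ_least[OF idq])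
      have princ_case: "1 * a \<in> ideal_hull J F" if ax: "a \<in> xJ" and xF: "x \<in> F" and FJ: "F \<subseteq> J" for a F
      proof -
        obtain b where "b \<in> J" "a = x * b" using xJ_memE[OF ax] by blast
        then show ?thesis using ideal_hull_memI[OF J_subring FJ _ xF] by (simp add: mult.commute)
      qed
      show ?thesis
      proof (cases "q = xJ")
        case True
        have "1 * a \<in> ideal_hull J {x}" if a: "a \<in> q" for a
          by (rule princ_case[OF a[unfolded True]]) (use x_J in auto)
        then show ?thesis using \<open>x \<in> q\<close> denom_1 by (intro exI[of _ "{x}"]) blast
      next
        case False
        \<comment> \<open>An element of \<open>q\<close> outside \<open>xJ\<close> forces a power of
          \<gamma>, hence \<gamma> itself, into \<open>q\<close>. The same congruence, applied to an
          arbitrary element of \<open>q\<close>, shows that \<open>x\<close> and \<gamma> generate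
          \<open>q\<close> up to denominators.\<close>
        then obtain a where a: "a \<in> q" "a \<notin> xJ" using xq by blast
        then obtain w w' e where w: "w \<in> J - P" "w' \<in> J - P" "w * a - w' * \<gamma> ^ e \<in> xJ" using \<gamma>(2) qJ by blast
        have "w * a \<in> q" using a w by (intro ideal_in_mult[OF idq]) auto
        then have "w' * \<gamma> ^ e \<in> q" using ideal_in_diff_cancel'[OF J_subring idq, of "w * a"] w(3) xq by blast
        then have "\<gamma> ^ e \<in> q" using prime_in_mult[OF q(1), of w' "\<gamma> ^ e"] w(2) q(2) \<gamma>J J_subring by blast
        then have \<gamma>q: "\<gamma> \<in> q" by (rule prime_in_power[OF q(1) J_subring \<gamma>J])
        have F: "{x, \<gamma>} \<subseteq> J" using x_J \<gamma>J by blast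
        have hid: "ideal_in (ideal_hull J {x, \<gamma>}) J" by (rule ideal_hull_ideal[OF J_subring F])
        have "\<exists>w\<in>J-P. w * b \<in> ideal_hull J {x, \<gamma>}" if b: "b \<in> q" for b
        proof (cases "b \<in> xJ")
          case True then show ?thesis using princ_case[OF True _ F] denom_1 by blast
        next
          case False
          then obtain w w' e where w: "w \<in> J - P" "w' \<in> J - P" "w * b - w' * \<gamma> ^ e \<in> xJ" using \<gamma>(2) b qJ by blast
          have "w * b \<in> q" using b w by (intro ideal_in_mult[OF idq]) auto
          then have w\<gamma>: "w' * \<gamma> ^ e \<in> q" using ideal_in_diff_cancel'[OF J_subring idq, of "w * b"] w(3) xq by blast
          have "e \<noteq> 0" using w\<gamma> w(2) q(2) by (cases e) auto
          then obtain e' where e': "e = Suc e'" by (cases e) auto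
          have "w' * \<gamma> ^ e' \<in> J" using w(2) \<gamma>J J_subring by blast
          then have "(w' * \<gamma> ^ e') * \<gamma> \<in> ideal_hull J {x, \<gamma>}" by (intro ideal_hull_memI[OF J_subring F]) auto
          then have "w' * \<gamma> ^ e \<in> ideal_hull J {x, \<gamma>}" unfolding e' by (simp add: mult_ac)
          moreover have "w * b - w' * \<gamma> ^ e \<in> ideal_hull J {x, \<gamma>}" using princ_case[OF w(3) _ F] by simp
          ultimately have "w * b \<in> ideal_hull J {x, \<gamma>}" using ideal_in_diff_cancel[OF J_subring hid] by blast
          then show ?thesis using w(1) by blast
        qed
        then show ?thesis using \<open>x \<in> q\<close> \<gamma>q by (intro exI[of _ "{x, \<gamma>}"]) blast
      qed
    next
      case xq: False
      show ?thesis
      proof (cases "q = {0}")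
        case True
        have "0 \<in> ideal_hull J {}" using ideal_in_0[OF ideal_hull_ideal[OF J_subring]] by blast
        then have "1 * a \<in> ideal_hull J {}" if "a \<in> q" for a using True that by simp
        then show ?thesis using denom_1 by (intro exI[of _ "{}"]) blast
      next
        case False
        then obtain a0 where a0: "a0 \<in> q" "a0 \<noteq> 0" using ideal_in_0[OF idq] by blast
        let ?q = "{a\<in>B 0. a \<in> q}"
        have "prime_in ?q (B 0)" by (rule contract_prime[OF hom_on_id B_subring _ q(1)]) (use B_J in auto)
        moreover have "?q \<noteq> {0}"
        proof -
          obtain e where "x ^ e * a0 \<in> B 0" using J_x_power a0 qJ by blast
          moreover have "x ^ e * a0 \<in> q" using a0 x_J J_subring by (intro ideal_in_mult[OF idq]) auto
          moreover have "x ^ e * a0 \<noteq> 0" using x_nz a0 by simp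
          ultimately show ?thesis by blast
        qed
        ultimately obtain \<pi> where \<pi>: "\<pi> \<in> ?q" "\<pi> \<noteq> 0" "prime_in (princ (B 0) \<pi>) (B 0)"
          using B_pcp unfolding primes_contain_prime_def by blast
        let ?p = "princ (B 0) \<pi>"
        have pq: "?p \<subseteq> q"
        proof
          fix u assume "u \<in> ?p"
          then obtain r where "r \<in> B 0" "u = r * \<pi>" unfolding princ_def by blast
          then show "u \<in> q" using \<pi>(1) B_J ideal_in_mult[OF idq] by blast
        qed
        then have xp: "x \<notin> ?p" using xq by blast
        note E = extend_prime[OF \<pi>(3) xp]
        have xeq: "x ^ e \<notin> q" for e using prime_in_power[OF q(1) J_subring x_J] xq by blast
        have xeJ: "x ^ e \<in> J" for e using x_J J_subring by blast
        have Eq: "extend ?p \<subseteq> q"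
        proof
          fix a assume "a \<in> extend ?p"
          then obtain e where "a \<in> J" "x ^ e * a \<in> q" using pq unfolding extend_def by blast
          then show "a \<in> q" using prime_in_mult[OF q(1) xeJ] xeq by blast
        qed
        have "\<pi> \<in> extend ?p" using E(2) princ_self[OF B_subring] by blast
        then have E0: "{0} \<subset> extend ?p" using \<pi>(2) ideal_in_0[OF prime_in_ideal[OF E(1)]] by blast
        have "q \<subset> P" using q(2) xq xinP by blast
        \<comment> \<open>A strict inclusion of \<open>extend ?p\<close> in \<open>q\<close> would
          complete 0, \<open>extend ?p\<close>, \<open>q\<close>, \<open>P\<close> to a chain of
          length 3.\<close>
        then have qE: "q = extend ?p" using chain3I[OF zeroP E(1) q(1) P E0] Eq nch by blast
        \<comment> \<open>In \<open>J\<close> the element \<pi> may become divisible by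
          \<open>x\<close>: for instance z_1^s(2) + z_0 is prime in \<open>B 0\<close> and equals x
          z_2. The generator is what remains after removing all factors \<open>x\<close>, finitely
          many by \<open>X0\<close>.\<close>
        have "\<pi> \<in> J" "\<pi> \<notin> Xinf" using \<pi> B_J X0 by blast+
        then obtain e f where f: "\<pi> = x ^ e * f" "f \<in> J" "f \<notin> xJ" using x_factor by blast
        have "f \<in> q" using prime_in_mult[OF q(1) xeJ f(2)] \<pi>(1) f(1) xeq by blast
        moreover have "1 * a \<in> ideal_hull J {f}" if "a \<in> q" for a
        proof -
          have "a \<in> extend ?p" using that qE by blast
          then obtain i r where r: "a \<in> J" "r \<in> B 0" "x ^ i * a = r * \<pi>" unfolding extend_def princ_def by blast
          have "x ^ i * a = f * (x ^ e * r)" using r(3) f(1) by (simp add: mult_ac)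
          moreover have "x ^ e * r \<in> J" using xeJ r(2) B_J J_subring by blast
          ultimately have "a \<in> princ J f" using x_power_cancel[OF f(2,3) r(1)] by blast
          then obtain b where "b \<in> J" "a = b * f" unfolding princ_def by blast
          then show ?thesis using ideal_hull_memI[OF J_subring, of "{f}"] f(2) by simp
        qed
        ultimately show ?thesis using denom_1 by (intro exI[of _ "{f}"]) blast
      qed
    qed
  qed
  then show ?thesis by (rule jaffard_if_noeth[OF P])
qed

lemma locally_jaffard_J: "locally_jaffard J"
  unfolding locally_jaffard_def
proof (intro conjI allI impI)
  show "domain (sub_ring J)" by (rule domain_sub_ring[OF J_subring])
  fix P assume "primeideal P (sub_ring J)"
  then have P: "prime_in P J" by (simp add: primeideal_sub_ring[OF J_subring])
  show "jaffard_domain (localization_at J P)"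
  proof (cases "x \<in> P")
    case False then show ?thesis by (rule jaffard_x_notin[OF P])
  next
    case True
    then have "xJ \<subseteq> P" by (rule princ_least[OF prime_in_ideal[OF P]])
    then show ?thesis using jaffard_above_xJ[OF P] jaffard_xJ_dvr jaffard_xJ_height2 by blast
  qed
qed

end

theorem theorem3p6:
  fixes k :: "'a::field_char_0 set" and s :: "nat \<Rightarrow> nat" and x :: 'a and \<zeta> :: "nat \<Rightarrow> 'a"
  assumes "subfield k ring_of_type_algebra"
    and "\<And>n. n \<ge> 2 \<Longrightarrow> s n > 0"
    and "alg_independent k [x, \<zeta> 0, \<zeta> 1]"
    and "\<And>n. n \<ge> 2 \<Longrightarrow> x * \<zeta> n = \<zeta> (n - 1) ^ s n + \<zeta> (n - 2)"
  shows "locally_jaffard (david_J k x \<zeta>)"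
proof -
  interpret david k s x \<zeta>
    by unfold_locales (use subfield_type_algebra[OF assms(1)] assms(2-4) in auto)
  show ?thesis by (rule locally_jaffard_J)
qed

end
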